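(* Let $K\subset\mathbb{R}^n$ and $L\subset\mathbb{R}^m$ be non-trivial closed convex cones, and let $G\in\mathbb{R}^{m\times n}$ be a standard Gaussian matrix. There exists a universal constant $C>0$ such that for every $t\ge 1$: (1) if $\sqrt{\delta(K)}-\sqrt{m-\delta(L)}\le -C\sqrt{t}$, then $\mathbb{P}\big(L\cap GK=\{0\}\big)\ge 1-e^{-t}$; (2) if $\sqrt{\delta(K)}-\sqrt{m-\delta(L)}\ge C\sqrt{t}$, then $\mathbb{P}\big(L\cap GK\neq\{0\}\big)\ge 1-e^{-t}$.
   Context: A standard Gaussian matrix $G\in\mathbb{R}^{m\times n}$ has i.i.d. $\mathcal{N}(0,1)$ entries. For a set $K$, $GK\equiv\{G\mu:\mu\in K\}$. A closed convex cone is non-trivial if it is not $\{0\}$. For a closed convex cone $K\subset\mathbb{R}^n$, the statistical dimension is $\delta(K)\equiv\mathbb{E}\|\Pi_K(g)\|^2$ with $g\sim\mathcal{N}(0,I_n)$, where $\Pi_K(y)=\arg\min_{\mu\in K}\|y-\mu\|$ is the Euclidean metric projection onto $K$ and $\|\cdot\|$ is the Euclidean norm. *)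

theory Defs
  imports "HOL-Probability.Probability"
begin

text \<open>Vectors of R^n are represented as functions nat => real vanishing
  outside the index set {..<n} (dimensions vary inside the statement, since
  the constant C must be universal over all n and m).\<close>

definition Rn :: "nat \<Rightarrow> (nat \<Rightarrow> real) set" where
  "Rn n = {x. \<forall>i\<ge>n. x i = 0}"

definition enorm :: "nat \<Rightarrow> (nat \<Rightarrow> real) \<Rightarrow> real" where
  "enorm n x = sqrt (\<Sum>i<n. (x i)\<^sup>2)"

definition vdiff :: "(nat \<Rightarrow> real) \<Rightarrow> (nat \<Rightarrow> real) \<Rightarrow> (nat \<Rightarrow> real)" where
  "vdiff x y = (\<lambda>i. x i - y i)"

definition closed_convex_cone :: "nat \<Rightarrow> (nat \<Rightarrow> real) set \<Rightarrow> bool" where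
  "closed_convex_cone n K \<longleftrightarrow>
     K \<subseteq> Rn n \<and> (\<lambda>i. 0) \<in> K
     \<and> (\<forall>x\<in>K. \<forall>c::real. c \<ge> 0 \<longrightarrow> (\<lambda>i. c * x i) \<in> K)
     \<and> (\<forall>x\<in>K. \<forall>y\<in>K. \<forall>u::real. 0 \<le> u \<and> u \<le> 1 \<longrightarrow> (\<lambda>i. u * x i + (1 - u) * y i) \<in> K)
     \<and> (\<forall>y\<in>Rn n. (\<forall>e>0. \<exists>x\<in>K. enorm n (vdiff x y) < e) \<longrightarrow> y \<in> K)"

definition proj :: "nat \<Rightarrow> (nat \<Rightarrow> real) set \<Rightarrow> (nat \<Rightarrow> real) \<Rightarrow> (nat \<Rightarrow> real)" where
  "proj n K y = (SOME \<mu>. \<mu> \<in> K \<and> (\<forall>\<nu>\<in>K. enorm n (vdiff y \<mu>) \<le> enorm n (vdiff y \<nu>)))"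

definition std_normal :: "real measure" where
  "std_normal = density lborel std_normal_density"

definition gauss_vec :: "nat \<Rightarrow> (nat \<Rightarrow> real) measure" where
  "gauss_vec n = PiM {..<n} (\<lambda>_. std_normal)"

definition gauss_mat :: "nat \<Rightarrow> nat \<Rightarrow> (nat \<times> nat \<Rightarrow> real) measure" where
  "gauss_mat m n = PiM ({..<m} \<times> {..<n}) (\<lambda>_. std_normal)"

definition ext0 :: "nat \<Rightarrow> (nat \<Rightarrow> real) \<Rightarrow> (nat \<Rightarrow> real)" where
  "ext0 n g = (\<lambda>i. if i < n then g i else 0)"

definition stat_dim :: "nat \<Rightarrow> (nat \<Rightarrow> real) set \<Rightarrow> real" where
  "stat_dim n K = (\<integral>g. (enorm n (proj n K (ext0 n g)))\<^sup>2 \<partial>gauss_vec n)"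

definition matvec :: "nat \<Rightarrow> nat \<Rightarrow> (nat \<times> nat \<Rightarrow> real) \<Rightarrow> (nat \<Rightarrow> real) \<Rightarrow> (nat \<Rightarrow> real)" where
  "matvec m n G \<mu> = (\<lambda>i. if i < m then (\<Sum>j<n. G (i, j) * \<mu> j) else 0)"

end

theory Submission
  imports Defs
begin

text \<open>
  For \<open>G \<mu>\<close> to meet \<open>L\<close> away from \<open>0\<close> there must be a unit vector \<open>\<mu>\<close> of \<open>K\<close> with \<open>\<langle>v, G \<mu>\<rangle> \<le> 0\<close> for
  all unit vectors \<open>v\<close> of the polar cone of \<open>L\<close>. Gordon's inequality compares the Gaussian process
  \<open>\<langle>v, G \<mu>\<rangle> + z\<close> with \<open>\<langle>v, h\<rangle> - \<langle>\<mu>, g\<rangle>\<close> and bounds the probability of this event by the one of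
  \<open>dist(h, L) \<le> \<parallel>\<Pi>\<^sub>K g\<parallel>\<close>. Both sides are 1-Lipschitz functions of a Gaussian vector, whose means are
  \<open>sqrt (m - \<delta>(L))\<close> and \<open>sqrt (\<delta>(K))\<close> up to 2, so Gaussian concentration gives (1). For (2) the same
  bound is applied to the transposed matrix and to the dual cones: if no unit vector \<open>v\<close> that is
  nonnegative on \<open>L\<close> satisfies \<open>\<langle>v, G \<mu>\<rangle> \<le> 1\<close> on the unit sphere of \<open>K\<close>, then \<open>G K - L\<close> is the whole
  space.

  Gordon's inequality is proved by Lindeberg's replacement method, which needs no integration
  by parts, and concentration by Maurey's property (tau): \<open>f x * g y \<le> exp (\<parallel>x - y\<parallel>\<^sup>2 / 4)\<close> implies
  \<open>\<integral>f * \<integral>g \<le> 1\<close>, which follows from the Prekopa-Leindler inequality on the line and tensorizes.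
\<close>

section \<open>Gaussian concentration\<close>

text \<open>Gordon's comparison concerns finite index sets and smooth functions, while the events
  here range over whole spheres and are sharp. The passages between the two shift a threshold by
  small constants, which a large \<open>C\<close> absorbs because \<open>sqrt t\<close> is at least
  1; for the same reason tails \<open>exp (- r\<^sup>2 / 4)\<close> are good enough.

  The value 19 is dictated by (2). Deviations \<open>r = 4 * sqrt t\<close> give tails
  \<open>exp (- 4 * t)\<close>, four of which sum to at most \<open>exp (- t)\<close>. The side of
  \<open>K\<close> deviates by \<open>r\<close>, the side of \<open>L\<close> by
  \<open>2 * r\<close>, because it carries an extra term that makes it 2-Lipschitz. Adding the
  threshold shifts 4, the bound 2 between mean and root mean square, and the mean 1 of the extra
  term, the budget is \<open>12 * sqrt t + 7\<close>, at most \<open>19 * sqrt t\<close>.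

  The extra term comes from the delicate point of (2): the common point must be nonzero. It is found
  in the form \<open>w + l\<close> with a fixed unit vector \<open>w\<close> and some
  \<open>l\<close>, both in the cone, and it can vanish only if \<open>- w\<close> is in the cone. A
  subspace has no suitable \<open>w\<close> and must first be cut down.\<close>

lemma sets_std_normal [simp, measurable_cong]: "sets std_normal = sets borel"
  and space_std_normal [simp]: "space std_normal = UNIV"
  by (simp_all add: std_normal_def)

abbreviation gauss_on :: "'k set \<Rightarrow> ('k \<Rightarrow> real) measure" where
  "gauss_on A \<equiv> PiM A (\<lambda>_. std_normal)"

lemma prob_space_std_normal: "prob_space std_normal"
  unfolding std_normal_def by (rule prob_space_normal_density) simp

lemma prob_space_gauss_on: "prob_space (gauss_on A)"
  by (intro prob_space_PiM prob_space_std_normal)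

interpretation std_normal: prob_space std_normal
  by (rule prob_space_std_normal)

interpretation gauss: product_sigma_finite "\<lambda>_. std_normal"
  by unfold_locales

section \<open>Property (tau) of the Gaussian measure, on the line and for products\<close>

lemma nn_integral_layer_cake:
  fixes u :: "real \<Rightarrow> real"
  assumes [measurable]: "u \<in> borel_measurable borel" and nn: "\<And>x. 0 \<le> u x"
  shows "(\<integral>\<^sup>+x. ennreal (u x) \<partial>lborel)
       = (\<integral>\<^sup>+s. indicator {0<..} s * emeasure lborel {x. s < u x} \<partial>lborel)"
proof -
  have 1: "ennreal (u x) = (\<integral>\<^sup>+s. indicator {0<..<u x} s \<partial>lborel)" for x
    using nn[of x] by simp
  have "(\<integral>\<^sup>+x. ennreal (u x) \<partial>lborel) = (\<integral>\<^sup>+x. (\<integral>\<^sup>+s. indicator {0<..<u x} s \<partial>lborel) \<partial>lborel)"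
    by (simp add: 1)
  also have "\<dots> = (\<integral>\<^sup>+x. (\<integral>\<^sup>+s. indicator {p. 0 < snd p \<and> snd p < u (fst p)} (x, s) \<partial>lborel) \<partial>lborel)"
    by (intro nn_integral_cong) (auto split: split_indicator)
  also have "\<dots> = (\<integral>\<^sup>+s. (\<integral>\<^sup>+x. indicator {p. 0 < snd p \<and> snd p < u (fst p)} (x, s) \<partial>lborel) \<partial>lborel)"
    by (rule lborel_pair.Fubini'[symmetric]) measurable
  also have "\<dots> = (\<integral>\<^sup>+s. indicator {0<..} s * (\<integral>\<^sup>+x. indicator {x. s < u x} x \<partial>lborel) \<partial>lborel)"
    by (subst nn_integral_cmult[symmetric]; (intro nn_integral_cong)?) (auto split: split_indicator)
  finally show ?thesis by simp
qed

lemma emeasure_lborel_le_diameter: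
  fixes A :: "real set"
  assumes "A \<noteq> {}" "bdd_above A" "bdd_below A"
  shows "emeasure lborel A \<le> ennreal (Sup A - Inf A)"
proof -
  have "emeasure lborel A \<le> emeasure lborel {Inf A..Sup A}"
    using assms by (intro emeasure_mono) (auto intro: cInf_lower cSup_upper)
  also have "\<dots> = ennreal (Sup A - Inf A)"
    using assms by (simp add: cInf_le_cSup)
  finally show ?thesis .
qed

text \<open>The one-dimensional Brunn-Minkowski inequality in the form in which it is used: the
  sumset is known to lie in an interval, so it suffices to compare the suprema and the infima of the
  two sets.\<close>

lemma emeasure_add_le_of_sums_in_interval:
  fixes A B :: "real set"
  assumes ne: "A \<noteq> {}" "B \<noteq> {}" and sum: "\<And>x y. x \<in> A \<Longrightarrow> y \<in> B \<Longrightarrow> \<bar>x + y\<bar> \<le> 2 * r"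
  shows "emeasure lborel A + emeasure lborel B \<le> ennreal (4 * r)"
proof -
  obtain x0 y0 where xy: "x0 \<in> A" "y0 \<in> B" using ne by blast
  have bA: "bdd_above A" "bdd_below A"
    using sum[OF _ xy(2)] by (auto intro!: bdd_aboveI[of _ "2*r - y0"] bdd_belowI[of _ "-2*r - y0"] simp: abs_le_iff) (smt (verit))+
  have bB: "bdd_above B" "bdd_below B"
    using sum[OF xy(1)] by (auto intro!: bdd_aboveI[of _ "2*r - x0"] bdd_belowI[of _ "-2*r - x0"] simp: abs_le_iff) (smt (verit))+
  have "Sup A \<le> 2 * r - y" if "y \<in> B" for y
    using sum[OF _ that] ne by (intro cSup_least) (auto simp: abs_le_iff, smt (verit))
  hence "y \<le> 2 * r - Sup A" if "y \<in> B" for y using that by (smt (verit))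
  hence 1: "Sup B \<le> 2 * r - Sup A" using ne by (intro cSup_least) auto
  have "Inf A \<ge> - 2 * r - y" if "y \<in> B" for y
    using sum[OF _ that] ne by (intro cInf_greatest) (auto simp: abs_le_iff, smt (verit))
  hence "y \<ge> - 2 * r - Inf A" if "y \<in> B" for y using that by (smt (verit))
  hence 2: "Inf B \<ge> - 2 * r - Inf A" using ne by (intro cInf_greatest) auto
  have "emeasure lborel A + emeasure lborel B \<le> ennreal (Sup A - Inf A) + ennreal (Sup B - Inf B)"
    using bA bB ne by (intro add_mono emeasure_lborel_le_diameter)
  also have "\<dots> = ennreal ((Sup A - Inf A) + (Sup B - Inf B))"
    using bA bB ne by (intro ennreal_plus[symmetric]) (auto simp: cInf_le_cSup)
  also have "\<dots> \<le> ennreal (4 * r)" using 1 2 by (intro ennreal_leI) linarith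
  finally show ?thesis .
qed

text \<open>The Prekopa-Leindler inequality on the line, in the case where the middle function is a
  Gaussian bump: its superlevel sets are intervals.\<close>

lemma nn_integral_add_le_gaussian_bump:
  fixes u v :: "real \<Rightarrow> real"
  assumes [measurable]: "u \<in> borel_measurable borel" "v \<in> borel_measurable borel"
    and u: "\<And>x. 0 \<le> u x" "\<And>x. u x \<le> 1" "\<And>s. s < 1 \<Longrightarrow> \<exists>x. s < u x"
    and v: "\<And>x. 0 \<le> v x" "\<And>x. v x \<le> 1" "\<And>s. s < 1 \<Longrightarrow> \<exists>x. s < v x"
    and c: "0 < c" and uv: "\<And>x y. u x * v y \<le> (c * exp (- ((x + y) / 2)\<^sup>2 / 2))\<^sup>2"
  shows "(\<integral>\<^sup>+x. ennreal (u x) \<partial>lborel) + (\<integral>\<^sup>+x. ennreal (v x) \<partial>lborel)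
    \<le> 2 * (\<integral>\<^sup>+x. ennreal (c * exp (- x\<^sup>2 / 2)) \<partial>lborel)"
proof -
  let ?w = "\<lambda>x. c * exp (- x\<^sup>2 / 2)"
  have level: "emeasure lborel {x. s < u x} + emeasure lborel {x. s < v x}
      \<le> 2 * emeasure lborel {x. s < ?w x}" if s: "0 < s" for s
  \<comment> \<open>For s >= 1 both level sets on the left are empty. For s < 1 both are nonempty
    because the suprema are normalized to 1; if only one of them were empty, nothing would bound the
    length of the other.\<close>
  proof (cases "s < 1")
    case False
    hence "{x. s < u x} = {}" "{x. s < v x} = {}" using u(2) v(2) by (auto simp: not_less) (meson order_trans)+
    thus ?thesis by simp
  next
    case True
    define \<rho> where "\<rho> = 2 * ln (c / s)"
    define r where "r = sqrt \<rho>"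
    have w: "s < ?w z \<longleftrightarrow> z\<^sup>2 < \<rho>" for z
    proof -
      have "s < ?w z \<longleftrightarrow> s / c < exp (- z\<^sup>2 / 2)" using c by (simp add: field_simps)
      also have "\<dots> \<longleftrightarrow> ln (s / c) < - z\<^sup>2 / 2" using c s
        by (metis divide_pos_pos exp_less_cancel_iff exp_ln)
      also have "\<dots> \<longleftrightarrow> z\<^sup>2 < \<rho>" using c s by (auto simp: \<rho>_def ln_div)
      finally show ?thesis .
    qed
    \<comment> \<open>The midpoint of a point of one level set and a point of the other lies in the
      level set of the bump: the product of two values above s exceeds the square of s.\<close>
    have in_w: "((x + y) / 2)\<^sup>2 < \<rho>" if "s < u x" "s < v y" for x y
    proof -
      have "s\<^sup>2 < u x * v y" using that s unfolding power2_eq_square by (intro mult_strict_mono) auto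
      also have "\<dots> \<le> (?w ((x + y) / 2))\<^sup>2" using uv[of x y] by simp
      finally have "s < ?w ((x + y) / 2)" using c s by (auto intro: power2_less_imp_less)
      thus ?thesis using w by blast
    qed
    obtain x0 y0 where "s < u x0" "s < v y0" using u(3) v(3) True by blast
    with in_w have "0 \<le> ((x0 + y0) / 2)\<^sup>2" "((x0 + y0) / 2)\<^sup>2 < \<rho>" by auto
    hence \<rho>: "0 < \<rho>" by linarith
    have sq: "z\<^sup>2 < \<rho> \<longleftrightarrow> \<bar>z\<bar> < r" for z
      unfolding r_def using \<rho> by (metis real_sqrt_abs real_sqrt_less_iff)
    have "emeasure lborel {x. s < ?w x} = emeasure lborel {-r<..<r}"
      unfolding w sq by (intro arg_cong2[where f=emeasure]) auto
    also have "\<dots> = ennreal (2 * r)" using \<rho> by (simp add: r_def)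
    finally have C: "emeasure lborel {x. s < ?w x} = ennreal (2 * r)" .
    have "emeasure lborel {x. s < u x} + emeasure lborel {x. s < v x} \<le> ennreal (4 * r)"
    proof (rule emeasure_add_le_of_sums_in_interval)
      fix x y assume "x \<in> {x. s < u x}" "y \<in> {x. s < v x}"
      hence "\<bar>(x + y) / 2\<bar> < r" using in_w sq by blast
      hence "- r < (x + y) / 2" "(x + y) / 2 < r" by linarith+
      thus "\<bar>x + y\<bar> \<le> 2 * r" by (simp add: abs_le_iff)
    qed (use \<open>s < u x0\<close> \<open>s < v y0\<close> in auto)
    also have "\<dots> = 2 * ennreal (2 * r)"
      using ennreal_mult''[of "2 * r" 2] \<rho> by (simp add: r_def)
    finally show ?thesis unfolding C .
  qed
  have [measurable]: "(\<lambda>s. emeasure lborel {x. s < f x}) \<in> borel_measurable borel"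
    if [measurable]: "f \<in> borel_measurable borel" for f :: "real \<Rightarrow> real"
    by measurable
  have "(\<integral>\<^sup>+x. ennreal (u x) \<partial>lborel) + (\<integral>\<^sup>+x. ennreal (v x) \<partial>lborel)
     = (\<integral>\<^sup>+s. indicator {0<..} s * emeasure lborel {x. s < u x}
         + indicator {0<..} s * emeasure lborel {x. s < v x} \<partial>lborel)"
    using u v by (simp add: nn_integral_layer_cake nn_integral_add)
  also have "\<dots> \<le> (\<integral>\<^sup>+s. 2 * (indicator {0<..} s * emeasure lborel {x. s < ?w x}) \<partial>lborel)"
    using level by (intro nn_integral_mono) (auto split: split_indicator)
  also have "\<dots> = 2 * (\<integral>\<^sup>+x. ennreal (?w x) \<partial>lborel)"
    using c by (subst nn_integral_layer_cake) (auto simp: nn_integral_cmult)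
  finally show ?thesis .
qed

text \<open>The exponent (x - y)^2 / 4 completes -x^2/2 - y^2/2 to minus the square of the midpoint,
  so after multiplication by the density the hypothesis says that \<open>u x * v y\<close> is at
  most the squared density at the midpoint. Dividing \<open>u\<close> and \<open>v\<close> by their
  suprema \<open>a\<close> and \<open>b\<close> makes the additive inequality above applicable, and
  the inequality between arithmetic and geometric mean turns its sum \<open>P / a + Q / b\<close>
  into the product \<open>P * Q\<close>.\<close>

lemma nn_integral_mult_le_one_real:
  fixes f g :: "real \<Rightarrow> real"
  assumes [measurable]: "f \<in> borel_measurable borel" "g \<in> borel_measurable borel"
    and nn: "\<And>x. 0 \<le> f x" "\<And>x. 0 \<le> g x"
    and fg: "\<And>x y. f x * g y \<le> exp ((x - y)\<^sup>2 / 4)"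
  shows "(\<integral>\<^sup>+x. ennreal (f x) \<partial>std_normal) * (\<integral>\<^sup>+x. ennreal (g x) \<partial>std_normal) \<le> 1"
proof (cases "(\<forall>x. f x = 0) \<or> (\<forall>x. g x = 0)")
  case True
  thus ?thesis by auto
next
  case False
  then obtain x0 y0 where x0: "f x0 > 0" and y0: "g y0 > 0" using nn by (metis less_eq_real_def)
  define u where "u = (\<lambda>x. f x * std_normal_density x)"
  define v where "v = (\<lambda>x. g x * std_normal_density x)"
  have [measurable]: "u \<in> borel_measurable borel" "v \<in> borel_measurable borel"
    unfolding u_def v_def by measurable
  have nn': "0 \<le> u x" "0 \<le> v x" for x using nn by (simp_all add: u_def v_def)
  define K where "K = 1 / sqrt (2 * pi)"
  have K: "K > 0" by (simp add: K_def)
  have uv: "u x * v y \<le> (K * exp (- ((x + y) / 2)\<^sup>2 / 2))\<^sup>2" for x y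
  proof -
    have "u x * v y = (f x * g y) * (std_normal_density x * std_normal_density y)"
      by (simp add: u_def v_def)
    also have "\<dots> \<le> exp ((x - y)\<^sup>2 / 4) * (std_normal_density x * std_normal_density y)"
      by (intro mult_right_mono fg) simp
    also have "\<dots> = K\<^sup>2 * (exp ((x - y)\<^sup>2 / 4) * exp (- x\<^sup>2 / 2) * exp (- y\<^sup>2 / 2))"
      by (simp add: std_normal_density_def K_def power2_eq_square)
    also have "\<dots> = K\<^sup>2 * exp ((x - y)\<^sup>2 / 4 + - x\<^sup>2 / 2 + - y\<^sup>2 / 2)"
      by (simp only: exp_add)
    also have "(x - y)\<^sup>2 / 4 + - x\<^sup>2 / 2 + - y\<^sup>2 / 2 = 2 * (- ((x + y) / 2)\<^sup>2 / 2)"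
      by (simp add: power2_eq_square field_simps)
    finally show ?thesis by (simp only: power_mult_distrib exp_double)
  qed
  have "0 < u x0" "0 < v y0" using x0 y0 by (simp_all add: u_def v_def normal_density_pos)
  have uv': "u x * v y \<le> K\<^sup>2" for x y
    by (rule order_trans[OF uv], rule power_mono) (use K in auto)
  \<comment> \<open>One positive value of \<open>v\<close> bounds \<open>u\<close> through the bound
    on the product, and conversely; the suprema used for the normalization are therefore
    finite.\<close>
  have bu: "bdd_above (range u)" using uv'[of _ y0] \<open>0 < v y0\<close>
    by (auto intro!: bdd_aboveI[of _ "K\<^sup>2 / v y0"] simp: field_simps)
  have bv: "bdd_above (range v)" using uv'[of x0] \<open>0 < u x0\<close>
    by (auto intro!: bdd_aboveI[of _ "K\<^sup>2 / u x0"] simp: field_simps)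
  define a where "a = Sup (range u)"
  define b where "b = Sup (range v)"
  have ua: "u x \<le> a" for x using bu by (auto simp: a_def intro: cSup_upper)
  have vb: "v x \<le> b" for x using bv by (auto simp: b_def intro: cSup_upper)
  have ab: "0 < a" "0 < b" using ua[of x0] vb[of y0] \<open>0 < u x0\<close> \<open>0 < v y0\<close> by auto
  define c where "c = K / sqrt (a * b)"
  have c: "0 < c" using K ab by (simp add: c_def)
  have "(\<integral>\<^sup>+x. ennreal (u x / a) \<partial>lborel) + (\<integral>\<^sup>+x. ennreal (v x / b) \<partial>lborel)
    \<le> 2 * (\<integral>\<^sup>+x. ennreal (c * exp (- x\<^sup>2 / 2)) \<partial>lborel)"
  proof (rule nn_integral_add_le_gaussian_bump)
    show "\<exists>x. s < u x / a" if "s < 1" for s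
    proof -
      have "s * a < Sup (range u)" using that ab by (simp add: a_def[symmetric])
      then obtain x where "s * a < u x" using bu by (subst (asm) less_cSup_iff) auto
      thus ?thesis using ab by (auto simp: field_simps)
    qed
    show "\<exists>x. s < v x / b" if "s < 1" for s
    proof -
      have "s * b < Sup (range v)" using that ab by (simp add: b_def[symmetric])
      then obtain x where "s * b < v x" using bv by (subst (asm) less_cSup_iff) auto
      thus ?thesis using ab by (auto simp: field_simps)
    qed
    show "u x / a * (v y / b) \<le> (c * exp (- ((x + y) / 2)\<^sup>2 / 2))\<^sup>2" for x y
    proof -
      have "u x / a * (v y / b) = u x * v y / (a * b)" by simp
      also have "\<dots> \<le> (K * exp (- ((x + y) / 2)\<^sup>2 / 2))\<^sup>2 / (a * b)"
        using ab by (intro divide_right_mono uv) simp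
      also have "\<dots> = (c * exp (- ((x + y) / 2)\<^sup>2 / 2))\<^sup>2"
        using ab by (simp add: c_def power_mult_distrib power_divide)
      finally show ?thesis .
    qed
  qed (use nn' ua vb ab c in auto)
  also have "(\<integral>\<^sup>+x. ennreal (c * exp (- x\<^sup>2 / 2)) \<partial>lborel) = (\<integral>\<^sup>+x. ennreal (1 / sqrt (a * b)) * ennreal (std_normal_density x) \<partial>lborel)"
    using ab by (intro nn_integral_cong) (simp add: c_def K_def std_normal_density_def flip: ennreal_mult)
  also have "\<dots> = ennreal (1 / sqrt (a * b)) * emeasure std_normal (space std_normal)"
    by (subst nn_integral_cmult) (auto simp: std_normal_def emeasure_density)
  also have "\<dots> = ennreal (1 / sqrt (a * b))"
    using std_normal.emeasure_space_1 by simp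
  finally have sum: "(\<integral>\<^sup>+x. ennreal (u x / a) \<partial>lborel) + (\<integral>\<^sup>+x. ennreal (v x / b) \<partial>lborel)
    \<le> 2 * ennreal (1 / sqrt (a * b))" .
  define P Q where "P = enn2real (\<integral>\<^sup>+x. ennreal (u x) \<partial>lborel)" and "Q = enn2real (\<integral>\<^sup>+x. ennreal (v x) \<partial>lborel)"
  have ea: "(\<integral>\<^sup>+x. ennreal (u x / a) \<partial>lborel) = ennreal (1 / a) * (\<integral>\<^sup>+x. ennreal (u x) \<partial>lborel)"
    using ab nn' by (subst nn_integral_cmult[symmetric]) (auto simp: ennreal_mult'[symmetric] intro!: nn_integral_cong)
  have eb: "(\<integral>\<^sup>+x. ennreal (v x / b) \<partial>lborel) = ennreal (1 / b) * (\<integral>\<^sup>+x. ennreal (v x) \<partial>lborel)"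
    using ab nn' by (subst nn_integral_cmult[symmetric]) (auto simp: ennreal_mult'[symmetric] intro!: nn_integral_cong)
  have "2 * ennreal (1 / sqrt (a * b)) < \<infinity>" by (simp add: ennreal_mult_less_top)
  with sum have "(\<integral>\<^sup>+x. ennreal (u x / a) \<partial>lborel) < \<infinity>" "(\<integral>\<^sup>+x. ennreal (v x / b) \<partial>lborel) < \<infinity>"
    by (auto simp: less_top[symmetric] top_unique)
  hence fin: "(\<integral>\<^sup>+x. ennreal (u x) \<partial>lborel) = ennreal P" "(\<integral>\<^sup>+x. ennreal (v x) \<partial>lborel) = ennreal Q"
    unfolding ea eb P_def Q_def using ab by (auto simp: ennreal_mult_less_top less_top)
  have PQ: "0 \<le> P" "0 \<le> Q" by (simp_all add: P_def Q_def)
  have "ennreal (P / a + Q / b) \<le> ennreal (2 / sqrt (a * b))"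
    using sum ab PQ unfolding ea eb fin
    by (simp add: ennreal_mult'[symmetric] ennreal_plus[symmetric] ennreal_mult''[of 2, simplified, symmetric] numeral_mult_ennreal del: ennreal_plus)
  hence le: "P / a + Q / b \<le> 2 / sqrt (a * b)" using ab by (simp add: ennreal_le_iff)
  have "4 * p * q \<le> (p + q)\<^sup>2" for p q :: real
    using zero_le_power2[of "p - q"] by (simp add: power2_eq_square algebra_simps)
  hence "4 * (P / a) * (Q / b) \<le> (P / a + Q / b)\<^sup>2" .
  also have "\<dots> \<le> (2 / sqrt (a * b))\<^sup>2" using le PQ ab by (intro power_mono) auto
  also have "\<dots> = 4 / (a * b)" using ab by (simp add: power_divide)
  finally have "P * Q \<le> 1" using ab by (simp add: field_simps)
  moreover have "(\<integral>\<^sup>+x. ennreal (f x) \<partial>std_normal) = ennreal P" "(\<integral>\<^sup>+x. ennreal (g x) \<partial>std_normal) = ennreal Q"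
    unfolding fin[symmetric] std_normal_def u_def v_def using nn
    by (auto simp: nn_integral_density ennreal_mult' mult.commute)
  ultimately show ?thesis using PQ by (simp add: ennreal_mult'[symmetric])
qed

text \<open>An infinite value of one function forces the other to vanish everywhere, so apart from
  the trivial case both are real valued. The induction over coordinates needs the extended form, as
  its partial integrals are a priori possibly infinite.\<close>

lemma nn_integral_mult_le_one_ennreal:
  fixes f g :: "real \<Rightarrow> ennreal"
  assumes [measurable]: "f \<in> borel_measurable borel" "g \<in> borel_measurable borel"
    and fg: "\<And>x y. f x * g y \<le> ennreal (exp ((x - y)\<^sup>2 / 4))"
  shows "(\<integral>\<^sup>+x. f x \<partial>std_normal) * (\<integral>\<^sup>+x. g x \<partial>std_normal) \<le> 1"
proof (cases "(\<forall>x. f x = 0) \<or> (\<forall>x. g x = 0)")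
  case True
  thus ?thesis by auto
next
  case False
  then obtain x0 y0 where x0: "f x0 \<noteq> 0" and y0: "g y0 \<noteq> 0" by blast
  have f: "f x = ennreal (enn2real (f x))" for x
    using fg[of x y0] y0 by (cases "f x") (auto simp: ennreal_top_mult top_unique)
  have g: "g x = ennreal (enn2real (g x))" for x
    using fg[of x0 x] x0 by (cases "g x") (auto simp: ennreal_mult_top top_unique)
  have "enn2real (f x) * enn2real (g y) \<le> exp ((x - y)\<^sup>2 / 4)" for x y
    using fg[of x y] by (subst (asm) f, subst (asm) g) (simp add: ennreal_mult'[symmetric])
  from nn_integral_mult_le_one_real[OF _ _ _ _ this] show ?thesis
    by (simp flip: f g)
qed

text \<open>Tensorization: with the new coordinates \<open>s\<close> and \<open>r\<close> fixed, the
  induction hypothesis is applied to the section of \<open>f\<close> at \<open>s\<close> and the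
  section of \<open>g\<close> at \<open>r\<close> damped by
  \<open>exp (- (s - r)\<^sup>2 / 4)\<close>. The result is exactly the one-dimensional hypothesis
  for the partial integrals \<open>F\<close> and \<open>G\<close>.\<close>

lemma nn_integral_mult_le_one_PiM:
  fixes f g :: "('k \<Rightarrow> real) \<Rightarrow> ennreal"
  assumes "finite A"
    and "f \<in> borel_measurable (gauss_on A)" "g \<in> borel_measurable (gauss_on A)"
    and "\<And>x y. x \<in> space (gauss_on A) \<Longrightarrow> y \<in> space (gauss_on A) \<Longrightarrow>
            f x * g y \<le> ennreal (exp ((\<Sum>k\<in>A. (x k - y k)\<^sup>2) / 4))"
  shows "(\<integral>\<^sup>+x. f x \<partial>gauss_on A) * (\<integral>\<^sup>+x. g x \<partial>gauss_on A) \<le> 1"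
  using assms
proof (induction A arbitrary: f g rule: finite_induct)
  case empty
  show ?case using empty(3)[of "\<lambda>_. undefined" "\<lambda>_. undefined"]
    by (simp add: gauss.nn_integral_empty space_PiM)
next
  case (insert i A)
  note [measurable] = insert.prems(1,2)
  note [simp] = insert.hyps
  let ?M = "gauss_on A"
  define F where "F = (\<lambda>s. \<integral>\<^sup>+x. f (x(i := s)) \<partial>?M)"
  define G where "G = (\<lambda>s. \<integral>\<^sup>+x. g (x(i := s)) \<partial>?M)"
  interpret prob_space ?M by (rule prob_space_gauss_on)
  have [measurable]: "F \<in> borel_measurable borel" "G \<in> borel_measurable borel"
    unfolding F_def G_def by (measurable, measurable)
  have "F s * G r \<le> ennreal (exp ((s - r)\<^sup>2 / 4))" for s r
  proof -
    let ?e = "ennreal (exp (- (s - r)\<^sup>2 / 4))"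
    have 1: "f (x(i := s)) * (g (y(i := r)) * ?e) \<le> ennreal (exp ((\<Sum>k\<in>A. (x k - y k)\<^sup>2) / 4))"
      if "x \<in> space ?M" "y \<in> space ?M" for x y
    proof -
      have eq: "(\<Sum>k\<in>insert i A. ((x(i := s)) k - (y(i := r)) k)\<^sup>2) = (s - r)\<^sup>2 + (\<Sum>k\<in>A. (x k - y k)\<^sup>2)"
        by (subst sum.insert) (auto intro!: sum.cong)
      have "f (x(i := s)) * g (y(i := r)) \<le> ennreal (exp (((s - r)\<^sup>2 + (\<Sum>k\<in>A. (x k - y k)\<^sup>2)) / 4))"
        using that unfolding eq[symmetric] by (intro insert.prems(3)) (auto simp: space_PiM PiE_iff extensional_def)
      hence "f (x(i := s)) * g (y(i := r)) * ?e \<le> ennreal (exp (((s - r)\<^sup>2 + (\<Sum>k\<in>A. (x k - y k)\<^sup>2)) / 4)) * ?e"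
        by (rule mult_right_mono) simp
      also have "\<dots> = ennreal (exp ((\<Sum>k\<in>A. (x k - y k)\<^sup>2) / 4))"
        by (simp add: ennreal_mult'[symmetric] exp_add[symmetric] field_simps)
      finally show ?thesis by (simp add: mult.assoc)
    qed
    have [measurable]: "(\<lambda>x. x(i := t)) \<in> ?M \<rightarrow>\<^sub>M gauss_on (insert i A)" for t :: real
      by measurable
    have "F s * (\<integral>\<^sup>+y. g (y(i := r)) * ?e \<partial>?M) \<le> 1"
      unfolding F_def by (rule insert.IH[OF _ _ 1]) measurable
    also have "(\<integral>\<^sup>+y. g (y(i := r)) * ?e \<partial>?M) = G r * ?e"
      unfolding G_def by (rule nn_integral_multc) measurable
    finally have "F s * G r * ?e \<le> 1" by (simp add: mult.assoc)
    hence "F s * G r * ?e * ennreal (exp ((s - r)\<^sup>2 / 4)) \<le> 1 * ennreal (exp ((s - r)\<^sup>2 / 4))"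
      by (rule mult_right_mono) simp
    moreover have "?e * ennreal (exp ((s - r)\<^sup>2 / 4)) = 1"
      by (simp add: ennreal_mult'[symmetric] exp_add[symmetric])
    ultimately show ?thesis by (simp add: mult.assoc)
  qed
  hence "(\<integral>\<^sup>+s. F s \<partial>std_normal) * (\<integral>\<^sup>+s. G s \<partial>std_normal) \<le> 1"
    by (intro nn_integral_mult_le_one_ennreal) auto
  thus ?case
    by (simp add: gauss.product_nn_integral_insert_rev F_def G_def)
qed

section \<open>Moments of standard Gaussian vectors\<close>

lemma integrable_std_normal_power: "integrable std_normal (\<lambda>x. \<bar>x\<bar> ^ k)" "integrable std_normal (\<lambda>x. x ^ k)"
  unfolding std_normal_def
  using integrable_std_normal_moment_abs[of k] integrable_std_normal_moment[of k]
  by (subst integrable_density; simp)+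

lemma integral_std_normal_id: "(\<integral>x. x \<partial>std_normal) = 0"
  and integral_std_normal_square: "(\<integral>x. x\<^sup>2 \<partial>std_normal) = 1"
  unfolding std_normal_def
  using integral_std_normal_moment_odd[of 0] integral_std_normal_moment_even[of 1]
  by (subst integral_density; simp)+

lemma integrable_PiM_component:
  fixes h :: "real \<Rightarrow> real"
  assumes "k \<in> A" "integrable std_normal h"
  shows "integrable (gauss_on A) (\<lambda>x. h (x k))"
    and "(\<integral>x. h (x k) \<partial>gauss_on A) = (\<integral>x. h x \<partial>std_normal)"
proof -
  have d: "distr (gauss_on A) std_normal (\<lambda>x. x k) = std_normal"
    using assms(1) by (intro distr_PiM_component[where M="\<lambda>_. std_normal"] prob_space_std_normal)
  have [measurable]: "h \<in> borel_measurable std_normal" "(\<lambda>x. x k) \<in> gauss_on A \<rightarrow>\<^sub>M std_normal"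
    using assms by auto
  show "integrable (gauss_on A) (\<lambda>x. h (x k))"
    using assms(2) by (subst (asm) d[symmetric], subst (asm) integrable_distr_eq) auto
  show "(\<integral>x. h (x k) \<partial>gauss_on A) = (\<integral>x. h x \<partial>std_normal)"
    by (subst d[symmetric], subst integral_distr) auto
qed

lemma integral_PiM_mult_components:
  assumes "finite A" "k \<in> A" "l \<in> A"
  shows "integrable (gauss_on A) (\<lambda>x. x k * x l)"
    and "(\<integral>x. x k * x l \<partial>gauss_on A) = (if k = l then 1 else 0)"
proof -
  have "integrable (gauss_on A) (\<lambda>x. x k * x l)
    \<and> (\<integral>x. x k * x l \<partial>gauss_on A) = (if k = l then 1 else 0)"
  proof (cases "k = l")
    case True
    thus ?thesis
      using integrable_PiM_component[OF assms(2) integrable_std_normal_power(2)[of 2]]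
      by (simp add: power2_eq_square[symmetric] integral_std_normal_square)
  next
    case False
    define h :: "'a \<Rightarrow> real \<Rightarrow> real" where "h = (\<lambda>j x. if j = k \<or> j = l then x else 1)"
    have int: "integrable std_normal (h j)" for j
      using integrable_std_normal_power(2)[of 1] by (cases "j = k \<or> j = l") (simp_all add: h_def)
    have "(\<Prod>j\<in>A. h j (x j)) = (\<Prod>j\<in>{k, l}. h j (x j))" for x
      using assms by (intro prod.mono_neutral_right) (auto simp: h_def)
    hence eq: "(\<Prod>j\<in>A. h j (x j)) = x k * x l" for x
      using False by (simp add: h_def)
    have "(\<Prod>j\<in>A. integral\<^sup>L std_normal (h j)) = 0"
      using assms by (auto intro!: bexI[of _ k] simp: h_def integral_std_normal_id)
    thus ?thesis
      using gauss.product_integrable_prod[of A h, OF assms(1) int] gauss.product_integral_prod[of A h, OF assms(1) int] False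
      by (simp add: eq)
  qed
  thus "integrable (gauss_on A) (\<lambda>x. x k * x l)"
    and "(\<integral>x. x k * x l \<partial>gauss_on A) = (if k = l then 1 else 0)" by auto
qed

lemma exp_diff_exp_minus_squared: "(exp w - exp (- w))\<^sup>2 = exp (2 * w) + exp (- (2 * w)) - 2" for w :: real
  by (simp add: power2_diff exp_minus exp_double power_inverse)

text \<open>The right side is the square of 2 sinh (z/2), which is at least z for z >= 0 because its
  derivative cosh (z/2) is at least 1. It serves to bound a variance by exponential moments.\<close>

lemma square_le_exp_add_exp_minus: "z\<^sup>2 \<le> exp z + exp (- z) - 2" for z :: real
proof -
  have *: "z\<^sup>2 \<le> exp z + exp (- z) - 2" if "0 \<le> z" for z :: real
  proof -
    have d: "DERIV (\<lambda>y. exp (y / 2) - exp (- (y / 2)) - y) y :> exp (y / 2) / 2 + exp (- (y / 2)) / 2 - 1" for y :: real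
      by (auto intro!: derivative_eq_intros)
    have p: "0 \<le> exp (y / 2) / 2 + exp (- (y / 2)) / 2 - 1" for y :: real
      using zero_le_power2[of "exp (y / 4) - exp (- (y / 4))"]
      unfolding exp_diff_exp_minus_squared by (simp add: field_simps)
    have "(\<lambda>y. exp (y / 2) - exp (- (y / 2)) - y) 0 \<le> (\<lambda>y. exp (y / 2) - exp (- (y / 2)) - y) z"
      by (rule DERIV_nonneg_imp_nondecreasing[OF that], intro exI conjI, rule d, rule p)
    hence "z \<le> exp (z / 2) - exp (- (z / 2))" by simp
    hence "z\<^sup>2 \<le> (exp (z / 2) - exp (- (z / 2)))\<^sup>2" using that by (intro power_mono) auto
    also have "\<dots> = exp z + exp (- z) - 2" unfolding exp_diff_exp_minus_squared by simp
    finally show ?thesis .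
  qed
  show ?thesis using *[of z] *[of "- z"] by (cases "0 \<le> z") auto
qed

section \<open>Concentration of 1-Lipschitz functions of a Gaussian vector\<close>

locale gauss_lipschitz =
  fixes A :: "'k set" and F :: "('k \<Rightarrow> real) \<Rightarrow> real"
  assumes fin [simp]: "finite A"
    and meas [measurable]: "F \<in> borel_measurable (gauss_on A)"
    and lip: "\<And>x y. x \<in> space (gauss_on A) \<Longrightarrow> y \<in> space (gauss_on A) \<Longrightarrow>
       \<bar>F x - F y\<bar> \<le> sqrt (\<Sum>k\<in>A. (x k - y k)\<^sup>2)"
begin

abbreviation M where "M \<equiv> gauss_on A"

sublocale prob_space M by (rule prob_space_gauss_on)

lemma uminus: "gauss_lipschitz A (\<lambda>x. - F x)"
  using lip by unfold_locales (auto, smt (verit))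

lemma integrable: "integrable M F"
proof (rule Bochner_Integration.integrable_bound)
  let ?z = "\<lambda>k\<in>A. 0::real"
  have z: "?z \<in> space M" by (auto simp: space_PiM)
  show "integrable M (\<lambda>x. \<bar>F ?z\<bar> + (\<Sum>k\<in>A. \<bar>x k\<bar>))"
    using integrable_PiM_component(1)[OF _ integrable_std_normal_power(1)[of 1]]
    by (intro Bochner_Integration.integrable_add integrable_const Bochner_Integration.integrable_sum) simp
  show "AE x in M. norm (F x) \<le> norm (\<bar>F ?z\<bar> + (\<Sum>k\<in>A. \<bar>x k\<bar>))"
  proof (rule AE_I2)
    fix x assume x: "x \<in> space M"
    have "sqrt (\<Sum>k\<in>A. (x k - ?z k)\<^sup>2) = L2_set x A"
      by (auto simp: L2_set_def intro!: sum.cong)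
    also have "\<dots> \<le> (\<Sum>k\<in>A. \<bar>x k\<bar>)" by (rule L2_set_le_sum_abs)
    finally show "norm (F x) \<le> norm (\<bar>F ?z\<bar> + (\<Sum>k\<in>A. \<bar>x k\<bar>))"
      using lip[OF x z] by simp
  qed
qed measurable

lemma nn_integral_exp_le:
  assumes "0 \<le> l"
  shows "(\<integral>\<^sup>+x. ennreal (exp (l * (F x - expectation F))) \<partial>M) \<le> ennreal (exp (l\<^sup>2))"
proof -
  let ?m = "expectation F"
  let ?f = "\<lambda>x. ennreal (exp (l * (F x - ?m) - l\<^sup>2))"
  let ?g = "\<lambda>x. ennreal (exp (- l * (F x - ?m)))"
  have le1: "(\<integral>\<^sup>+x. ?f x \<partial>M) * (\<integral>\<^sup>+x. ?g x \<partial>M) \<le> 1"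
  proof (rule nn_integral_mult_le_one_PiM)
    fix x y assume xy: "x \<in> space M" "y \<in> space M"
    define d where "d = sqrt (\<Sum>k\<in>A. (x k - y k)\<^sup>2)"
    have "l * (F x - F y) \<le> l * d" using lip[OF xy] assms unfolding d_def by (intro mult_left_mono) auto
    also have "l * d \<le> l\<^sup>2 + d\<^sup>2 / 4" using zero_le_power2[of "l - d / 2"] by (simp add: power2_eq_square algebra_simps)
    also have "d\<^sup>2 = (\<Sum>k\<in>A. (x k - y k)\<^sup>2)" by (simp add: d_def sum_nonneg)
    finally show "?f x * ?g y \<le> ennreal (exp ((\<Sum>k\<in>A. (x k - y k)\<^sup>2) / 4))"
      by (simp add: ennreal_mult'[symmetric] exp_add[symmetric] algebra_simps)
  qed (simp_all, measurable)
  have ge1: "1 \<le> (\<integral>\<^sup>+x. ?g x \<partial>M)"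
  proof (cases "(\<integral>\<^sup>+x. ?g x \<partial>M) = \<infinity>")
    case False
    hence g: "Bochner_Integration.integrable M (\<lambda>x. exp (- l * (F x - ?m)))"
      by (intro integrableI_nonneg) (auto simp: less_top[symmetric])
    have "1 = (\<integral>x. 1 + - l * (F x - ?m) \<partial>M)"
      using integrable by (simp add: prob_space)
    also have "\<dots> \<le> (\<integral>x. exp (- l * (F x - ?m)) \<partial>M)"
      using integrable g by (intro integral_mono exp_ge_add_one_self) simp_all
    finally have "ennreal 1 \<le> ennreal (\<integral>x. exp (- l * (F x - ?m)) \<partial>M)" by (rule ennreal_leI)
    thus ?thesis using nn_integral_eq_integral[OF g] by simp
  qed simp
  have "(\<integral>\<^sup>+x. ?f x \<partial>M) * 1 \<le> 1"
    by (rule order_trans[OF mult_left_mono[OF ge1] le1]) simp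
  hence "ennreal (exp (l\<^sup>2)) * (\<integral>\<^sup>+x. ?f x \<partial>M) \<le> ennreal (exp (l\<^sup>2)) * 1"
    by (intro mult_left_mono) simp_all
  thus ?thesis
    by (subst (asm) nn_integral_cmult[symmetric]) (auto simp: ennreal_mult'[symmetric] exp_add[symmetric])
qed

text \<open>Markov's inequality for the exponential moment at l = r/2, the minimizer of l^2 - l
  r.\<close>

lemma upper_tail:
  assumes "0 \<le> r"
  shows "prob {x\<in>space M. F x \<ge> expectation F + r} \<le> exp (- r\<^sup>2 / 4)"
proof -
  let ?m = "expectation F"
  have "emeasure M {x\<in>space M. F x \<ge> ?m + r} = (\<integral>\<^sup>+x. indicator {x\<in>space M. F x \<ge> ?m + r} x \<partial>M)"
    by simp
  also have "\<dots> \<le> (\<integral>\<^sup>+x. ennreal (exp (- r\<^sup>2 / 2)) * ennreal (exp (r / 2 * (F x - ?m))) \<partial>M)"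
  proof (intro nn_integral_mono)
    fix x
    have "1 \<le> exp (- r\<^sup>2 / 2 + r / 2 * (F x - ?m))" if "F x \<ge> ?m + r"
      using mult_left_mono[of r "F x - ?m" "r / 2"] that assms by (simp add: power2_eq_square)
    thus "indicator {x\<in>space M. F x \<ge> ?m + r} x \<le> ennreal (exp (- r\<^sup>2 / 2)) * ennreal (exp (r / 2 * (F x - ?m)))"
      by (auto simp: ennreal_mult'[symmetric] exp_add[symmetric] split: split_indicator)
  qed
  also have "\<dots> = ennreal (exp (- r\<^sup>2 / 2)) * (\<integral>\<^sup>+x. ennreal (exp (r / 2 * (F x - ?m))) \<partial>M)"
    by (rule nn_integral_cmult) measurable
  also have "\<dots> \<le> ennreal (exp (- r\<^sup>2 / 2)) * ennreal (exp ((r / 2)\<^sup>2))"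
    using assms by (intro mult_left_mono nn_integral_exp_le) auto
  also have "\<dots> = ennreal (exp (- r\<^sup>2 / 4))"
    by (simp add: ennreal_mult'[symmetric] exp_add[symmetric] power2_eq_square)
  finally show ?thesis by (simp add: emeasure_eq_measure)
qed

lemma lower_tail:
  assumes "0 \<le> r"
  shows "prob {x\<in>space M. F x \<le> expectation F - r} \<le> exp (- r\<^sup>2 / 4)"
proof -
  interpret m: gauss_lipschitz A "\<lambda>x. - F x" by (rule uminus)
  have "{x\<in>space M. F x \<le> expectation F - r} = {x\<in>space M. - F x \<ge> expectation (\<lambda>x. - F x) + r}" by auto
  thus ?thesis using m.upper_tail[OF assms] by simp
qed

text \<open>The exponential moments of \<open>F\<close> and \<open>- F\<close> at l = 1 bound the
  variance by 2 e - 2, and e <= 3.\<close>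

lemma second_moment:
  shows "integrable M (\<lambda>x. (F x)\<^sup>2)" and "expectation (\<lambda>x. (F x)\<^sup>2) \<le> (expectation F)\<^sup>2 + 4"
proof -
  interpret m: gauss_lipschitz A "\<lambda>x. - F x" by (rule uminus)
  let ?m = "expectation F"
  let ?p = "\<lambda>x. exp (F x - ?m)" and ?q = "\<lambda>x. exp (?m - F x)"
  have p: "(\<integral>\<^sup>+x. ennreal (?p x) \<partial>M) \<le> ennreal (exp 1)" using nn_integral_exp_le[of 1] by (simp only: mult_1 power_one zero_le_one)
  have q: "(\<integral>\<^sup>+x. ennreal (?q x) \<partial>M) \<le> ennreal (exp 1)"
    using m.nn_integral_exp_le[of 1] by (simp only: mult_1 power_one zero_le_one integral_minus minus_diff_minus minus_diff_eq)
  have ip: "integrable M ?p" using p by (intro integrableI_nonneg) (auto simp: top_unique less_top[symmetric])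
  have iq: "integrable M ?q" using q by (intro integrableI_nonneg) (auto simp: top_unique less_top[symmetric])
  have ep: "expectation ?p \<le> exp 1" using p by (subst (asm) nn_integral_eq_integral[OF ip]) auto
  have eq: "expectation ?q \<le> exp 1" using q by (subst (asm) nn_integral_eq_integral[OF iq]) auto
  have bnd: "(F x - ?m)\<^sup>2 \<le> ?p x + ?q x - 2" for x using square_le_exp_add_exp_minus[of "F x - ?m"] by simp
  have iv: "integrable M (\<lambda>x. (F x - ?m)\<^sup>2)"
  proof (rule Bochner_Integration.integrable_bound)
    show "Bochner_Integration.integrable M (\<lambda>x. ?p x + ?q x - 2)" using ip iq by simp
    show "AE x in M. norm ((F x - ?m)\<^sup>2) \<le> norm (?p x + ?q x - 2)"
      using bnd by (intro AE_I2) (metis abs_ge_self abs_of_nonneg order_trans real_norm_def zero_le_power2)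
  qed measurable
  have eq2: "(F x)\<^sup>2 = (F x - ?m)\<^sup>2 + 2 * ?m * F x - ?m\<^sup>2" for x
    by (simp add: power2_eq_square algebra_simps)
  show "integrable M (\<lambda>x. (F x)\<^sup>2)" unfolding eq2 using iv integrable by auto
  have "expectation (\<lambda>x. (F x - ?m)\<^sup>2) \<le> expectation (\<lambda>x. ?p x + ?q x - 2)"
    using iv ip iq bnd by (intro integral_mono) auto
  also have "\<dots> \<le> 4" using ip iq ep eq exp_le by (simp add: prob_space)
  finally show "expectation (\<lambda>x. (F x)\<^sup>2) \<le> ?m\<^sup>2 + 4"
    unfolding eq2 using iv integrable by (simp add: prob_space power2_eq_square)
qed

end

section \<open>Comparison of Gaussian measures\<close>

lemma distr_std_normal_scale:
  assumes "0 < c"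
  shows "distr std_normal borel (\<lambda>x. c * x) = density lborel (normal_density 0 c)"
proof -
  have "distributed std_normal lborel (\<lambda>x. x) std_normal_density"
    by (auto simp: distributed_def std_normal_def distr_id2 normal_density_nonneg)
  from std_normal.normal_density_affine[OF this, of c 0] assms
  have "distributed std_normal lborel (\<lambda>x. c * x) (normal_density 0 c)" by simp
  hence "distr std_normal lborel (\<lambda>x. c * x) = density lborel (normal_density 0 c)"
    by (simp add: distributed_def)
  thus ?thesis by (metis distr_cong sets_lborel)
qed

lemma std_normal_stable:
  assumes [measurable]: "E \<in> sets borel" and sh: "0 \<le> s" "0 \<le> h"
  shows "(\<integral>\<^sup>+x. \<integral>\<^sup>+y. indicator E (sqrt s * x + sqrt h * y) \<partial>std_normal \<partial>std_normal)
     = (\<integral>\<^sup>+x. indicator E (sqrt (s + h) * x) \<partial>std_normal)"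
proof -
  \<comment> \<open>The convolution formula concerns densities, and a scale of 0 has none; in the
    degenerate cases one of the two integrations is over a constant.\<close>
  consider "s = 0" | "h = 0" | "0 < s" "0 < h" using sh by linarith
  thus ?thesis
  proof cases
    case 3
    let ?N = "\<lambda>c. density lborel (normal_density 0 c)"
    have D: "(\<integral>\<^sup>+x. f (sqrt c * x) \<partial>std_normal) = (\<integral>\<^sup>+x. f x \<partial>?N (sqrt c))"
      if "f \<in> borel_measurable borel" "0 < c" for f :: "real \<Rightarrow> ennreal" and c
      using that by (subst distr_std_normal_scale[symmetric]) (auto simp: nn_integral_distr)
    interpret s: prob_space "?N (sqrt s)" using 3 by (intro prob_space_normal_density) simp
    interpret h: prob_space "?N (sqrt h)" using 3 by (intro prob_space_normal_density) simp
    have "(\<integral>\<^sup>+x. \<integral>\<^sup>+y. indicator E (sqrt s * x + sqrt h * y) \<partial>std_normal \<partial>std_normal)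
        = (\<integral>\<^sup>+x. \<integral>\<^sup>+y. indicator E (x + y) \<partial>?N (sqrt h) \<partial>?N (sqrt s))"
      using 3 D[of "\<lambda>y. indicator E (sqrt s * x + y)" h for x] D[of "\<lambda>x. \<integral>\<^sup>+y. indicator E (x + y) \<partial>?N (sqrt h)" s]
      by simp
    also have "\<dots> = (\<integral>\<^sup>+x. indicator E x \<partial>(?N (sqrt s) \<star> ?N (sqrt h)))"
      by (rule nn_integral_convolution[symmetric]) (auto intro: s.finite_measure_axioms h.finite_measure_axioms)
    also have "?N (sqrt s) \<star> ?N (sqrt h) = ?N (sqrt (s + h))"
      using 3 conv_normal_density_zero_mean[of "sqrt s" "sqrt h"]
      by (subst convolution_density) (auto simp: s.finite_measure_axioms h.finite_measure_axioms ennreal_mult')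
    finally show ?thesis using 3 D[of "indicator E" "s + h"] by simp
  qed (use std_normal.emeasure_space_1 in auto)
qed

text \<open>Both sides are the product of the laws of \<open>sqrt (s + h)\<close> times a standard
  normal variable. It is enough to test this on boxes, where the integrals factorize.\<close>

lemma PiM_std_normal_stable:
  assumes A: "finite A" and sh: "0 \<le> s" "0 \<le> h"
  shows "distr (gauss_on A \<Otimes>\<^sub>M gauss_on A) (gauss_on A)
           (\<lambda>(x, y). \<lambda>k\<in>A. sqrt s * x k + sqrt h * y k)
       = distr (gauss_on A) (gauss_on A) (\<lambda>x. \<lambda>k\<in>A. sqrt (s + h) * x k)"
proof -
  let ?N = "gauss_on A"
  define Q where "Q = distr std_normal borel (\<lambda>x. sqrt (s + h) * x)"
  have setsQ [simp, measurable_cong]: "sets Q = sets borel" by (simp add: Q_def)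
  interpret Q: prob_space Q unfolding Q_def by (rule std_normal.prob_space_distr) simp
  interpret Q: product_sigma_finite "\<lambda>_. Q" by unfold_locales
  interpret N: prob_space ?N by (rule prob_space_gauss_on)
  have sets: "sets (PiM A (\<lambda>_. Q)) = sets ?N" by (intro sets_PiM_cong) auto
  have ind: "indicator (Pi\<^sub>E A E) (\<lambda>k\<in>A. z k) = (\<Prod>k\<in>A. indicator (E k) (z k) :: ennreal)" for E and z :: "'a \<Rightarrow> real"
    using A by (auto simp: indicator_def prod_zero_iff PiE_def Pi_def)
  have Q_E: "emeasure Q E = (\<integral>\<^sup>+x. indicator E (sqrt (s + h) * x) \<partial>std_normal)" if "E \<in> sets borel" for E
  proof -
    have "emeasure Q E = (\<integral>\<^sup>+x. indicator E x \<partial>Q)" using that by simp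
    also have "\<dots> = (\<integral>\<^sup>+x. indicator E (sqrt (s + h) * x) \<partial>std_normal)"
      unfolding Q_def using that by (intro nn_integral_distr) auto
    finally show ?thesis .
  qed
  have "distr (?N \<Otimes>\<^sub>M ?N) ?N (\<lambda>(x, y). \<lambda>k\<in>A. sqrt s * x k + sqrt h * y k) = PiM A (\<lambda>_. Q)"
  proof (rule Q.PiM_eqI)
    fix E assume E [measurable]: "\<And>k. k \<in> A \<Longrightarrow> E k \<in> sets Q"
    have PE [measurable]: "Pi\<^sub>E A E \<in> sets ?N" using A by (intro sets_PiM_I_finite) (use E in auto)
    have "emeasure (distr (?N \<Otimes>\<^sub>M ?N) ?N (\<lambda>(x, y). \<lambda>k\<in>A. sqrt s * x k + sqrt h * y k)) (Pi\<^sub>E A E)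
      = (\<integral>\<^sup>+z. indicator (Pi\<^sub>E A E) z \<partial>distr (?N \<Otimes>\<^sub>M ?N) ?N (\<lambda>(x, y). \<lambda>k\<in>A. sqrt s * x k + sqrt h * y k))"
      using PE by simp
    also have "\<dots>
      = (\<integral>\<^sup>+z. indicator (Pi\<^sub>E A E) (case z of (x, y) \<Rightarrow> \<lambda>k\<in>A. sqrt s * x k + sqrt h * y k) \<partial>(?N \<Otimes>\<^sub>M ?N))"
      by (rule nn_integral_distr) measurable
    also have "\<dots> = (\<integral>\<^sup>+x. \<integral>\<^sup>+y. indicator (Pi\<^sub>E A E) (\<lambda>k\<in>A. sqrt s * x k + sqrt h * y k) \<partial>?N \<partial>?N)"
      by (subst N.nn_integral_fst[symmetric]) auto
    also have "\<dots> = (\<integral>\<^sup>+x. (\<Prod>k\<in>A. \<integral>\<^sup>+y. indicator (E k) (sqrt s * x k + sqrt h * y) \<partial>std_normal) \<partial>?N)"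
      unfolding ind using E A by (intro nn_integral_cong gauss.product_nn_integral_prod) auto
    also have "\<dots> = (\<Prod>k\<in>A. \<integral>\<^sup>+x. \<integral>\<^sup>+y. indicator (E k) (sqrt s * x + sqrt h * y) \<partial>std_normal \<partial>std_normal)"
      using E A by (intro gauss.product_nn_integral_prod) auto
    also have "\<dots> = (\<Prod>k\<in>A. emeasure Q (E k))"
      using E sh by (intro prod.cong refl) (simp add: Q_E std_normal_stable)
    finally show "emeasure (distr (?N \<Otimes>\<^sub>M ?N) ?N (\<lambda>(x, y). \<lambda>k\<in>A. sqrt s * x k + sqrt h * y k)) (Pi\<^sub>E A E)
        = (\<Prod>k\<in>A. emeasure Q (E k))" .
  qed (use A sets in auto)
  moreover have "distr ?N ?N (\<lambda>x. \<lambda>k\<in>A. sqrt (s + h) * x k) = PiM A (\<lambda>_. Q)"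
  proof (rule Q.PiM_eqI)
    fix E assume E [measurable]: "\<And>k. k \<in> A \<Longrightarrow> E k \<in> sets Q"
    have PE [measurable]: "Pi\<^sub>E A E \<in> sets ?N" using A by (intro sets_PiM_I_finite) (use E in auto)
    have "emeasure (distr ?N ?N (\<lambda>x. \<lambda>k\<in>A. sqrt (s + h) * x k)) (Pi\<^sub>E A E)
      = (\<integral>\<^sup>+z. indicator (Pi\<^sub>E A E) z \<partial>distr ?N ?N (\<lambda>x. \<lambda>k\<in>A. sqrt (s + h) * x k))"
      using PE by simp
    also have "\<dots>
      = (\<integral>\<^sup>+x. indicator (Pi\<^sub>E A E) (\<lambda>k\<in>A. sqrt (s + h) * x k) \<partial>?N)"
      by (rule nn_integral_distr) measurable
    also have "\<dots> = (\<Prod>k\<in>A. emeasure Q (E k))"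
      unfolding ind using E A by (subst gauss.product_nn_integral_prod) (auto simp: Q_E)
    finally show "emeasure (distr ?N ?N (\<lambda>x. \<lambda>k\<in>A. sqrt (s + h) * x k)) (Pi\<^sub>E A E) = (\<Prod>k\<in>A. emeasure Q (E k))" .
  qed (use A sets in auto)
  ultimately show ?thesis by simp
qed

section \<open>Replacement of one stable measure by another along a path\<close>

abbreviation real_product :: "('p \<Rightarrow> real) measure" where
  "real_product \<equiv> PiM UNIV (\<lambda>_. borel)"

lemma measurable_real_product_add [measurable (raw)]:
  assumes [measurable]: "f \<in> M \<rightarrow>\<^sub>M real_product" "g \<in> M \<rightarrow>\<^sub>M real_product"
  shows "(\<lambda>\<omega> p. f \<omega> p + g \<omega> p) \<in> M \<rightarrow>\<^sub>M real_product"
  by (intro measurable_abs_UNIV) measurable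

lemma measurable_real_product_mult [measurable (raw)]:
  assumes [measurable]: "g \<in> M \<rightarrow>\<^sub>M real_product"
  shows "(\<lambda>\<omega> p. c * g \<omega> p) \<in> M \<rightarrow>\<^sub>M real_product"
  by (intro measurable_abs_UNIV) measurable

lemma measurable_real_product_const [measurable (raw)]: "(\<lambda>_. w) \<in> M \<rightarrow>\<^sub>M real_product"
  by (intro measurable_abs_UNIV) measurable

text \<open>The one feature of centered Gaussian measures on which the path argument rests:
  independent samples weighted by \<open>sqrt s\<close> and \<open>sqrt h\<close> add up to a sample
  weighted by \<open>sqrt (s + h)\<close>.\<close>

definition sqrt_stable :: "('p \<Rightarrow> real) measure \<Rightarrow> bool" where
  "sqrt_stable \<mu> \<longleftrightarrow> prob_space \<mu> \<and> sets \<mu> = sets real_product \<and>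
     (\<forall>s h. 0 \<le> s \<longrightarrow> 0 \<le> h \<longrightarrow>
        distr (\<mu> \<Otimes>\<^sub>M \<mu>) real_product (\<lambda>(x, y) p. sqrt s * x p + sqrt h * y p)
      = distr \<mu> real_product (\<lambda>x p. sqrt (s + h) * x p))"

lemma integral_sqrt_stable:
  fixes f :: "('p \<Rightarrow> real) \<Rightarrow> real"
  assumes \<mu>: "sqrt_stable \<mu>" and [measurable]: "f \<in> borel_measurable real_product"
    and bd: "\<And>x. \<bar>f x\<bar> \<le> B" and sh: "0 \<le> s" "0 \<le> h"
  shows "(\<integral>x. f (\<lambda>p. w p + sqrt (s + h) * x p) \<partial>\<mu>)
       = (\<integral>x. \<integral>y. f (\<lambda>p. w p + sqrt s * x p + sqrt h * y p) \<partial>\<mu> \<partial>\<mu>)"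
proof -
  interpret prob_space \<mu> using \<mu> by (simp add: sqrt_stable_def)
  interpret pair_prob_space \<mu> \<mu> by unfold_locales
  have [measurable_cong, simp]: "sets \<mu> = sets real_product" using \<mu> by (simp add: sqrt_stable_def)
  have "(\<integral>x. f (\<lambda>p. w p + sqrt (s + h) * x p) \<partial>\<mu>)
      = (\<integral>x. f (\<lambda>p. w p + x p) \<partial>(distr \<mu> real_product (\<lambda>x p. sqrt (s + h) * x p)))"
    by (subst integral_distr) measurable
  also have "distr \<mu> real_product (\<lambda>x p. sqrt (s + h) * x p)
      = distr (\<mu> \<Otimes>\<^sub>M \<mu>) real_product (\<lambda>(x, y) p. sqrt s * x p + sqrt h * y p)"
    using \<mu> sh by (simp add: sqrt_stable_def)
  also have "(\<integral>x. f (\<lambda>p. w p + x p) \<partial>\<dots>)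
      = (\<integral>z. (case z of (x, y) \<Rightarrow> f (\<lambda>p. w p + sqrt s * x p + sqrt h * y p)) \<partial>(\<mu> \<Otimes>\<^sub>M \<mu>))"
    by (subst integral_distr) (measurable, simp add: case_prod_beta' add.assoc)
  also have "\<dots> = (\<integral>x. \<integral>y. f (\<lambda>p. w p + sqrt s * x p + sqrt h * y p) \<partial>\<mu> \<partial>\<mu>)"
    by (rule integral_fst[symmetric]) (auto intro!: P.integrable_const_bound[of _ B] bd)
  finally show ?thesis .
qed

text \<open>Lindeberg's replacement argument, run along the path from \<open>\<nu>\<close> to \<open>\<mu>\<close> that mixes
  \<open>sqrt s\<close> times a sample of \<open>\<mu>\<close> with \<open>sqrt (1 - s)\<close> times a sample of \<open>\<nu>\<close>: one step of
  length \<open>1 / N\<close> loses at most \<open>K / N powr (3 / 2)\<close>.\<close>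

lemma integral_le_of_small_time_comparison:
  fixes f :: "('p \<Rightarrow> real) \<Rightarrow> real"
  assumes \<mu>: "sqrt_stable \<mu>" and \<nu>: "sqrt_stable \<nu>"
    and f [measurable]: "f \<in> borel_measurable real_product" and bd: "\<And>x. \<bar>f x\<bar> \<le> B"
    and step: "\<And>w h. 0 \<le> h \<Longrightarrow>
       (\<integral>y. f (\<lambda>p. w p + sqrt h * y p) \<partial>\<nu>) - K * (h * sqrt h) \<le> (\<integral>x. f (\<lambda>p. w p + sqrt h * x p) \<partial>\<mu>)"
  shows "(\<integral>y. f y \<partial>\<nu>) \<le> (\<integral>x. f x \<partial>\<mu>)"
proof -
  interpret \<mu>: prob_space \<mu> using \<mu> by (simp add: sqrt_stable_def)
  interpret \<nu>: prob_space \<nu> using \<nu> by (simp add: sqrt_stable_def)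
  interpret \<nu>\<mu>: pair_prob_space \<nu> \<mu> by unfold_locales
  have [measurable_cong, simp]: "sets \<mu> = sets real_product" "sets \<nu> = sets real_product"
    using \<mu> \<nu> by (simp_all add: sqrt_stable_def)
  define Z where "Z = (\<lambda>s. \<integral>y. \<integral>x. f (\<lambda>p. sqrt s * x p + sqrt (1 - s) * y p) \<partial>\<mu> \<partial>\<nu>)"
  have bd_int: "\<bar>\<integral>x. g x \<partial>N\<bar> \<le> B" if "prob_space N" "\<And>x. \<bar>g x\<bar> \<le> B" for N and g :: "('p \<Rightarrow> real) \<Rightarrow> real"
  proof -
    interpret prob_space N by fact
    have "0 \<le> B" using bd[of undefined] by linarith
    thus ?thesis
      using that(2) integral_abs_bound[of N g]
      by (cases "integrable N g")
         (auto simp: not_integrable_integral_eq intro!: order_trans[OF integral_abs_bound] integral_le_const)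
  qed
  have Z_step: "Z s - K * (h * sqrt h) \<le> Z (s + h)" if s: "0 \<le> s" "0 \<le> h" "s + h \<le> 1" for s h
  proof -
    \<comment> \<open>In \<open>Z (s + h)\<close> the sample of \<open>\<mu>\<close> splits into
      parts of variance \<open>s\<close> and \<open>h\<close>, in \<open>Z s\<close> the sample of
      \<open>\<nu>\<close> splits into parts of variance \<open>r\<close> and \<open>h\<close>. The
      parts of variance \<open>s\<close> and \<open>r\<close> are then common to both, and only the
      part of variance \<open>h\<close> differs in law, which is the situation of
      \<open>step\<close>.\<close>
    define r where "r = 1 - s - h"
    let ?g = "\<lambda>x y z. f (\<lambda>p. sqrt s * x p + sqrt r * y p + sqrt h * z p)"
    have 1: "Z (s + h) = (\<integral>y. \<integral>x. \<integral>x'. ?g x y x' \<partial>\<mu> \<partial>\<mu> \<partial>\<nu>)"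
      unfolding Z_def
    proof (rule Bochner_Integration.integral_cong[OF refl])
      fix y
      show "(\<integral>x. f (\<lambda>p. sqrt (s + h) * x p + sqrt (1 - (s + h)) * y p) \<partial>\<mu>)
          = (\<integral>x. \<integral>x'. ?g x y x' \<partial>\<mu> \<partial>\<mu>)"
        using integral_sqrt_stable[OF \<mu> f bd s(1,2), of "\<lambda>p. sqrt r * y p"]
        by (simp add: r_def algebra_simps)
    qed
    have "Z s = (\<integral>x. \<integral>y. f (\<lambda>p. sqrt s * x p + sqrt (1 - s) * y p) \<partial>\<nu> \<partial>\<mu>)"
      unfolding Z_def
      by (rule \<nu>\<mu>.Fubini_integral[symmetric]) (auto intro!: \<nu>\<mu>.P.integrable_const_bound[of _ B] bd)
    also have "\<dots> = (\<integral>x. \<integral>y. \<integral>y'. ?g x y y' \<partial>\<nu> \<partial>\<nu> \<partial>\<mu>)"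
    proof (rule Bochner_Integration.integral_cong[OF refl])
      fix x
      have r: "1 - s = r + h" "0 \<le> r" using s by (auto simp: r_def)
      thus "(\<integral>y. f (\<lambda>p. sqrt s * x p + sqrt (1 - s) * y p) \<partial>\<nu>)
          = (\<integral>y. \<integral>y'. ?g x y y' \<partial>\<nu> \<partial>\<nu>)"
        unfolding r(1) using integral_sqrt_stable[OF \<nu> f bd _ s(2), of r "\<lambda>p. sqrt s * x p"] by simp
    qed
    also have "\<dots> = (\<integral>y. \<integral>x. \<integral>y'. ?g x y y' \<partial>\<nu> \<partial>\<mu> \<partial>\<nu>)"
      by (rule \<nu>\<mu>.Fubini_integral)
         (auto intro!: \<nu>\<mu>.P.integrable_const_bound[of _ B] bd_int bd \<nu>.prob_space_axioms)
    finally have 2: "Z s = (\<integral>y. \<integral>x. \<integral>y'. ?g x y y' \<partial>\<nu> \<partial>\<mu> \<partial>\<nu>)" .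
    have "(\<integral>y. \<integral>x. \<integral>y'. ?g x y y' \<partial>\<nu> \<partial>\<mu> \<partial>\<nu>) - K * (h * sqrt h)
        = (\<integral>y. (\<integral>x. (\<integral>y'. ?g x y y' \<partial>\<nu>) - K * (h * sqrt h) \<partial>\<mu>) \<partial>\<nu>)"
    proof -
      have "integrable \<mu> (\<lambda>x. \<integral>y'. ?g x y y' \<partial>\<nu>)" for y
        by (auto intro!: \<mu>.integrable_const_bound[of _ B] bd_int bd \<nu>.prob_space_axioms)
      moreover have "integrable \<nu> (\<lambda>y. \<integral>x. \<integral>y'. ?g x y y' \<partial>\<nu> \<partial>\<mu>)"
        by (auto intro!: \<nu>.integrable_const_bound[of _ B] bd_int bd \<nu>.prob_space_axioms \<mu>.prob_space_axioms)
      ultimately show ?thesis by (simp add: \<mu>.prob_space \<nu>.prob_space)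
    qed
    also have "\<dots> \<le> (\<integral>y. \<integral>x. \<integral>x'. ?g x y x' \<partial>\<mu> \<partial>\<mu> \<partial>\<nu>)"
    proof (rule integral_mono)
      have int: "integrable \<mu> (\<lambda>x. \<integral>y'. ?g x y y' \<partial>\<nu>)" for y
        by (auto intro!: \<mu>.integrable_const_bound[of _ B] bd_int bd \<nu>.prob_space_axioms)
      show "(\<integral>x. (\<integral>y'. ?g x y y' \<partial>\<nu>) - K * (h * sqrt h) \<partial>\<mu>)
          \<le> (\<integral>x. \<integral>x'. ?g x y x' \<partial>\<mu> \<partial>\<mu>)" for y
      proof (rule integral_mono)
        show "integrable \<mu> (\<lambda>x. (\<integral>y'. ?g x y y' \<partial>\<nu>) - K * (h * sqrt h))"
          using int by simp
        show "integrable \<mu> (\<lambda>x. (\<integral>y'. ?g x y y' \<partial>\<mu>))"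
          by (auto intro!: \<mu>.integrable_const_bound[of _ B] bd_int bd \<mu>.prob_space_axioms)
      qed (rule step, rule s)
      have "integrable \<nu> (\<lambda>y. \<integral>x. \<integral>y'. ?g x y y' \<partial>\<nu> \<partial>\<mu>)"
        by (auto intro!: \<nu>.integrable_const_bound[of _ B] bd_int bd \<nu>.prob_space_axioms \<mu>.prob_space_axioms)
      thus "integrable \<nu> (\<lambda>y. \<integral>x. (\<integral>y'. ?g x y y' \<partial>\<nu>) - K * (h * sqrt h) \<partial>\<mu>)"
        using int by simp
      show "integrable \<nu> (\<lambda>y. \<integral>x. \<integral>x'. ?g x y x' \<partial>\<mu> \<partial>\<mu>)"
        by (auto intro!: \<nu>.integrable_const_bound[of _ B] bd_int bd \<mu>.prob_space_axioms)
    qed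
    finally show ?thesis unfolding 1 2 .
  qed
  \<comment> \<open>\<open>N\<close> steps of length \<open>1 / N\<close> lose
    \<open>N * K / N powr (3 / 2) = K / sqrt N\<close> altogether, which tends to 0.\<close>
  have Z_le: "Z 0 - K / sqrt N \<le> Z 1" if N: "0 < N" for N :: nat
  proof -
    define h where "h = 1 / real N"
    have "Z 0 - real k * (K * (h * sqrt h)) \<le> Z (real k * h)" if "k \<le> N" for k
      using that
    proof (induction k)
      case (Suc k)
      have "real k * h + h = real (Suc k) * h" by (simp add: algebra_simps)
      moreover have "real (Suc k) * h \<le> 1" using Suc.prems N by (simp add: h_def)
      ultimately have "Z (real k * h) - K * (h * sqrt h) \<le> Z (real (Suc k) * h)"
        using Z_step[of "real k * h" h] N by (simp add: h_def)
      thus ?case using Suc by (simp add: algebra_simps)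
    qed simp
    from this[of N] N show ?thesis by (simp add: h_def real_sqrt_divide)
  qed
  have "(\<lambda>N. Z 0 - K / sqrt (real N)) \<longlonglongrightarrow> Z 0 - 0"
    by (intro tendsto_intros tendsto_divide_0[OF tendsto_const] filterlim_compose[OF sqrt_at_top] filterlim_at_top_imp_at_infinity filterlim_real_sequentially)
  hence "Z 0 \<le> Z 1"
    using Z_le by (intro LIMSEQ_le_const2) (auto intro!: exI[of _ 1])
  moreover have "Z 0 = (\<integral>y. f y \<partial>\<nu>)" "Z 1 = (\<integral>x. f x \<partial>\<mu>)"
    by (simp_all add: Z_def \<mu>.prob_space \<nu>.prob_space)
  ultimately show ?thesis by simp
qed

text \<open>The law of a centered Gaussian process whose covariance at \<open>p\<close>,
  \<open>q\<close> is the inner product of \<open>a p\<close> and \<open>a q\<close>. As a linear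
  image of independent variables it needs no construction from a covariance matrix.\<close>

definition gauss_image :: "'k set \<Rightarrow> ('p \<Rightarrow> 'k \<Rightarrow> real) \<Rightarrow> ('p \<Rightarrow> real) measure" where
  "gauss_image A a = distr (gauss_on A) real_product (\<lambda>x p. \<Sum>k\<in>A. a p k * x k)"

lemma measurable_linear_image [measurable]:
  "(\<lambda>x p. \<Sum>k\<in>A. a p k * x k) \<in> gauss_on A \<rightarrow>\<^sub>M real_product"
  by (intro measurable_abs_UNIV) measurable

lemma sqrt_stable_gauss_image:
  assumes "finite A"
  shows "sqrt_stable (gauss_image A a)"
  unfolding sqrt_stable_def
proof (intro conjI allI impI)
  let ?N = "gauss_on A" and ?L = "\<lambda>x p. \<Sum>k\<in>A. a p k * x k"
  interpret N: prob_space ?N by (rule prob_space_gauss_on)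
  interpret L: prob_space "distr ?N real_product ?L" by (rule N.prob_space_distr) measurable
  show "prob_space (gauss_image A a)" unfolding gauss_image_def by unfold_locales
  show "sets (gauss_image A a) = sets real_product" by (simp add: gauss_image_def)
  fix s h :: real assume sh: "0 \<le> s" "0 \<le> h"
  have "distr (gauss_image A a \<Otimes>\<^sub>M gauss_image A a) real_product (\<lambda>(x, y) p. sqrt s * x p + sqrt h * y p)
      = distr (?N \<Otimes>\<^sub>M ?N) real_product ((\<lambda>(x, y) p. sqrt s * x p + sqrt h * y p) \<circ> (\<lambda>(x, y). (?L x, ?L y)))"
    unfolding gauss_image_def
    by (subst pair_measure_distr) (auto intro: L.sigma_finite_measure_axioms simp: distr_distr)
  also have "(\<lambda>(x, y) p. sqrt s * x p + sqrt h * y p) \<circ> (\<lambda>(x, y). (?L x, ?L y))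
      = ?L \<circ> (\<lambda>(x, y). \<lambda>k\<in>A. sqrt s * x k + sqrt h * y k)"
    by (auto simp: fun_eq_iff sum_distrib_left sum.distrib[symmetric] algebra_simps intro!: sum.cong)
  also have "distr (?N \<Otimes>\<^sub>M ?N) real_product \<dots>
      = distr (distr (?N \<Otimes>\<^sub>M ?N) ?N (\<lambda>(x, y). \<lambda>k\<in>A. sqrt s * x k + sqrt h * y k)) real_product ?L"
    by (subst distr_distr) auto
  also have "\<dots> = distr (distr ?N ?N (\<lambda>x. \<lambda>k\<in>A. sqrt (s + h) * x k)) real_product ?L"
    by (simp only: PiM_std_normal_stable[OF assms sh])
  also have "\<dots> = distr ?N real_product (?L \<circ> (\<lambda>x. \<lambda>k\<in>A. sqrt (s + h) * x k))"
    by (subst distr_distr) auto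
  also have "?L \<circ> (\<lambda>x. \<lambda>k\<in>A. sqrt (s + h) * x k) = (\<lambda>x p. sqrt (s + h) * x p) \<circ> ?L"
    by (auto simp: fun_eq_iff sum_distrib_left algebra_simps intro!: sum.cong)
  also have "distr ?N real_product \<dots> = distr (gauss_image A a) real_product (\<lambda>x p. sqrt (s + h) * x p)"
    unfolding gauss_image_def by (subst distr_distr) auto
  finally show "distr (gauss_image A a \<Otimes>\<^sub>M gauss_image A a) real_product (\<lambda>(x, y) p. sqrt s * x p + sqrt h * y p)
      = distr (gauss_image A a) real_product (\<lambda>x p. sqrt (s + h) * x p)" .
qed

lemma integrable_cube_sum:
  fixes X :: "'p \<Rightarrow> 'a \<Rightarrow> real"
  assumes "finite P" "\<And>p. p \<in> P \<Longrightarrow> X p \<in> borel_measurable M" "\<And>p. p \<in> P \<Longrightarrow> integrable M (\<lambda>x. \<bar>X p x\<bar> ^ 3)"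
  shows "integrable M (\<lambda>x. (\<Sum>p\<in>P. \<bar>X p x\<bar>) ^ 3)"
  using assms
proof (induction P rule: finite_induct)
  case (insert p P)
  have [measurable]: "X q \<in> borel_measurable M" if "q \<in> insert p P" for q using insert.prems that by blast
  have cube: "(y + z) ^ 3 \<le> 4 * (y ^ 3 + z ^ 3)" if "0 \<le> y" "0 \<le> z" for y z :: real
  proof -
    have "4 * (y ^ 3 + z ^ 3) - (y + z) ^ 3 = 3 * (y + z) * (y - z)\<^sup>2"
      by (simp add: power2_eq_square power3_eq_cube algebra_simps)
    moreover have "0 \<le> 3 * (y + z) * (y - z)\<^sup>2" using that by simp
    ultimately show ?thesis by linarith
  qed
  show ?case
  proof (rule Bochner_Integration.integrable_bound)
    show "integrable M (\<lambda>x. 4 * (\<bar>X p x\<bar> ^ 3 + (\<Sum>q\<in>P. \<bar>X q x\<bar>) ^ 3))"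
      using insert by simp
    show "AE x in M. norm ((\<Sum>q\<in>insert p P. \<bar>X q x\<bar>) ^ 3) \<le> norm (4 * (\<bar>X p x\<bar> ^ 3 + (\<Sum>q\<in>P. \<bar>X q x\<bar>) ^ 3))"
      using insert(1,2) cube by (intro AE_I2) (simp add: sum_nonneg)
  qed measurable
qed simp

abbreviation quad_form :: "'p set \<Rightarrow> ('p \<Rightarrow> 'p \<Rightarrow> real) \<Rightarrow> ('p \<Rightarrow> real) \<Rightarrow> real" where
  "quad_form P c u \<equiv> \<Sum>p\<in>P. \<Sum>q\<in>P. c p q * (u p * u q)"

abbreviation cov_form :: "'p set \<Rightarrow> ('p \<Rightarrow> 'p \<Rightarrow> real) \<Rightarrow> 'k set \<Rightarrow> ('p \<Rightarrow> 'k \<Rightarrow> real) \<Rightarrow> real" where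
  "cov_form P c A a \<equiv> \<Sum>p\<in>P. \<Sum>q\<in>P. c p q * (\<Sum>k\<in>A. a p k * a q k)"

text \<open>\<open>b\<close> and \<open>c\<close> play the gradient and the Hessian. Recorded is
  only the Taylor estimate with a uniform cubic remainder: the replacement step uses nothing more,
  and a cubic spline, whose third derivative jumps, satisfies it.\<close>

definition second_order_expansion ::
  "'p set \<Rightarrow> (('p \<Rightarrow> real) \<Rightarrow> real) \<Rightarrow> (('p \<Rightarrow> real) \<Rightarrow> 'p \<Rightarrow> real)
     \<Rightarrow> (('p \<Rightarrow> real) \<Rightarrow> 'p \<Rightarrow> 'p \<Rightarrow> real) \<Rightarrow> real \<Rightarrow> bool" where
  "second_order_expansion P f b c C \<longleftrightarrow> (\<forall>w u.
     \<bar>f (\<lambda>p. w p + u p) - f w - (\<Sum>p\<in>P. b w p * u p) - quad_form P (c w) u / 2\<bar>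
       \<le> C * (\<Sum>p\<in>P. \<bar>u p\<bar>) ^ 3)"

text \<open>The linear term has mean 0, the quadratic term has the covariance as its mean, and the
  remainder scales like \<open>h * sqrt h\<close>. The constant \<open>K\<close> is a third absolute
  moment of the process; it is chosen before \<open>f\<close>, \<open>w\<close> and
  \<open>h\<close>, since the steps along the path need it uniformly in \<open>w\<close>.\<close>

lemma integral_gauss_image_expansion:
  fixes a :: "'p \<Rightarrow> 'k \<Rightarrow> real"
  assumes A: "finite A" and P: "finite P"
  shows "\<exists>K. \<forall>f b c C B w h. f \<in> borel_measurable real_product \<longrightarrow> (\<forall>x. \<bar>f x\<bar> \<le> B) \<longrightarrow>
     second_order_expansion P f b c C \<longrightarrow> 0 \<le> h \<longrightarrow>
       \<bar>(\<integral>x. f (\<lambda>p. w p + sqrt h * x p) \<partial>gauss_image A a) - f w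
          - h * cov_form P (c w) A a / 2\<bar> \<le> C * K * (h * sqrt h)"
proof -
  let ?N = "gauss_on A"
  define L where "L = (\<lambda>x p. \<Sum>k\<in>A. a p k * x k)"
  interpret N: prob_space ?N by (rule prob_space_gauss_on)
  have [measurable]: "(\<lambda>x. L x p) \<in> borel_measurable ?N" for p
    unfolding L_def by measurable
  have Lm [measurable]: "L \<in> ?N \<rightarrow>\<^sub>M real_product" unfolding L_def by (rule measurable_linear_image)
  have L1: "integrable ?N (\<lambda>x. L x p)" "(\<integral>x. L x p \<partial>?N) = 0" for p
    using integrable_PiM_component[OF _ integrable_std_normal_power(2)[of 1], of _ A]
    by (auto simp: L_def integral_std_normal_id)
  have LL: "L x p * L x q = (\<Sum>k\<in>A. \<Sum>l\<in>A. a p k * a q l * (x k * x l))" for x p q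
    by (simp add: L_def sum_product mult_ac)
  have L2: "integrable ?N (\<lambda>x. L x p * L x q)" for p q
    unfolding LL using integral_PiM_mult_components(1)[OF A]
    by (intro Bochner_Integration.integrable_sum integrable_mult_right) auto
  have E2: "(\<integral>x. L x p * L x q \<partial>?N) = (\<Sum>k\<in>A. a p k * a q k)" for p q
  proof -
    have "(\<integral>x. L x p * L x q \<partial>?N) = (\<Sum>k\<in>A. \<Sum>l\<in>A. a p k * a q l * (\<integral>x. x k * x l \<partial>?N))"
      unfolding LL using integral_PiM_mult_components(1)[OF A]
      by (simp add: Bochner_Integration.integral_sum)
    also have "\<dots> = (\<Sum>k\<in>A. \<Sum>l\<in>A. if l = k then a p k * a q k else 0)"
      using integral_PiM_mult_components(2)[OF A] by (intro sum.cong) auto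
    finally show ?thesis using A by simp
  qed
  have L3: "integrable ?N (\<lambda>x. \<bar>L x p\<bar> ^ 3)" for p
  proof (rule Bochner_Integration.integrable_bound)
    have "integrable ?N (\<lambda>x. \<bar>a p k * x k\<bar> ^ 3)" if "k \<in> A" for k
      using integrable_PiM_component(1)[OF that integrable_std_normal_power(1)[of 3]]
      by (simp add: abs_mult power_mult_distrib)
    thus "integrable ?N (\<lambda>x. (\<Sum>k\<in>A. \<bar>a p k * x k\<bar>) ^ 3)"
      using A by (intro integrable_cube_sum) auto
    show "AE x in ?N. norm (\<bar>L x p\<bar> ^ 3) \<le> norm ((\<Sum>k\<in>A. \<bar>a p k * x k\<bar>) ^ 3)"
      by (intro AE_I2) (auto simp: L_def sum_nonneg intro!: power_mono sum_abs)
  qed measurable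
  have S3: "integrable ?N (\<lambda>x. (\<Sum>p\<in>P. \<bar>L x p\<bar>) ^ 3)"
    using P L3 by (intro integrable_cube_sum) auto
  define K where "K = (\<integral>x. (\<Sum>p\<in>P. \<bar>L x p\<bar>) ^ 3 \<partial>?N)"
  show ?thesis
  proof (intro exI[of _ K] allI impI)
    fix f b c C B w and h :: real
    assume f [measurable]: "f \<in> borel_measurable real_product" and bd: "\<forall>x. \<bar>f x\<bar> \<le> B"
      and ex: "second_order_expansion P f b c C" and h: "0 \<le> h"
    define q where "q = (\<lambda>x. (\<Sum>p\<in>P. b w p * (sqrt h * L x p))
        + (\<Sum>p\<in>P. \<Sum>q\<in>P. c w p q * ((sqrt h * L x p) * (sqrt h * L x q))) / 2)"
    have hh: "c w p q * ((sqrt h * L x p) * (sqrt h * L x q)) = (c w p q * h) * (L x p * L x q)" for x p q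
      using h by (simp add: mult_ac)
    define q1 where "q1 = (\<lambda>x. \<Sum>p\<in>P. b w p * (sqrt h * L x p))"
    define q2 where "q2 = (\<lambda>x. \<Sum>p\<in>P. \<Sum>q\<in>P. c w p q * ((sqrt h * L x p) * (sqrt h * L x q)))"
    have q_eq: "q = (\<lambda>x. q1 x + q2 x / 2)" by (simp add: q_def q1_def q2_def)
    have q1: "integrable ?N q1" "(\<integral>x. q1 x \<partial>?N) = 0"
      using L1 by (simp_all add: q1_def Bochner_Integration.integral_sum)
    have i2: "integrable ?N (\<lambda>x. (c w p q * h) * (L x p * L x q))" for p q
      using L2 by (rule integrable_mult_right)
    have q2: "integrable ?N q2"
      unfolding q2_def hh by (intro Bochner_Integration.integrable_sum i2)
    have "(\<integral>x. q2 x \<partial>?N) = (\<Sum>p\<in>P. \<Sum>q\<in>P. (\<integral>x. (c w p q * h) * (L x p * L x q) \<partial>?N))"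
      unfolding q2_def hh using i2
      by (subst Bochner_Integration.integral_sum; (intro sum.cong refl Bochner_Integration.integral_sum Bochner_Integration.integrable_sum)?)
    also have "\<dots> = h * cov_form P (c w) A a"
      unfolding integral_mult_right_zero E2 by (simp add: sum_distrib_left mult_ac)
    finally have e2: "(\<integral>x. q2 x \<partial>?N) = h * cov_form P (c w) A a" .
    have q: "integrable ?N q" unfolding q_eq using q1 q2 by simp
    have Eq: "(\<integral>x. q x \<partial>?N) = h * cov_form P (c w) A a / 2"
      unfolding q_eq using q1 q2 e2 by simp
    have intf: "integrable ?N (\<lambda>x. f (\<lambda>p. w p + sqrt h * L x p))"
      by (rule N.integrable_const_bound[of _ B]) (use bd in auto)
    have "\<bar>(\<integral>x. f (\<lambda>p. w p + sqrt h * L x p) \<partial>?N) - f w - (\<integral>x. q x \<partial>?N)\<bar>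
        = \<bar>\<integral>x. f (\<lambda>p. w p + sqrt h * L x p) - f w - q x \<partial>?N\<bar>"
      using intf q by (simp add: N.prob_space)
    also have "\<dots> \<le> (\<integral>x. \<bar>f (\<lambda>p. w p + sqrt h * L x p) - f w - q x\<bar> \<partial>?N)"
      by (rule integral_abs_bound)
    also have "\<dots> \<le> (\<integral>x. C * (h * sqrt h) * (\<Sum>p\<in>P. \<bar>L x p\<bar>) ^ 3 \<partial>?N)"
    proof (rule integral_mono)
      fix x
      have "\<bar>f (\<lambda>p. w p + sqrt h * L x p) - f w - q x\<bar> \<le> C * (\<Sum>p\<in>P. \<bar>sqrt h * L x p\<bar>) ^ 3"
        using ex[unfolded second_order_expansion_def, rule_format, of w "\<lambda>p. sqrt h * L x p"]
        by (simp add: q_def diff_diff_eq)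
      also have "(\<Sum>p\<in>P. \<bar>sqrt h * L x p\<bar>) = sqrt h * (\<Sum>p\<in>P. \<bar>L x p\<bar>)"
        using h by (simp add: abs_mult sum_distrib_left)
      also have "C * (sqrt h * (\<Sum>p\<in>P. \<bar>L x p\<bar>)) ^ 3 = C * (h * sqrt h) * (\<Sum>p\<in>P. \<bar>L x p\<bar>) ^ 3"
        using h by (simp add: power_mult_distrib power3_eq_cube)
      finally show "\<bar>f (\<lambda>p. w p + sqrt h * L x p) - f w - q x\<bar> \<le> C * (h * sqrt h) * (\<Sum>p\<in>P. \<bar>L x p\<bar>) ^ 3" .
    qed (use intf q S3 in auto)
    also have "\<dots> = C * K * (h * sqrt h)" by (simp add: K_def)
    finally have "\<bar>(\<integral>x. f (\<lambda>p. w p + sqrt h * L x p) \<partial>?N) - f w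
          - h * cov_form P (c w) A a / 2\<bar> \<le> C * K * (h * sqrt h)"
      unfolding Eq .
    moreover have "(\<integral>x. f (\<lambda>p. w p + sqrt h * x p) \<partial>gauss_image A a) = (\<integral>x. f (\<lambda>p. w p + sqrt h * L x p) \<partial>?N)"
      unfolding gauss_image_def L_def[symmetric] by (subst integral_distr) auto
    ultimately show "\<bar>(\<integral>x. f (\<lambda>p. w p + sqrt h * x p) \<partial>gauss_image A a) - f w
          - h * cov_form P (c w) A a / 2\<bar> \<le> C * K * (h * sqrt h)"
      by simp
  qed
qed

text \<open>The hypothesis on the covariances is the one of Gordon's and Slepian's lemmas: the covariance
  of the larger side may exceed the other one only in directions where the mixed second
  derivative of \<open>f\<close> is nonnegative.\<close>

lemma gaussian_comparison:
  fixes a b :: "'p \<Rightarrow> 'k \<Rightarrow> real"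
  assumes A: "finite A" and A': "finite A'" and P: "finite P"
    and f: "f \<in> borel_measurable real_product" and bd: "\<And>x. \<bar>f x\<bar> \<le> B"
    and ex: "second_order_expansion P f d c C" and C: "0 \<le> C"
    and cov: "\<And>w p q. p \<in> P \<Longrightarrow> q \<in> P \<Longrightarrow>
       c w p q * (\<Sum>k\<in>A'. b p k * b q k) \<le> c w p q * (\<Sum>k\<in>A. a p k * a q k)"
  shows "(\<integral>y. f y \<partial>gauss_image A' b) \<le> (\<integral>x. f x \<partial>gauss_image A a)"
proof -
  obtain K where K: "\<And>w h. 0 \<le> h \<Longrightarrow> \<bar>(\<integral>x. f (\<lambda>p. w p + sqrt h * x p) \<partial>gauss_image A a) - f w
          - h * cov_form P (c w) A a / 2\<bar> \<le> C * K * (h * sqrt h)"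
    using integral_gauss_image_expansion[OF A P, of a] f bd ex by blast
  obtain K' where K': "\<And>w h. 0 \<le> h \<Longrightarrow> \<bar>(\<integral>x. f (\<lambda>p. w p + sqrt h * x p) \<partial>gauss_image A' b) - f w
          - h * cov_form P (c w) A' b / 2\<bar> \<le> C * K' * (h * sqrt h)"
    using integral_gauss_image_expansion[OF A' P, of b] f bd ex by blast
  show ?thesis
  proof (rule integral_le_of_small_time_comparison[OF _ _ f bd])
    fix w and h :: real assume h: "0 \<le> h"
    have "cov_form P (c w) A' b \<le> cov_form P (c w) A a"
      by (intro sum_mono cov)
    hence "h * cov_form P (c w) A' b / 2 \<le> h * cov_form P (c w) A a / 2"
      using h by (intro divide_right_mono mult_left_mono) auto
    thus "(\<integral>y. f (\<lambda>p. w p + sqrt h * y p) \<partial>gauss_image A' b) - (C * K + C * K') * (h * sqrt h)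
       \<le> (\<integral>x. f (\<lambda>p. w p + sqrt h * x p) \<partial>gauss_image A a)"
      using K[OF h, of w] K'[OF h, of w] by (simp add: ring_distribs)
  qed (use A A' in \<open>auto intro: sqrt_stable_gauss_image\<close>)
qed

section \<open>Gordon's inequality\<close>

text \<open>The bounded local variant is the one that products preserve: products of Taylor terms
  and remainders contain powers of the increment above the third, which a cube dominates only when
  the increment has l1 norm at most 1.\<close>

definition local_expansion ::
  "'p set \<Rightarrow> (('p \<Rightarrow> real) \<Rightarrow> real) \<Rightarrow> (('p \<Rightarrow> real) \<Rightarrow> 'p \<Rightarrow> real)
     \<Rightarrow> (('p \<Rightarrow> real) \<Rightarrow> 'p \<Rightarrow> 'p \<Rightarrow> real) \<Rightarrow> real \<Rightarrow> bool" where
  "local_expansion P f b c C \<longleftrightarrow>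
     (\<forall>w. \<bar>f w\<bar> \<le> C \<and> (\<forall>p. \<bar>b w p\<bar> \<le> C) \<and> (\<forall>p q. \<bar>c w p q\<bar> \<le> C)) \<and>
     (\<forall>w u. (\<Sum>p\<in>P. \<bar>u p\<bar>) \<le> 1 \<longrightarrow>
        \<bar>f (\<lambda>p. w p + u p) - f w - (\<Sum>p\<in>P. b w p * u p) - quad_form P (c w) u / 2\<bar>
          \<le> C * (\<Sum>p\<in>P. \<bar>u p\<bar>) ^ 3)"

lemma abs_linear_form_le:
  fixes b u :: "'p \<Rightarrow> real"
  assumes "\<And>p. \<bar>b p\<bar> \<le> C"
  shows "\<bar>\<Sum>p\<in>P. b p * u p\<bar> \<le> C * (\<Sum>p\<in>P. \<bar>u p\<bar>)"
proof -
  have "\<bar>\<Sum>p\<in>P. b p * u p\<bar> \<le> (\<Sum>p\<in>P. \<bar>b p\<bar> * \<bar>u p\<bar>)"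
    by (simp add: abs_mult[symmetric] sum_abs)
  also have "\<dots> \<le> (\<Sum>p\<in>P. C * \<bar>u p\<bar>)" using assms by (intro sum_mono mult_right_mono) auto
  finally show ?thesis by (simp add: sum_distrib_left)
qed

lemma abs_quadratic_form_le:
  fixes c :: "'p \<Rightarrow> 'p \<Rightarrow> real"
  assumes "\<And>p q. \<bar>c p q\<bar> \<le> C"
  shows "\<bar>\<Sum>p\<in>P. \<Sum>q\<in>P. c p q * (u p * u q)\<bar> \<le> C * (\<Sum>p\<in>P. \<bar>u p\<bar>)\<^sup>2"
proof -
  have "\<bar>\<Sum>p\<in>P. \<Sum>q\<in>P. c p q * (u p * u q)\<bar> \<le> (\<Sum>p\<in>P. \<Sum>q\<in>P. \<bar>c p q\<bar> * (\<bar>u p\<bar> * \<bar>u q\<bar>))"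
    by (intro order_trans[OF sum_abs] sum_mono) (simp add: abs_mult)
  also have "\<dots> \<le> (\<Sum>p\<in>P. \<Sum>q\<in>P. C * (\<bar>u p\<bar> * \<bar>u q\<bar>))"
    using assms by (intro sum_mono mult_right_mono) auto
  also have "\<dots> = C * (\<Sum>p\<in>P. \<bar>u p\<bar>)\<^sup>2"
    unfolding power2_eq_square sum_product by (simp only: sum_distrib_left)
  finally show ?thesis .
qed

lemma local_expansion_imp_second_order_expansion:
  assumes "local_expansion P f b c C"
  shows "second_order_expansion P f b c (4 * C)" and "0 \<le> C"
proof -
  have bd: "\<bar>f w\<bar> \<le> C" "\<bar>b w p\<bar> \<le> C" "\<bar>c w p q\<bar> \<le> C" for w p q
    using assms by (auto simp: local_expansion_def)
  show C: "0 \<le> C" using bd(1)[of undefined] by linarith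
  show "second_order_expansion P f b c (4 * C)"
    unfolding second_order_expansion_def
  proof (intro allI)
    fix w u :: "'a \<Rightarrow> real"
    define s where "s = (\<Sum>p\<in>P. \<bar>u p\<bar>)"
    have s0: "0 \<le> s" by (simp add: s_def sum_nonneg)
    let ?l = "\<Sum>p\<in>P. b w p * u p" and ?q = "\<Sum>p\<in>P. \<Sum>q\<in>P. c w p q * (u p * u q)"
    show "\<bar>f (\<lambda>p. w p + u p) - f w - ?l - ?q / 2\<bar> \<le> 4 * C * (\<Sum>p\<in>P. \<bar>u p\<bar>) ^ 3"
    proof (cases "s \<le> 1")
      case True
      hence "\<bar>f (\<lambda>p. w p + u p) - f w - ?l - ?q / 2\<bar> \<le> C * s ^ 3"
        using assms by (auto simp: local_expansion_def s_def)
      also have "\<dots> \<le> 4 * C * s ^ 3" using C s0 by (intro mult_right_mono) auto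
      finally show ?thesis by (simp add: s_def)
    next
      case False
      have p: "1 \<le> s ^ 3" "s \<le> s ^ 3" "s\<^sup>2 \<le> s ^ 3"
        using False power_increasing[of 0 3 s] power_increasing[of 1 3 s] power_increasing[of 2 3 s] by auto
      have "\<bar>?l\<bar> \<le> C * s" unfolding s_def by (rule abs_linear_form_le) (rule bd)
      moreover have "\<bar>?q\<bar> \<le> C * s\<^sup>2" unfolding s_def by (rule abs_quadratic_form_le) (rule bd)
      moreover have "\<bar>f (\<lambda>p. w p + u p)\<bar> \<le> C" "\<bar>f w\<bar> \<le> C" by (rule bd)+
      moreover have "C * 1 \<le> C * s ^ 3" "C * s \<le> C * s ^ 3" "C * s\<^sup>2 \<le> C * s ^ 3"
        using C p by (intro mult_left_mono; simp)+
      ultimately show ?thesis unfolding s_def[symmetric] by linarith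
    qed
  qed
qed

text \<open>The Leibniz rules for gradient and Hessian. The remainder comes out with the constant 1
  + 3 + 1/2 + 1/2 + 1/4 = 21/4, rounded up to 6; the same 6 covers the four products in the
  Hessian.\<close>

lemma local_expansion_mult:
  assumes f: "local_expansion P f b c C" and g: "local_expansion P g b' c' C'"
  shows "local_expansion P (\<lambda>w. f w * g w) (\<lambda>w p. f w * b' w p + g w * b w p)
    (\<lambda>w p q. f w * c' w p q + g w * c w p q + b w p * b' w q + b' w p * b w q) (6 * (C * C'))"
proof -
  let ?c = "\<lambda>w p q. f w * c' w p q + g w * c w p q + b w p * b' w q + b' w p * b w q"
  have F: "\<bar>f w\<bar> \<le> C" "\<bar>b w p\<bar> \<le> C" "\<bar>c w p q\<bar> \<le> C" for w p q
    using f by (auto simp: local_expansion_def)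
  have G: "\<bar>g w\<bar> \<le> C'" "\<bar>b' w p\<bar> \<le> C'" "\<bar>c' w p q\<bar> \<le> C'" for w p q
    using g by (auto simp: local_expansion_def)
  have C: "0 \<le> C" "0 \<le> C'" using F(1)[of undefined] G(1)[of undefined] by linarith+
  have M: "\<bar>x * y\<bar> \<le> C * C'" "\<bar>y * x\<bar> \<le> C * C'" if "\<bar>x\<bar> \<le> C" "\<bar>y\<bar> \<le> C'" for x y
  proof -
    show "\<bar>x * y\<bar> \<le> C * C'" unfolding abs_mult using that C by (intro mult_mono) auto
    thus "\<bar>y * x\<bar> \<le> C * C'" by (simp only: mult.commute)
  qed
  show ?thesis
    unfolding local_expansion_def
  proof (intro conjI allI impI)
    fix w p q
    show "\<bar>f w * g w\<bar> \<le> 6 * (C * C')"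
      using M(1)[OF F(1)[of w] G(1)[of w]] mult_nonneg_nonneg[OF C] by linarith
    show "\<bar>f w * b' w p + g w * b w p\<bar> \<le> 6 * (C * C')"
      using M(1)[OF F(1)[of w] G(2)[of w p]] M(2)[OF F(2)[of w p] G(1)[of w]] by linarith
    show "\<bar>?c w p q\<bar> \<le> 6 * (C * C')"
      using M(1)[OF F(1)[of w] G(3)[of w p q]] M(2)[OF F(3)[of w p q] G(1)[of w]]
        M(1)[OF F(2)[of w p] G(2)[of w q]] M(2)[OF F(2)[of w q] G(2)[of w p]] by linarith
  next
    fix w u :: "'a \<Rightarrow> real"
    define s where "s = (\<Sum>p\<in>P. \<bar>u p\<bar>)"
    assume "(\<Sum>p\<in>P. \<bar>u p\<bar>) \<le> 1"
    hence s1: "s \<le> 1" by (simp add: s_def)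
    have s0: "0 \<le> s" by (simp add: s_def sum_nonneg)
    define l l' where "l = (\<Sum>p\<in>P. b w p * u p)" and "l' = (\<Sum>p\<in>P. b' w p * u p)"
    define q q' where "q = quad_form P (c w) u / 2"
      and "q' = quad_form P (c' w) u / 2"
    define r where "r = f (\<lambda>p. w p + u p) - f w - l - q"
    define r' where "r' = g (\<lambda>p. w p + u p) - g w - l' - q'"
    have r: "\<bar>r\<bar> \<le> C * s ^ 3" "\<bar>r'\<bar> \<le> C' * s ^ 3"
      using f g s1 unfolding local_expansion_def r_def r'_def l_def l'_def q_def q'_def s_def by blast+
    have l: "\<bar>l\<bar> \<le> C * s" "\<bar>l'\<bar> \<le> C' * s"
      unfolding l_def l'_def s_def using F G by (auto intro!: abs_linear_form_le)
    have q: "\<bar>q\<bar> \<le> C * s\<^sup>2 / 2" "\<bar>q'\<bar> \<le> C' * s\<^sup>2 / 2"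
      unfolding q_def q'_def s_def using abs_quadratic_form_le[of "c w" C u P] abs_quadratic_form_le[of "c' w" C' u P] F G by auto
    have lin: "(\<Sum>p\<in>P. (f w * b' w p + g w * b w p) * u p) = f w * l' + g w * l"
      by (simp add: l_def l'_def sum_distrib_left sum.distrib algebra_simps)
    have ll: "(\<Sum>p\<in>P. \<Sum>q\<in>P. b w p * b' w q * (u p * u q)) = l * l'"
      "(\<Sum>p\<in>P. \<Sum>q\<in>P. b' w p * b w q * (u p * u q)) = l' * l"
      unfolding l_def l'_def sum_product by (auto intro!: sum.cong)
    have quad: "(\<Sum>p\<in>P. \<Sum>q\<in>P. ?c w p q * (u p * u q)) / 2
        = f w * q' + g w * q + l * l'"
    proof -
      have "(\<Sum>p\<in>P. \<Sum>q\<in>P. ?c w p q * (u p * u q))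
        = (\<Sum>p\<in>P. \<Sum>q\<in>P. f w * (c' w p q * (u p * u q)) + g w * (c w p q * (u p * u q))
            + b w p * b' w q * (u p * u q) + b' w p * b w q * (u p * u q))"
        by (intro sum.cong refl) (simp add: algebra_simps)
      also have "\<dots> = f w * quad_form P (c' w) u + g w * quad_form P (c w) u
          + l * l' + l' * l"
        by (simp add: sum.distrib ll sum_distrib_left)
      finally show ?thesis by (simp add: q_def q'_def add_divide_distrib)
    qed
    have g_eq: "g (\<lambda>p. w p + u p) = g w + l' + q' + r'" and f_eq: "f (\<lambda>p. w p + u p) = f w + l + q + r"
      by (simp_all add: r_def r'_def)
    \<comment> \<open>Leaving the shifted value of \<open>f\<close> unexpanded in front of
      \<open>r'\<close> keeps the list short: every term on the right has order at least three in
      \<open>u\<close>.\<close>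
    have "f (\<lambda>p. w p + u p) * g (\<lambda>p. w p + u p) - f w * g w - (f w * l' + g w * l) - (f w * q' + g w * q + l * l')
      = f (\<lambda>p. w p + u p) * r' + r * (g w + l' + q') + l * q' + q * l' + q * q'"
      unfolding g_eq f_eq by (simp add: algebra_simps)
    also have "\<bar>\<dots>\<bar> \<le> C * (C' * s ^ 3) + (C * s ^ 3) * (C' + C' + C') + (C * s) * (C' * s\<^sup>2 / 2) + (C * s\<^sup>2 / 2) * (C' * s) + (C * s\<^sup>2 / 2) * (C' * s / 2)"
    proof -
      have s2: "C' * s\<^sup>2 \<le> C' * s" "C' * s \<le> C' * 1"
        using C s0 s1 mult_left_mono[OF s1 C(2)] by (auto intro!: mult_left_mono simp: power2_eq_square mult_left_le_one_le)
      have "\<bar>f (\<lambda>p. w p + u p) * r'\<bar> \<le> C * (C' * s ^ 3)"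
        unfolding abs_mult using F r C by (intro mult_mono) auto
      moreover have "\<bar>r * (g w + l' + q')\<bar> \<le> (C * s ^ 3) * (C' + C' + C')"
        unfolding abs_mult
      proof (intro mult_mono)
        show "\<bar>g w + l' + q'\<bar> \<le> C' + C' + C'" using G(1)[of w] l q s2 by linarith
      qed (use r C s0 in auto)
      moreover have "\<bar>l * q'\<bar> \<le> (C * s) * (C' * s\<^sup>2 / 2)"
        unfolding abs_mult using l q C s0 by (intro mult_mono) auto
      moreover have "\<bar>q * l'\<bar> \<le> (C * s\<^sup>2 / 2) * (C' * s)"
        unfolding abs_mult using l q C s0 by (intro mult_mono) auto
      moreover have "\<bar>q * q'\<bar> \<le> (C * s\<^sup>2 / 2) * (C' * s / 2)"
        unfolding abs_mult using q C s0 s2 by (intro mult_mono) auto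
      ultimately show ?thesis by linarith
    qed
    also have "\<dots> = (21/4) * (C * C') * s ^ 3"
      by (simp add: power2_eq_square power3_eq_cube algebra_simps)
    also have "\<dots> \<le> 6 * (C * C') * s ^ 3" using C s0 by (intro mult_right_mono) auto
    finally show "\<bar>f (\<lambda>p. w p + u p) * g (\<lambda>p. w p + u p) - f w * g w - (\<Sum>p\<in>P. (f w * b' w p + g w * b w p) * u p)
       - (\<Sum>p\<in>P. \<Sum>q\<in>P. ?c w p q * (u p * u q)) / 2\<bar>
       \<le> 6 * (C * C') * (\<Sum>p\<in>P. \<bar>u p\<bar>) ^ 3"
      unfolding lin quad s_def[symmetric] .
  qed
qed

lemma local_expansion_one_minus:
  assumes "local_expansion P f b c C"
  shows "local_expansion P (\<lambda>w. 1 - f w) (\<lambda>w p. - b w p) (\<lambda>w p q. - c w p q) (1 + C)"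
  unfolding local_expansion_def
proof (intro conjI allI impI)
  have bd: "\<bar>f w\<bar> \<le> C" "\<bar>b w p\<bar> \<le> C" "\<bar>c w p q\<bar> \<le> C" for w p q
    using assms by (auto simp: local_expansion_def)
  fix w p q
  show "\<bar>1 - f w\<bar> \<le> 1 + C" "\<bar>- b w p\<bar> \<le> 1 + C" "\<bar>- c w p q\<bar> \<le> 1 + C"
    using bd(1)[of w] bd(2)[of w p] bd(3)[of w p q] by linarith+
next
  fix w u :: "'a \<Rightarrow> real"
  let ?s = "(\<Sum>p\<in>P. \<bar>u p\<bar>)"
  assume "?s \<le> 1"
  hence "\<bar>f (\<lambda>p. w p + u p) - f w - (\<Sum>p\<in>P. b w p * u p) - quad_form P (c w) u / 2\<bar> \<le> C * ?s ^ 3"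
    using assms by (auto simp: local_expansion_def)
  also have "\<dots> \<le> (1 + C) * ?s ^ 3" by (intro mult_right_mono) (auto intro: sum_nonneg)
  finally show "\<bar>1 - f (\<lambda>p. w p + u p) - (1 - f w) - (\<Sum>p\<in>P. - b w p * u p)
      - (\<Sum>p\<in>P. \<Sum>q\<in>P. - c w p q * (u p * u q)) / 2\<bar> \<le> (1 + C) * ?s ^ 3"
    by (simp add: sum_negf abs_if split: if_splits)
qed

lemma local_expansion_const: "local_expansion P (\<lambda>_. k) (\<lambda>_ _. 0) (\<lambda>_ _ _. 0) \<bar>k\<bar>"
  by (auto simp: local_expansion_def intro!: mult_nonneg_nonneg sum_nonneg)

lemma local_expansion_coordinate:
  fixes \<sigma> \<sigma>1 \<sigma>2 :: "real \<Rightarrow> real"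
  assumes P: "finite P" "p0 \<in> P"
    and bd: "\<And>x. \<bar>\<sigma> x\<bar> \<le> C" "\<And>x. \<bar>\<sigma>1 x\<bar> \<le> C" "\<And>x. \<bar>\<sigma>2 x\<bar> \<le> C"
    and ex: "\<And>x u. \<bar>\<sigma> (x + u) - \<sigma> x - \<sigma>1 x * u - \<sigma>2 x * u\<^sup>2 / 2\<bar> \<le> C * \<bar>u\<bar> ^ 3"
  shows "local_expansion P (\<lambda>w. \<sigma> (w p0)) (\<lambda>w p. if p = p0 then \<sigma>1 (w p0) else 0)
     (\<lambda>w p q. if p = p0 \<and> q = p0 then \<sigma>2 (w p0) else 0) C"
  unfolding local_expansion_def
proof (intro conjI allI impI)
  have C: "0 \<le> C" using bd(1)[of undefined] by linarith
  fix w p q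
  show "\<bar>\<sigma> (w p0)\<bar> \<le> C" "\<bar>if p = p0 then \<sigma>1 (w p0) else 0\<bar> \<le> C"
    "\<bar>if p = p0 \<and> q = p0 then \<sigma>2 (w p0) else 0\<bar> \<le> C"
    using bd C by auto
next
  have C: "0 \<le> C" using bd(1)[of undefined] by linarith
  fix w u :: "'a \<Rightarrow> real"
  have 1: "(\<Sum>p\<in>P. (if p = p0 then \<sigma>1 (w p0) else 0) * u p) = \<sigma>1 (w p0) * u p0"
  proof -
    have "(\<Sum>p\<in>P. (if p = p0 then \<sigma>1 (w p0) else 0) * u p) = (\<Sum>p\<in>P. if p = p0 then \<sigma>1 (w p0) * u p0 else 0)"
      by (intro sum.cong) auto
    thus ?thesis using P by simp
  qed
  have 2: "(\<Sum>p\<in>P. \<Sum>q\<in>P. (if p = p0 \<and> q = p0 then \<sigma>2 (w p0) else 0) * (u p * u q)) = \<sigma>2 (w p0) * (u p0)\<^sup>2"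
  proof -
    have "(\<Sum>p\<in>P. \<Sum>q\<in>P. (if p = p0 \<and> q = p0 then \<sigma>2 (w p0) else 0) * (u p * u q))
       = (\<Sum>p\<in>P. \<Sum>q\<in>P. if q = p0 then (if p = p0 then \<sigma>2 (w p0) * (u p0)\<^sup>2 else 0) else 0)"
      by (intro sum.cong refl) (auto simp: power2_eq_square)
    thus ?thesis using P by simp
  qed
  have "\<bar>u p0\<bar> \<le> (\<Sum>p\<in>P. \<bar>u p\<bar>)" using P by (intro member_le_sum) auto
  hence "C * \<bar>u p0\<bar> ^ 3 \<le> C * (\<Sum>p\<in>P. \<bar>u p\<bar>) ^ 3" using C by (intro mult_left_mono power_mono) auto
  with ex[of "w p0" "u p0"]
  show "\<bar>\<sigma> (w p0 + u p0) - \<sigma> (w p0) - (\<Sum>p\<in>P. (if p = p0 then \<sigma>1 (w p0) else 0) * u p)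
     - (\<Sum>p\<in>P. \<Sum>q\<in>P. (if p = p0 \<and> q = p0 then \<sigma>2 (w p0) else 0) * (u p * u q)) / 2\<bar> \<le> C * (\<Sum>p\<in>P. \<bar>u p\<bar>) ^ 3"
    unfolding 1 2 by linarith
qed

text \<open>A cubic spline: the third difference of \<open>max 0 x ^ 3 / 6\<close>.\<close>

lemma smooth_step_exists:
  fixes \<alpha> \<beta> :: real
  assumes "\<alpha> < \<beta>"
  shows "\<exists>\<sigma> \<sigma>1 \<sigma>2 C. \<sigma> \<in> borel_measurable borel \<and> (\<forall>x\<le>\<alpha>. \<sigma> x = 0) \<and> (\<forall>x\<ge>\<beta>. \<sigma> x = 1)
    \<and> (\<forall>x. 0 \<le> \<sigma> x \<and> \<sigma> x \<le> 1 \<and> 0 \<le> \<sigma>1 x \<and> \<bar>\<sigma> x\<bar> \<le> C \<and> \<bar>\<sigma>1 x\<bar> \<le> C \<and> \<bar>\<sigma>2 x\<bar> \<le> C)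
    \<and> (\<forall>x u. \<bar>\<sigma> (x + u) - \<sigma> x - \<sigma>1 x * u - \<sigma>2 x * u\<^sup>2 / 2\<bar> \<le> C * \<bar>u\<bar> ^ 3)"
proof -
  define m where "m = (\<lambda>x::real. max 0 x)"
  define s where "s = (\<lambda>x. ((m x) ^ 3 - 3 * (m (x - 1)) ^ 3 + 3 * (m (x - 2)) ^ 3 - (m (x - 3)) ^ 3) / 6)"
  define s1 where "s1 = (\<lambda>x. ((m x)\<^sup>2 - 3 * (m (x - 1))\<^sup>2 + 3 * (m (x - 2))\<^sup>2 - (m (x - 3))\<^sup>2) / 2)"
  define s2 where "s2 = (\<lambda>x. m x - 3 * m (x - 1) + 3 * m (x - 2) - m (x - 3))"
  have exm: "\<bar>(m (x + u)) ^ 3 - (m x) ^ 3 - 3 * (m x)\<^sup>2 * u - 3 * m x * u\<^sup>2\<bar> \<le> \<bar>u\<bar> ^ 3" for x u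
  proof -
    consider "0 \<le> x" "0 \<le> x + u" | "0 \<le> x" "x + u < 0" | "x < 0" "0 \<le> x + u" | "x < 0" "x + u < 0" by linarith
    thus ?thesis
    proof cases
      case 1
      hence "(m (x + u)) ^ 3 - (m x) ^ 3 - 3 * (m x)\<^sup>2 * u - 3 * m x * u\<^sup>2 = u ^ 3"
        by (simp add: m_def power2_eq_square power3_eq_cube algebra_simps)
      thus ?thesis by (simp add: power_abs)
    next
      case 2
      hence eq: "(m (x + u)) ^ 3 - (m x) ^ 3 - 3 * (m x)\<^sup>2 * u - 3 * m x * u\<^sup>2 = (- (x + u)) ^ 3 - (- u) ^ 3"
        by (simp add: m_def power2_eq_square power3_eq_cube algebra_simps)
      have "0 \<le> (- (x + u)) ^ 3" using 2 by (intro zero_le_power) simp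
      moreover have "(- (x + u)) ^ 3 \<le> (- u) ^ 3" using 2 by (intro power_mono) auto
      moreover have "\<bar>u\<bar> ^ 3 = (- u) ^ 3" using 2 by (simp add: abs_if)
      ultimately show ?thesis unfolding eq by linarith
    next
      case 3
      hence "(m (x + u)) ^ 3 - (m x) ^ 3 - 3 * (m x)\<^sup>2 * u - 3 * m x * u\<^sup>2 = (x + u) ^ 3" by (simp add: m_def)
      moreover have "(x + u) ^ 3 \<le> u ^ 3" "0 \<le> (x + u) ^ 3" using 3 by (auto intro!: power_mono zero_le_power)
      moreover have "\<bar>u\<bar> ^ 3 = u ^ 3" using 3 by simp
      ultimately show ?thesis by linarith
    qed (simp add: m_def)
  qed
  have exs: "\<bar>s (x + u) - s x - s1 x * u - s2 x * u\<^sup>2 / 2\<bar> \<le> 2 * \<bar>u\<bar> ^ 3" for x u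
  proof -
    define R where "R = (\<lambda>y. (m (y + u)) ^ 3 - (m y) ^ 3 - 3 * (m y)\<^sup>2 * u - 3 * m y * u\<^sup>2)"
    have R: "\<bar>R y\<bar> \<le> \<bar>u\<bar> ^ 3" for y using exm unfolding R_def .
    have eq: "s (x + u) - s x - s1 x * u - s2 x * u\<^sup>2 / 2 = (R x - 3 * R (x - 1) + 3 * R (x - 2) - R (x - 3)) / 6"
      by (simp add: s_def s1_def s2_def R_def field_simps)
    \<comment> \<open>The weights 1, 3, 3, 1 of the third difference sum to 8, and 8/6 is at most
      2.\<close>
    have *: "\<bar>(a - 3 * b + 3 * c - d) / 6\<bar> \<le> 2 * z"
      if "\<bar>a\<bar> \<le> z" "\<bar>b\<bar> \<le> z" "\<bar>c\<bar> \<le> z" "\<bar>d\<bar> \<le> z" for a b c d z :: real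
    proof -
      have "- z \<le> a" "a \<le> z" "- z \<le> b" "b \<le> z" "- z \<le> c" "c \<le> z" "- z \<le> d" "d \<le> z" using that by linarith+
      hence "a - 3 * b + 3 * c - d \<le> 12 * z" "- (12 * z) \<le> a - 3 * b + 3 * c - d" by linarith+
      thus ?thesis by (simp add: abs_le_iff)
    qed
    show ?thesis unfolding eq by (rule *) (rule R)+
  qed
  have cases: "s x = 0 \<and> s1 x = 0 \<and> s2 x = 0" if "x \<le> 0" for x using that by (simp add: s_def s1_def s2_def m_def)
  have cases3: "s x = 1 \<and> s1 x = 0 \<and> s2 x = 0" if "3 \<le> x" for x
    using that by (simp add: s_def s1_def s2_def m_def power2_eq_square power3_eq_cube algebra_simps)
  have bs: "0 \<le> s x \<and> s x \<le> 1 \<and> 0 \<le> s1 x \<and> \<bar>s1 x\<bar> \<le> 3 \<and> \<bar>s2 x\<bar> \<le> 3" for x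
  proof -
    consider "x \<le> 0" | "0 \<le> x" "x \<le> 1" | "1 \<le> x" "x \<le> 2" | "2 \<le> x" "x \<le> 3" | "3 \<le> x" by linarith
    thus ?thesis
    proof cases
      case 2
      have "x ^ 3 \<le> 1" "x\<^sup>2 \<le> 1" "0 \<le> x ^ 3" using 2 by (auto intro!: power_le_one)
      thus ?thesis using 2 by (auto simp: s_def s1_def s2_def m_def)
    next
      case 3
      define y where "y = x - 1"
      have x: "x = 1 + y" and y: "0 \<le> y" "y \<le> 1" using 3 by (auto simp: y_def)
      have p: "0 \<le> y\<^sup>2" "y\<^sup>2 \<le> y" "y ^ 3 \<le> y\<^sup>2" "0 \<le> y ^ 3"
        using y power_decreasing[of 1 2 y] power_decreasing[of 2 3 y] by auto
      have e: "s x = (1 + 3 * y + 3 * y\<^sup>2 - 2 * y ^ 3) / 6" "s1 x = (1 + 2 * y - 2 * y\<^sup>2) / 2" "s2 x = 1 - 2 * y"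
        using y unfolding x s_def s1_def s2_def m_def by (simp_all add: power2_eq_square power3_eq_cube algebra_simps)
      have "3 * y\<^sup>2 - 2 * y ^ 3 \<le> 1"
      proof -
        have "1 - 3 * y\<^sup>2 + 2 * y ^ 3 = (1 - y)\<^sup>2 * (1 + 2 * y)" by (simp add: power2_eq_square power3_eq_cube algebra_simps)
        moreover have "0 \<le> (1 - y)\<^sup>2 * (1 + 2 * y)" using y by simp
        ultimately show ?thesis by linarith
      qed
      hence "0 \<le> 1 + 3 * y + 3 * y\<^sup>2 - 2 * y ^ 3" "1 + 3 * y + 3 * y\<^sup>2 - 2 * y ^ 3 \<le> 6"
        "0 \<le> 1 + 2 * y - 2 * y\<^sup>2" "1 + 2 * y - 2 * y\<^sup>2 \<le> 6" using p y by linarith+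
      thus ?thesis unfolding e using y by (simp add: abs_le_iff)
    next
      case 4
      define y where "y = 3 - x"
      have x: "x = 3 - y" and y: "0 \<le> y" "y \<le> 1" using 4 by (auto simp: y_def)
      have p: "0 \<le> y\<^sup>2" "y\<^sup>2 \<le> 1" "y ^ 3 \<le> 1" "0 \<le> y ^ 3" using y by (auto intro!: power_le_one)
      have e: "s x = (6 - y ^ 3) / 6" "s1 x = y\<^sup>2 / 2" "s2 x = - y"
        using y unfolding x s_def s1_def s2_def m_def by (simp_all add: power2_eq_square power3_eq_cube algebra_simps)
      show ?thesis unfolding e using p y by (auto simp: abs_le_iff)
    qed (use cases cases3 in auto)
  qed
  \<comment> \<open>The spline \<open>s\<close> rises from 0 to 1 on [0, 3]; \<open>k\<close>
    rescales this interval to [\<alpha>, \<beta>], and each derivative contributes a factor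
    \<open>k\<close> to the bounds.\<close>
  define k where "k = 3 / (\<beta> - \<alpha>)"
  have k: "0 < k" using assms by (simp add: k_def)
  define C where "C = 3 + 3 * k + 3 * k\<^sup>2 + 3 * k ^ 3"
  have C: "3 \<le> C" "3 * k \<le> C" "3 * k\<^sup>2 \<le> C" "3 * k ^ 3 \<le> C" "0 \<le> C" using k by (auto simp: C_def)
  show ?thesis
  proof (rule exI[of _ "\<lambda>x. s (k * (x - \<alpha>))"], rule exI[of _ "\<lambda>x. k * s1 (k * (x - \<alpha>))"],
      rule exI[of _ "\<lambda>x. k\<^sup>2 * s2 (k * (x - \<alpha>))"], rule exI[of _ C], intro conjI allI impI)
    show "(\<lambda>x. s (k * (x - \<alpha>))) \<in> borel_measurable borel" unfolding s_def m_def by measurable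
    fix x :: real
    show "s (k * (x - \<alpha>)) = 0" if "x \<le> \<alpha>" using that k cases[of "k * (x - \<alpha>)"] by (simp add: mult_nonneg_nonpos)
    show "s (k * (x - \<alpha>)) = 1" if "x \<ge> \<beta>"
    proof -
      have "\<beta> - \<alpha> \<noteq> 0" using assms by simp
      hence "3 = k * (\<beta> - \<alpha>)" by (simp only: k_def times_divide_eq_left nonzero_mult_div_cancel_right not_False_eq_True)
      also have "\<dots> \<le> k * (x - \<alpha>)" using that k by (intro mult_left_mono) auto
      finally show ?thesis using cases3 by blast
    qed
    note b = bs[of "k * (x - \<alpha>)"]
    show "0 \<le> s (k * (x - \<alpha>))" "s (k * (x - \<alpha>)) \<le> 1" "0 \<le> k * s1 (k * (x - \<alpha>))" using b k by auto
    show "\<bar>s (k * (x - \<alpha>))\<bar> \<le> C" using b C by auto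
    have "k * \<bar>s1 (k * (x - \<alpha>))\<bar> \<le> k * 3" using b k by (intro mult_left_mono) auto
    thus "\<bar>k * s1 (k * (x - \<alpha>))\<bar> \<le> C" using C unfolding abs_mult abs_of_pos[OF k] by linarith
    have "k\<^sup>2 * \<bar>s2 (k * (x - \<alpha>))\<bar> \<le> k\<^sup>2 * 3" using b k by (intro mult_left_mono) auto
    thus "\<bar>k\<^sup>2 * s2 (k * (x - \<alpha>))\<bar> \<le> C" using C unfolding abs_mult abs_of_nonneg[OF zero_le_power2[of k]] by linarith
    fix u :: real
    have "\<bar>s (k * (x - \<alpha>) + k * u) - s (k * (x - \<alpha>)) - s1 (k * (x - \<alpha>)) * (k * u) - s2 (k * (x - \<alpha>)) * (k * u)\<^sup>2 / 2\<bar>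
       \<le> 2 * \<bar>k * u\<bar> ^ 3" by (rule exs)
    also have "\<dots> = (2 * k ^ 3) * \<bar>u\<bar> ^ 3" using k by (simp add: abs_mult power_mult_distrib)
    also have "\<dots> \<le> C * \<bar>u\<bar> ^ 3" using C k by (intro mult_right_mono) (auto simp: C_def)
    finally show "\<bar>s (k * (x + u - \<alpha>)) - s (k * (x - \<alpha>)) - k * s1 (k * (x - \<alpha>)) * u - k\<^sup>2 * s2 (k * (x - \<alpha>)) * u\<^sup>2 / 2\<bar> \<le> C * \<bar>u\<bar> ^ 3"
      by (simp add: algebra_simps power_mult_distrib)
  qed
qed

section \<open>Sign patterns of first and second derivatives\<close>

definition row_decreasing :: "('i \<times> 'j) set \<Rightarrow> 'i \<Rightarrow> (('i \<times> 'j \<Rightarrow> real) \<Rightarrow> real) \<Rightarrow> bool" where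
  "row_decreasing P i f \<longleftrightarrow> (\<forall>w. 0 \<le> f w \<and> f w \<le> 1) \<and> (\<exists>b c C. local_expansion P f b c C \<and>
     (\<forall>w p. b w p \<le> 0) \<and> (\<forall>w p. fst p \<noteq> i \<longrightarrow> b w p = 0) \<and> (\<forall>w p q. fst p \<noteq> i \<or> fst q \<noteq> i \<longrightarrow> c w p q = 0))"

text \<open>The sign pattern of Gordon's lemma. Second derivatives within one row are left free
  because there the two covariances agree. The sign of the gradient is carried along because
  products of gradients enter the Hessian of a product.\<close>

definition mixed_increasing :: "('i \<times> 'j) set \<Rightarrow> (('i \<times> 'j \<Rightarrow> real) \<Rightarrow> real) \<Rightarrow> bool" where
  "mixed_increasing P f \<longleftrightarrow> (\<forall>w. 0 \<le> f w \<and> f w \<le> 1) \<and> (\<exists>b c C. local_expansion P f b c C \<and>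
     (\<forall>w p. 0 \<le> b w p) \<and> (\<forall>w p q. fst p \<noteq> fst q \<longrightarrow> 0 \<le> c w p q))"

lemma row_decreasing_mult:
  assumes "row_decreasing P i f" "row_decreasing P i g"
  shows "row_decreasing P i (\<lambda>w. f w * g w)"
proof -
  obtain b c C b' c' C' where
    f: "\<And>w. 0 \<le> f w" "\<And>w. f w \<le> 1" "local_expansion P f b c C" "\<And>w p. b w p \<le> 0" "\<And>w p. fst p \<noteq> i \<Longrightarrow> b w p = 0"
       "\<And>w p q. fst p \<noteq> i \<or> fst q \<noteq> i \<Longrightarrow> c w p q = 0"
    and g: "\<And>w. 0 \<le> g w" "\<And>w. g w \<le> 1" "local_expansion P g b' c' C'" "\<And>w p. b' w p \<le> 0" "\<And>w p. fst p \<noteq> i \<Longrightarrow> b' w p = 0"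
       "\<And>w p q. fst p \<noteq> i \<or> fst q \<noteq> i \<Longrightarrow> c' w p q = 0"
    using assms unfolding row_decreasing_def by metis
  show ?thesis
    unfolding row_decreasing_def
  proof (intro conjI allI)
    show "0 \<le> f w * g w" "f w * g w \<le> 1" for w using f(1,2)[of w] g(1,2)[of w] by (auto intro: mult_le_one)
    show "\<exists>b c C. local_expansion P (\<lambda>w. f w * g w) b c C \<and>
     (\<forall>w p. b w p \<le> 0) \<and> (\<forall>w p. fst p \<noteq> i \<longrightarrow> b w p = 0) \<and> (\<forall>w p q. fst p \<noteq> i \<or> fst q \<noteq> i \<longrightarrow> c w p q = 0)"
      by (rule exI, rule exI, rule exI, rule conjI, rule local_expansion_mult[OF f(3) g(3)])
         (use f g in \<open>auto simp: add_nonpos_nonpos mult_nonneg_nonpos\<close>)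
  qed
qed

lemma mixed_increasing_mult:
  assumes "mixed_increasing P f" "mixed_increasing P g"
  shows "mixed_increasing P (\<lambda>w. f w * g w)"
proof -
  obtain b c C b' c' C' where
    f: "\<And>w. 0 \<le> f w" "\<And>w. f w \<le> 1" "local_expansion P f b c C" "\<And>w p. 0 \<le> b w p" "\<And>w p q. fst p \<noteq> fst q \<Longrightarrow> 0 \<le> c w p q"
    and g: "\<And>w. 0 \<le> g w" "\<And>w. g w \<le> 1" "local_expansion P g b' c' C'" "\<And>w p. 0 \<le> b' w p" "\<And>w p q. fst p \<noteq> fst q \<Longrightarrow> 0 \<le> c' w p q"
    using assms unfolding mixed_increasing_def by metis
  show ?thesis
    unfolding mixed_increasing_def
  proof (intro conjI allI)
    show "0 \<le> f w * g w" "f w * g w \<le> 1" for w using f(1,2)[of w] g(1,2)[of w] by (auto intro: mult_le_one)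
    show "\<exists>b c C. local_expansion P (\<lambda>w. f w * g w) b c C \<and>
     (\<forall>w p. 0 \<le> b w p) \<and> (\<forall>w p q. fst p \<noteq> fst q \<longrightarrow> 0 \<le> c w p q)"
      by (rule exI, rule exI, rule exI, rule conjI, rule local_expansion_mult[OF f(3) g(3)])
         (use f g in \<open>auto\<close>)
  qed
qed

text \<open>The second derivative of a function of one row vanishes between different rows, and the
  complement turns a nonpositive gradient into a nonnegative one.\<close>

lemma mixed_increasing_one_minus:
  assumes "row_decreasing P i f"
  shows "mixed_increasing P (\<lambda>w. 1 - f w)"
proof -
  obtain b c C where f: "\<And>w. 0 \<le> f w" "\<And>w. f w \<le> 1" "local_expansion P f b c C" "\<And>w p. b w p \<le> 0" "\<And>w p. fst p \<noteq> i \<Longrightarrow> b w p = 0"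
       "\<And>w p q. fst p \<noteq> i \<or> fst q \<noteq> i \<Longrightarrow> c w p q = 0"
    using assms unfolding row_decreasing_def by metis
  have "c w p q = 0" if "fst p \<noteq> fst q" for w p q using f(6)[of p q] that by metis
  thus ?thesis
    unfolding mixed_increasing_def
    by (intro conjI allI exI[of _ "\<lambda>w p. - b w p"] exI[of _ "\<lambda>w p q. - c w p q"] exI[of _ "1 + C"]
        local_expansion_one_minus[OF f(3)]) (use f in auto)
qed

lemma row_decreasing_const: "row_decreasing P i (\<lambda>_. 1)"
  unfolding row_decreasing_def
  by (intro conjI allI exI, simp, simp, rule local_expansion_const) simp_all

lemma mixed_increasing_const: "mixed_increasing P (\<lambda>_. 1)"
  unfolding mixed_increasing_def
  by (intro conjI allI exI, simp, simp, rule local_expansion_const) simp_all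

lemma row_decreasing_prod:
  assumes "finite V" "\<And>v. v \<in> V \<Longrightarrow> row_decreasing P i (f v)"
  shows "row_decreasing P i (\<lambda>w. \<Prod>v\<in>V. f v w)"
  using assms by (induction V rule: finite_induct) (auto intro: row_decreasing_mult row_decreasing_const)

lemma mixed_increasing_prod:
  assumes "finite U" "\<And>v. v \<in> U \<Longrightarrow> mixed_increasing P (f v)"
  shows "mixed_increasing P (\<lambda>w. \<Prod>v\<in>U. f v w)"
  using assms by (induction U rule: finite_induct) (auto intro: mixed_increasing_mult mixed_increasing_const)

text \<open>The test function \<open>f\<close> is the indicator of "every row has a large entry",
  written with products by de Morgan and smoothed by a step \<open>\<sigma>\<close> between
  \<open>\<alpha>\<close> and \<open>\<beta>\<close>. It is 1 when every row reaches
  \<open>\<beta>\<close> and 0 when some row stays at or below \<open>\<alpha>\<close>, so its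
  integral lies between the two probabilities; the gap between the thresholds is the price of
  smoothness.\<close>

lemma gordon_comparison:
  fixes a b :: "'i \<times> 'j \<Rightarrow> 'k \<Rightarrow> real"
  assumes fin: "finite A" "finite A'" "finite U" "finite V" and \<alpha>\<beta>: "\<alpha> < \<beta>"
    and row: "\<And>i j j'. i \<in> U \<Longrightarrow> j \<in> V \<Longrightarrow> j' \<in> V \<Longrightarrow>
       (\<Sum>k\<in>A'. b (i, j) k * b (i, j') k) = (\<Sum>k\<in>A. a (i, j) k * a (i, j') k)"
    and cov: "\<And>i i' j j'. i \<in> U \<Longrightarrow> i' \<in> U \<Longrightarrow> j \<in> V \<Longrightarrow> j' \<in> V \<Longrightarrow>
       (\<Sum>k\<in>A'. b (i, j) k * b (i', j') k) \<le> (\<Sum>k\<in>A. a (i, j) k * a (i', j') k)"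
  shows "\<P>(x in gauss_on A'. \<forall>i\<in>U. \<exists>j\<in>V. \<beta> \<le> (\<Sum>k\<in>A'. b (i, j) k * x k))
       \<le> \<P>(x in gauss_on A. \<forall>i\<in>U. \<exists>j\<in>V. \<alpha> < (\<Sum>k\<in>A. a (i, j) k * x k))"
proof -
  note [simp] = fin
  obtain \<sigma> \<sigma>1 \<sigma>2 C where [measurable]: "\<sigma> \<in> borel_measurable borel"
    and \<sigma>: "\<And>x. x \<le> \<alpha> \<Longrightarrow> \<sigma> x = 0" "\<And>x. \<beta> \<le> x \<Longrightarrow> \<sigma> x = 1" "\<And>x. 0 \<le> \<sigma> x" "\<And>x. \<sigma> x \<le> 1" "\<And>x. 0 \<le> \<sigma>1 x"
      "\<And>x. \<bar>\<sigma> x\<bar> \<le> C" "\<And>x. \<bar>\<sigma>1 x\<bar> \<le> C" "\<And>x. \<bar>\<sigma>2 x\<bar> \<le> C"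
      "\<And>x u. \<bar>\<sigma> (x + u) - \<sigma> x - \<sigma>1 x * u - \<sigma>2 x * u\<^sup>2 / 2\<bar> \<le> C * \<bar>u\<bar> ^ 3"
    using smooth_step_exists[OF \<alpha>\<beta>] by metis
  define P where "P = U \<times> V"
  have P: "finite P" by (simp add: P_def)
  define f where "f = (\<lambda>w. \<Prod>i\<in>U. 1 - (\<Prod>j\<in>V. 1 - \<sigma> (w (i, j))))"
  have [measurable]: "f \<in> borel_measurable real_product" unfolding f_def by measurable
  have "row_decreasing P i (\<lambda>w. 1 - \<sigma> (w (i, j)))" if "i \<in> U" "j \<in> V" for i j
  proof -
    have "(i, j) \<in> P" using that by (simp add: P_def)
    from local_expansion_one_minus[OF local_expansion_coordinate[OF P this \<sigma>(6-9)]]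
    show ?thesis unfolding row_decreasing_def
      by (intro conjI exI allI; (assumption)?) (use \<sigma> in auto)
  qed
  hence "mixed_increasing P f"
    unfolding f_def by (intro mixed_increasing_prod mixed_increasing_one_minus row_decreasing_prod) auto
  then obtain d c D where f: "\<And>w. 0 \<le> f w" "\<And>w. f w \<le> 1" "local_expansion P f d c D" "\<And>w p q. fst p \<noteq> fst q \<Longrightarrow> 0 \<le> c w p q"
    unfolding mixed_increasing_def by metis
  have le: "(\<integral>y. f y \<partial>gauss_image A' b) \<le> (\<integral>x. f x \<partial>gauss_image A a)"
  proof (rule gaussian_comparison[OF _ _ P])
    show "second_order_expansion P f d c (4 * D)" "0 \<le> 4 * D"
      using local_expansion_imp_second_order_expansion[OF f(3)] by auto
    show "\<bar>f x\<bar> \<le> 1" for x using f(1,2)[of x] by auto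
    fix w p q assume pq: "p \<in> P" "q \<in> P"
    show "c w p q * (\<Sum>k\<in>A'. b p k * b q k) \<le> c w p q * (\<Sum>k\<in>A. a p k * a q k)"
    proof (cases "fst p = fst q")
      case True
      thus ?thesis using pq row[of "fst p" "snd p" "snd q"] by (auto simp: P_def)
    next
      case False
      thus ?thesis using pq f(4)[of p q w] cov[of "fst p" "fst q" "snd p" "snd q"]
        by (auto simp: P_def intro!: mult_left_mono)
    qed
  qed auto
  have one: "f w = 1" if "\<forall>i\<in>U. \<exists>j\<in>V. \<beta> \<le> w (i, j)" for w
  proof -
    have "(\<Prod>j\<in>V. 1 - \<sigma> (w (i, j))) = 0" if "i \<in> U" for i
      using \<open>\<forall>i\<in>U. _\<close> that \<sigma>(2) by (auto simp: prod_zero_iff)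
    hence "f w = (\<Prod>i\<in>U. 1)" unfolding f_def by (intro prod.cong) simp_all
    thus ?thesis by simp
  qed
  have zero: "f w = 0" if n: "\<not> (\<forall>i\<in>U. \<exists>j\<in>V. \<alpha> < w (i, j))" for w
  proof -
    obtain i where i: "i \<in> U" "\<And>j. j \<in> V \<Longrightarrow> w (i, j) \<le> \<alpha>" using n by (meson not_le)
    hence "(\<Prod>j\<in>V. 1 - \<sigma> (w (i, j))) = 1" using \<sigma>(1) by (intro prod.neutral) auto
    thus ?thesis using i by (auto simp: f_def intro!: prod_zero bexI[of _ i])
  qed
  have bounds: "\<P>(x in gauss_on S. \<forall>i\<in>U. \<exists>j\<in>V. \<beta> \<le> (\<Sum>k\<in>S. e (i, j) k * x k)) \<le> (\<integral>x. f x \<partial>gauss_image S e)"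
    "(\<integral>x. f x \<partial>gauss_image S e) \<le> \<P>(x in gauss_on S. \<forall>i\<in>U. \<exists>j\<in>V. \<alpha> < (\<Sum>k\<in>S. e (i, j) k * x k))"
    if "finite S" for S and e :: "'i \<times> 'j \<Rightarrow> 'k \<Rightarrow> real"
  proof -
    let ?N = "gauss_on S" and ?L = "\<lambda>x p. \<Sum>k\<in>S. e p k * x k"
    interpret N: prob_space ?N by (rule prob_space_gauss_on)
    have int: "(\<integral>x. f x \<partial>gauss_image S e) = (\<integral>x. f (?L x) \<partial>?N)"
      unfolding gauss_image_def by (subst integral_distr) auto
    have i: "integrable ?N (\<lambda>x. f (?L x))"
      by (rule N.integrable_const_bound[of _ 1]) (use f in auto)
    let ?B = "{x \<in> space ?N. \<forall>i\<in>U. \<exists>j\<in>V. \<beta> \<le> ?L x (i, j)}"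
    have [measurable]: "?B \<in> sets ?N" by measurable
    have "measure ?N ?B = (\<integral>x. indicator ?B x \<partial>?N)" by simp
    also have "\<dots> \<le> (\<integral>x. f (?L x) \<partial>?N)"
    proof (rule integral_mono[OF _ i])
      show "integrable ?N (indicator ?B :: _ \<Rightarrow> real)" by (rule N.integrable_const_bound[of _ 1]) auto
      show "indicator ?B x \<le> f (?L x)" for x using one[of "?L x"] f(1)[of "?L x"] by (auto split: split_indicator)
    qed
    finally show "measure ?N ?B \<le> (\<integral>x. f x \<partial>gauss_image S e)" unfolding int .
    let ?A = "{x \<in> space ?N. \<forall>i\<in>U. \<exists>j\<in>V. \<alpha> < ?L x (i, j)}"
    have [measurable]: "?A \<in> sets ?N" by measurable
    have "(\<integral>x. f (?L x) \<partial>?N) \<le> (\<integral>x. indicator ?A x \<partial>?N)"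
    proof (rule integral_mono[OF i])
      show "integrable ?N (indicator ?A :: _ \<Rightarrow> real)" by (rule N.integrable_const_bound[of _ 1]) auto
      show "f (?L x) \<le> indicator ?A x" if "x \<in> space ?N" for x
        using zero[of "?L x"] f(2)[of "?L x"] that by (auto split: split_indicator)
    qed
    also have "\<dots> = measure ?N ?A" by simp
    finally show "(\<integral>x. f x \<partial>gauss_image S e) \<le> measure ?N ?A" unfolding int .
  qed
  show ?thesis using bounds(1)[of A' b] le bounds(2)[of A a] by simp
qed

section \<open>Closed convex cones\<close>

definition ip :: "nat \<Rightarrow> (nat \<Rightarrow> real) \<Rightarrow> (nat \<Rightarrow> real) \<Rightarrow> real" where
  "ip n x y = (\<Sum>i<n. x i * y i)"

lemma enorm_eq_L2_set: "enorm n x = L2_set x {..<n}"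
  by (simp add: enorm_def L2_set_def)

lemma enorm_nonneg [simp]: "0 \<le> enorm n x"
  by (simp add: enorm_def sum_nonneg)

lemma enorm_square: "(enorm n x)\<^sup>2 = ip n x x"
  by (simp add: enorm_def ip_def sum_nonneg power2_eq_square[symmetric])

lemma ip_commute: "ip n x y = ip n y x"
  by (simp add: ip_def mult.commute)

lemma ip_linear:
  "ip n (\<lambda>i. x i + y i) z = ip n x z + ip n y z"
  "ip n (\<lambda>i. x i - y i) z = ip n x z - ip n y z"
  "ip n (\<lambda>i. c * x i) z = c * ip n x z"
  "ip n (\<lambda>i. - x i) z = - ip n x z"
  "ip n z (\<lambda>i. x i + y i) = ip n z x + ip n z y"
  "ip n z (\<lambda>i. x i - y i) = ip n z x - ip n z y"
  "ip n z (\<lambda>i. c * x i) = c * ip n z x"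
  "ip n z (\<lambda>i. - x i) = - ip n z x"
  by (simp_all add: ip_def sum.distrib sum_subtractf sum_distrib_left sum_negf algebra_simps)

lemma ip_vdiff: "ip n (vdiff x y) z = ip n x z - ip n y z" "ip n z (vdiff x y) = ip n z x - ip n z y"
  by (simp_all add: vdiff_def ip_linear)

lemma ip_le_enorm_mult: "ip n x y \<le> enorm n x * enorm n y"
proof -
  have "ip n x y \<le> (\<Sum>i<n. \<bar>x i\<bar> * \<bar>y i\<bar>)"
    unfolding ip_def by (intro sum_mono) (simp add: abs_mult[symmetric])
  also have "\<dots> \<le> enorm n x * enorm n y" unfolding enorm_eq_L2_set by (rule L2_set_mult_ineq)
  finally show ?thesis .
qed

lemma abs_ip_le_enorm_mult: "\<bar>ip n x y\<bar> \<le> enorm n x * enorm n y"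
  using ip_le_enorm_mult[of n x y] ip_le_enorm_mult[of n "\<lambda>i. - x i" y]
  by (simp add: ip_linear enorm_def abs_le_iff)

lemma enorm_scale: "enorm n (\<lambda>i. c * x i) = \<bar>c\<bar> * enorm n x"
  by (simp add: enorm_def power_mult_distrib sum_distrib_left[symmetric] real_sqrt_mult)

lemma enorm_add_le: "enorm n (\<lambda>i. x i + y i) \<le> enorm n x + enorm n y"
  unfolding enorm_eq_L2_set by (rule L2_set_triangle_ineq)

lemma enorm_vdiff_commute: "enorm n (vdiff x y) = enorm n (vdiff y x)"
  by (simp add: enorm_def vdiff_def power2_commute)

lemma enorm_vdiff_triangle: "enorm n (vdiff x z) \<le> enorm n (vdiff x y) + enorm n (vdiff y z)"
  using enorm_add_le[of n "vdiff x y" "vdiff y z"] by (simp add: vdiff_def)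

lemma enorm_le_add_vdiff: "enorm n x \<le> enorm n y + enorm n (vdiff x y)"
  using enorm_add_le[of n y "vdiff x y"] by (simp add: vdiff_def)

lemma enorm_zero [simp]: "enorm n (\<lambda>_. 0) = 0"
  by (simp add: enorm_def)

lemma enorm_eq_0_iff:
  assumes "x \<in> Rn n"
  shows "enorm n x = 0 \<longleftrightarrow> x = (\<lambda>_. 0)"
proof
  assume "enorm n x = 0"
  hence "x i = 0" if "i < n" for i using that by (simp add: enorm_eq_L2_set L2_set_eq_0_iff)
  thus "x = (\<lambda>_. 0)" using assms by (auto simp: Rn_def fun_eq_iff) (meson not_le)
qed simp

lemma abs_le_enorm: "i < n \<Longrightarrow> \<bar>x i\<bar> \<le> enorm n x"
  using member_le_L2_set[of "{..<n}" i "\<lambda>i. \<bar>x i\<bar>"] by (simp add: enorm_eq_L2_set L2_set_def)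

lemma continuous_on_enorm [continuous_intros]: "(\<And>i. continuous_on S (\<lambda>x. f x i)) \<Longrightarrow> continuous_on S (\<lambda>x. enorm n (f x))"
  unfolding enorm_def by (intro continuous_intros)

lemma continuous_on_ip [continuous_intros]:
  "(\<And>i. continuous_on S (\<lambda>x. f x i)) \<Longrightarrow> (\<And>i. continuous_on S (\<lambda>x. g x i)) \<Longrightarrow> continuous_on S (\<lambda>x. ip n (f x) (g x))"
  unfolding ip_def by (intro continuous_intros)

lemma continuous_on_coord [continuous_intros]: "continuous_on S (\<lambda>x::'a \<Rightarrow> real. x i)"
  by (rule continuous_on_subset[OF continuous_on_product_coordinates]) simp

lemma continuous_on_vdiff_left: "continuous_on S (\<lambda>x. vdiff x a i)" "continuous_on S (\<lambda>x. vdiff a x i)"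
  unfolding vdiff_def by (intro continuous_intros)+

text \<open>The function space carries the product topology, so compactness comes from Tychonoff's
  theorem: the coordinates below \<open>n\<close> range over a bounded interval and all others over
  {0}.\<close>

lemma compact_Rn_ball: "compact {x \<in> Rn n. enorm n x \<le> R}"
proof -
  let ?B = "\<lambda>i. if i < n then {-\<bar>R\<bar>..\<bar>R\<bar>} else {0::real}"
  have "compactin (product_topology (\<lambda>_. euclidean) UNIV) (PiE UNIV ?B)"
    by (subst compactin_PiE) auto
  hence "compact (PiE UNIV ?B)" by (simp add: euclidean_product_topology)
  moreover have "closed {x. enorm n x \<le> R}"
    by (intro closed_Collect_le continuous_intros)
  moreover have "{x \<in> Rn n. enorm n x \<le> R} = PiE UNIV ?B \<inter> {x. enorm n x \<le> R}"
  proof (intro set_eqI iffI)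
    fix x assume x: "x \<in> {x \<in> Rn n. enorm n x \<le> R}"
    have "x i \<in> ?B i" for i
      using x abs_le_enorm[of i n x] by (cases "i < n") (auto simp: Rn_def)
    thus "x \<in> PiE UNIV ?B \<inter> {x. enorm n x \<le> R}" using x by auto
  next
    fix x assume x: "x \<in> PiE UNIV ?B \<inter> {x. enorm n x \<le> R}"
    have "x i = 0" if "n \<le> i" for i using x that PiE_mem[of x UNIV ?B i] by auto
    thus "x \<in> {x \<in> Rn n. enorm n x \<le> R}" using x by (auto simp: Rn_def)
  qed
  ultimately show ?thesis by (simp add: compact_Int_closed)
qed

lemma compact_closed_subset_Rn_ball:
  assumes "closed S" "S \<subseteq> Rn n" "\<And>x. x \<in> S \<Longrightarrow> enorm n x \<le> R"
  shows "compact S"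
proof -
  have "S = {x \<in> Rn n. enorm n x \<le> R} \<inter> S" using assms by auto
  thus ?thesis using compact_Int_closed[OF compact_Rn_ball[of n R] assms(1)] by simp
qed

lemma closed_Rn: "closed (Rn n)"
proof -
  have "closed {x::nat \<Rightarrow> real. x i = 0}" for i
    by (intro closed_Collect_eq continuous_intros)
  moreover have "Rn n = (\<Inter>i\<in>{n..}. {x. x i = 0})" by (auto simp: Rn_def)
  ultimately show ?thesis by (simp add: closed_INT)
qed

lemma finite_net:
  assumes "compact S" "0 < \<delta>"
  shows "\<exists>U. finite U \<and> U \<subseteq> S \<and> (\<forall>x\<in>S. \<exists>u\<in>U. enorm n (vdiff x u) < \<delta>)"
proof -
  let ?B = "\<lambda>u. {x. enorm n (vdiff x u) < \<delta>}"
  have "open (?B u)" for u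
    by (intro open_Collect_less continuous_intros continuous_on_vdiff_left)
  moreover have "S \<subseteq> (\<Union>u\<in>S. ?B u)" using assms(2) by (auto simp: vdiff_def)
  ultimately obtain U where "U \<subseteq> S" "finite U" "S \<subseteq> (\<Union>u\<in>U. ?B u)"
    using compactE_image[OF assms(1), of S ?B] by blast
  thus ?thesis by (intro exI[of _ U]) auto
qed

section \<open>The metric projection onto a closed convex cone\<close>

locale cone =
  fixes n :: nat and K :: "(nat \<Rightarrow> real) set"
  assumes cone: "closed_convex_cone n K"
begin

lemma Rn: "x \<in> K \<Longrightarrow> x \<in> Rn n"
  using cone by (auto simp: closed_convex_cone_def)

lemma zero: "(\<lambda>_. 0) \<in> K"
  using cone by (auto simp: closed_convex_cone_def)

lemma scale: "x \<in> K \<Longrightarrow> 0 \<le> c \<Longrightarrow> (\<lambda>i. c * x i) \<in> K"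
  using cone by (auto simp: closed_convex_cone_def)

lemma add:
  assumes "x \<in> K" "y \<in> K"
  shows "(\<lambda>i. x i + y i) \<in> K"
proof -
  have "\<forall>u. 0 \<le> u \<and> u \<le> 1 \<longrightarrow> (\<lambda>i. u * x i + (1 - u) * y i) \<in> K"
    using cone assms by (simp add: closed_convex_cone_def)
  from this[rule_format, of "1/2"] have "(\<lambda>i. (1/2) * x i + (1 - 1/2) * y i) \<in> K" by simp
  from scale[OF this, of 2] show ?thesis by (simp add: algebra_simps)
qed

text \<open>\<open>closed_convex_cone\<close> states closedness through the norm; this transfers it
  to the product topology, in which the compactness arguments run.\<close>

lemma closed: "closed K"
  unfolding closed_sequential_limits
proof (intro allI impI)
  fix x l assume "(\<forall>k. x k \<in> K) \<and> x \<longlonglongrightarrow> l"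
  hence x: "\<And>k. x k \<in> K" "x \<longlonglongrightarrow> l" by auto
  have "l \<in> Rn n" using closed_Rn x Rn unfolding closed_sequential_limits by blast
  have "isCont (\<lambda>z. enorm n (vdiff z l)) l"
    by (rule continuous_on_interior[of UNIV]) (auto intro!: continuous_intros continuous_on_vdiff_left)
  from isCont_tendsto_compose[OF this x(2)]
  have "(\<lambda>k. enorm n (vdiff (x k) l)) \<longlonglongrightarrow> 0" by (simp add: vdiff_def)
  hence "\<exists>z\<in>K. enorm n (vdiff z l) < e" if "0 < e" for e
    using order_tendstoD(2)[OF _ that] x(1) by (force simp: eventually_sequentially)
  thus "l \<in> K" using cone \<open>l \<in> Rn n\<close> by (auto simp: closed_convex_cone_def)
qed

text \<open>The choice in the definition of \<open>proj\<close> is not void: a minimizer exists on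
  the compact part of norm at most twice that of \<open>y\<close>, and a point beyond it is farther
  from \<open>y\<close> than the origin is.\<close>

lemma proj: "proj n K y \<in> K" "\<nu> \<in> K \<Longrightarrow> enorm n (vdiff y (proj n K y)) \<le> enorm n (vdiff y \<nu>)"
proof -
  let ?S = "{x \<in> K. enorm n x \<le> 2 * enorm n y}"
  have "closed ?S"
    using closed_Int[OF closed closed_Collect_le[OF continuous_on_enorm[of UNIV "\<lambda>x. x" n] continuous_on_const[of UNIV "2 * enorm n y"]]]
    by (simp add: Int_def continuous_on_coord)
  hence "compact ?S" by (rule compact_closed_subset_Rn_ball) (use Rn in auto)
  moreover have "(\<lambda>_. 0) \<in> ?S" using zero by simp
  moreover have "continuous_on ?S (\<lambda>x. enorm n (vdiff y x))"
    by (intro continuous_intros continuous_on_vdiff_left)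
  ultimately obtain \<mu> where \<mu>: "\<mu> \<in> ?S" "\<And>x. x \<in> ?S \<Longrightarrow> enorm n (vdiff y \<mu>) \<le> enorm n (vdiff y x)"
    using continuous_attains_inf[of ?S "\<lambda>x. enorm n (vdiff y x)"] by blast
  have "enorm n (vdiff y \<mu>) \<le> enorm n (vdiff y x)" if "x \<in> K" for x
  proof (cases "x \<in> ?S")
    case False
    hence "2 * enorm n y < enorm n x" using that by simp
    moreover have "enorm n x \<le> enorm n y + enorm n (vdiff y x)"
      using enorm_le_add_vdiff[of n x y] by (simp add: enorm_vdiff_commute)
    moreover have "enorm n (vdiff y \<mu>) \<le> enorm n y"
      using \<mu>(2)[OF \<open>(\<lambda>_. 0) \<in> ?S\<close>] by (simp add: vdiff_def)
    ultimately show ?thesis by simp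
  qed (use \<mu> in blast)
  hence "\<mu> \<in> K \<and> (\<forall>\<nu>\<in>K. enorm n (vdiff y \<mu>) \<le> enorm n (vdiff y \<nu>))" using \<mu> by blast
  from someI[of "\<lambda>\<mu>. \<mu> \<in> K \<and> (\<forall>\<nu>\<in>K. enorm n (vdiff y \<mu>) \<le> enorm n (vdiff y \<nu>))", OF this]
  show "proj n K y \<in> K" "\<nu> \<in> K \<Longrightarrow> enorm n (vdiff y (proj n K y)) \<le> enorm n (vdiff y \<nu>)"
    unfolding proj_def by blast+
qed

end

lemma nonpos_of_first_order:
  fixes a b :: real
  assumes "\<And>s. 0 < s \<Longrightarrow> s \<le> 1 \<Longrightarrow> s * a \<le> s\<^sup>2 * b"
  shows "a \<le> 0"
proof (rule ccontr)
  assume "\<not> a \<le> 0"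
  define s where "s = min 1 (a / (2 * (\<bar>b\<bar> + 1)))"
  have s: "0 < s" "s \<le> 1" "s \<le> a / (2 * (\<bar>b\<bar> + 1))"
    using \<open>\<not> a \<le> 0\<close> by (auto simp: s_def)
  hence sb: "s * (2 * (\<bar>b\<bar> + 1)) \<le> a" by (subst (asm) pos_le_divide_eq) auto
  have "s * a \<le> s * (s * b)" using assms[OF s(1,2)] by (simp add: power2_eq_square mult.assoc)
  hence "a \<le> s * b" using s(1) by simp
  also have "\<dots> \<le> s * (\<bar>b\<bar> + 1)" using s by (intro mult_left_mono) auto
  finally show False using sb \<open>\<not> a \<le> 0\<close> by (simp add: algebra_simps)
qed

text \<open>The derivative at s = 0 of the squared norm of v + s d is twice the inner product. This
  optimality condition serves both the projection onto a cone and the minimizer in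
  \<open>cone_meets_of_dual_bound\<close>.\<close>

lemma ip_nonneg_of_enorm_minimal:
  assumes "\<And>s. 0 < s \<Longrightarrow> s \<le> 1 \<Longrightarrow> enorm n v \<le> enorm n (\<lambda>i. v i + s * d i)"
  shows "0 \<le> ip n v d"
proof -
  have "- (2 * ip n v d) \<le> 0"
  proof (rule nonpos_of_first_order)
    fix s :: real assume s: "0 < s" "s \<le> 1"
    have "(enorm n v)\<^sup>2 \<le> (enorm n (\<lambda>i. v i + s * d i))\<^sup>2"
      using assms[OF s] by (intro power_mono) auto
    also have "\<dots> = (enorm n v)\<^sup>2 + 2 * s * ip n v d + s\<^sup>2 * ip n d d"
      unfolding enorm_square by (simp add: ip_linear ip_commute[of n d v] power2_eq_square algebra_simps)
    finally show "s * - (2 * ip n v d) \<le> s\<^sup>2 * ip n d d" by simp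
  qed
  thus ?thesis by simp
qed

section \<open>Moreau's decomposition and its dual descriptions\<close>

context cone
begin

text \<open>The residual lies in the polar cone, because moving from the projection in a direction
  of \<open>K\<close> stays in \<open>K\<close> and cannot decrease the distance.\<close>

lemma ip_residual_le:
  assumes "x \<in> K"
  shows "ip n (vdiff y (proj n K y)) x \<le> 0"
proof -
  have "0 \<le> ip n (vdiff y (proj n K y)) (\<lambda>i. - x i)"
  proof (rule ip_nonneg_of_enorm_minimal)
    fix s :: real assume s: "0 < s" "s \<le> 1"
    have "(\<lambda>i. proj n K y i + s * x i) \<in> K" using s by (intro add proj scale assms) auto
    from proj(2)[OF this, of y]
    show "enorm n (vdiff y (proj n K y)) \<le> enorm n (\<lambda>i. vdiff y (proj n K y) i + s * - x i)"
      by (simp add: vdiff_def algebra_simps)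
  qed
  thus ?thesis by (simp add: ip_linear)
qed

lemma ip_residual_proj: "ip n (vdiff y (proj n K y)) (proj n K y) = 0"
proof (rule antisym[OF ip_residual_le[OF proj(1)]], rule ip_nonneg_of_enorm_minimal)
  fix s :: real assume s: "0 < s" "s \<le> 1"
  have "(\<lambda>i. (1 - s) * proj n K y i) \<in> K" using s by (intro proj scale) auto
  from proj(2)[OF this, of y]
  show "enorm n (vdiff y (proj n K y)) \<le> enorm n (\<lambda>i. vdiff y (proj n K y) i + s * proj n K y i)"
    by (simp add: vdiff_def algebra_simps)
qed

text \<open>When positive, \<open>pnorm\<close> is the maximum of the inner product with
  \<open>y\<close> over the unit sphere of \<open>K\<close>, and \<open>rnorm\<close>, the distance
  to \<open>K\<close>, is the one over the unit sphere of the polar cone (for \<open>y\<close> in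
  \<open>Rn n\<close>). In this form they enter the min-max bound.\<close>

definition pnorm :: "(nat \<Rightarrow> real) \<Rightarrow> real" where "pnorm y = enorm n (proj n K y)"
definition rnorm :: "(nat \<Rightarrow> real) \<Rightarrow> real" where "rnorm y = enorm n (vdiff y (proj n K y))"

lemma pnorm_nonneg [simp]: "0 \<le> pnorm y" and rnorm_nonneg [simp]: "0 \<le> rnorm y"
  by (simp_all add: pnorm_def rnorm_def)

lemma moreau: "(enorm n y)\<^sup>2 = (pnorm y)\<^sup>2 + (rnorm y)\<^sup>2"
proof -
  have "ip n y (proj n K y) = ip n (proj n K y) (proj n K y)"
    using ip_residual_proj[of y] by (simp add: ip_vdiff)
  thus ?thesis
    by (simp add: pnorm_def rnorm_def enorm_square ip_vdiff ip_commute[of n "proj n K y" y])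
qed

lemma ip_le_pnorm:
  assumes "x \<in> K"
  shows "ip n x y \<le> enorm n x * pnorm y"
proof -
  have "ip n x y \<le> ip n x (proj n K y)"
    using ip_residual_le[OF assms, of y] by (simp add: ip_vdiff ip_commute[of n x y] ip_commute[of n x "proj n K y"])
  also have "\<dots> \<le> enorm n x * pnorm y" unfolding pnorm_def by (rule ip_le_enorm_mult)
  finally show ?thesis .
qed

lemma ip_le_rnorm:
  assumes "\<And>x. x \<in> K \<Longrightarrow> ip n v x \<le> 0"
  shows "ip n v y \<le> enorm n v * rnorm y"
proof -
  have "ip n v y \<le> ip n v (vdiff y (proj n K y))"
    using assms[OF proj(1), of y] by (simp add: ip_vdiff)
  also have "\<dots> \<le> enorm n v * rnorm y" unfolding rnorm_def by (rule ip_le_enorm_mult)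
  finally show ?thesis .
qed

lemma pnorm_attained:
  assumes "0 < pnorm y"
  shows "\<exists>\<mu>\<in>K. enorm n \<mu> = 1 \<and> ip n \<mu> y = pnorm y"
proof (intro bexI conjI)
  let ?\<mu> = "\<lambda>i. (1 / pnorm y) * proj n K y i"
  show "?\<mu> \<in> K" using assms by (intro scale proj) simp
  show "enorm n ?\<mu> = 1" unfolding enorm_scale using assms by (simp add: pnorm_def)
  have "ip n (proj n K y) y = (pnorm y)\<^sup>2"
    using ip_residual_proj[of y] by (simp add: ip_vdiff pnorm_def enorm_square ip_commute[of n y "proj n K y"])
  thus "ip n ?\<mu> y = pnorm y" unfolding ip_linear using assms by (simp add: power2_eq_square)
qed

lemma rnorm_attained:
  assumes "0 < rnorm y" "y \<in> Rn n"
  shows "\<exists>v\<in>Rn n. (\<forall>x\<in>K. ip n v x \<le> 0) \<and> enorm n v = 1 \<and> ip n v y = rnorm y"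
proof (intro bexI conjI ballI)
  let ?v = "\<lambda>i. (1 / rnorm y) * vdiff y (proj n K y) i"
  show "?v \<in> Rn n" using assms Rn[OF proj(1), of y] by (auto simp: Rn_def vdiff_def)
  show "ip n ?v x \<le> 0" if "x \<in> K" for x
    unfolding ip_linear using assms ip_residual_le[OF that, of y] by (simp add: divide_le_0_iff)
  show "enorm n ?v = 1" unfolding enorm_scale using assms by (simp add: rnorm_def)
  have "ip n (vdiff y (proj n K y)) y = (rnorm y)\<^sup>2"
    using ip_residual_proj[of y] by (simp add: ip_vdiff rnorm_def enorm_square ip_commute[of n y "proj n K y"])
  thus "ip n ?v y = rnorm y" unfolding ip_linear using assms by (simp add: power2_eq_square)
qed

lemma pnorm_lipschitz: "\<bar>pnorm x - pnorm y\<bar> \<le> enorm n (vdiff x y)"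
proof -
  have *: "pnorm x - pnorm y \<le> enorm n (vdiff x y)" for x y
  proof (cases "0 < pnorm x")
    case True
    then obtain \<mu> where \<mu>: "\<mu> \<in> K" "enorm n \<mu> = 1" "ip n \<mu> x = pnorm x" using pnorm_attained by blast
    have "ip n \<mu> (vdiff x y) \<le> enorm n (vdiff x y)" using ip_le_enorm_mult[of n \<mu>] \<mu> by simp
    moreover have "ip n \<mu> y \<le> pnorm y" using ip_le_pnorm[OF \<mu>(1), of y] \<mu> by simp
    ultimately show ?thesis using \<mu> by (simp add: ip_vdiff)
  next
    case False
    thus ?thesis using pnorm_nonneg[of y] enorm_nonneg[of n "vdiff x y"] by linarith
  qed
  show ?thesis using *[of x y] *[of y x] by (simp add: abs_le_iff enorm_vdiff_commute[of n y])
qed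

lemma rnorm_lipschitz: "\<bar>rnorm x - rnorm y\<bar> \<le> enorm n (vdiff x y)"
proof -
  have *: "rnorm x \<le> rnorm y + enorm n (vdiff x y)" for x y
  proof -
    have "rnorm x \<le> enorm n (vdiff x (proj n K y))" unfolding rnorm_def by (intro proj)
    also have "\<dots> \<le> enorm n (vdiff x y) + rnorm y" unfolding rnorm_def by (rule enorm_vdiff_triangle)
    finally show ?thesis by simp
  qed
  show ?thesis using *[of x y] *[of y x] by (simp add: abs_le_iff enorm_vdiff_commute[of n y])
qed

end

section \<open>The bilinear min-max bound\<close>

text \<open>The second moment is the squared mean plus a variance between 0 and 4, and m^2 + 4 <= (m
  + 2)^2 for m >= 0. This trades the statistical dimension for the mean around which concentration
  takes place.\<close>

lemma (in gauss_lipschitz) expectation_le_sqrt: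
  shows "expectation F \<le> sqrt (expectation (\<lambda>x. (F x)\<^sup>2))"
    and "0 \<le> expectation F \<Longrightarrow> sqrt (expectation (\<lambda>x. (F x)\<^sup>2)) \<le> expectation F + 2"
proof -
  let ?m = "expectation F"
  have "0 \<le> expectation (\<lambda>x. (F x - ?m)\<^sup>2)" by simp
  also have "(\<lambda>x. (F x - ?m)\<^sup>2) = (\<lambda>x. (F x)\<^sup>2 - 2 * ?m * F x + ?m\<^sup>2)"
    by (simp add: power2_eq_square algebra_simps)
  also have "expectation \<dots> = expectation (\<lambda>x. (F x)\<^sup>2) - ?m\<^sup>2"
    using integrable second_moment(1) by (simp add: prob_space power2_eq_square)
  finally show "?m \<le> sqrt (expectation (\<lambda>x. (F x)\<^sup>2))" by (intro real_le_rsqrt) simp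
  assume "0 \<le> ?m"
  have "expectation (\<lambda>x. (F x)\<^sup>2) \<le> (?m + 2)\<^sup>2"
    using second_moment(2) \<open>0 \<le> ?m\<close> by (simp add: power2_eq_square algebra_simps)
  thus "sqrt (expectation (\<lambda>x. (F x)\<^sup>2)) \<le> ?m + 2" using \<open>0 \<le> ?m\<close> by (intro real_le_lsqrt) auto
qed

lemma measurable_gauss_vec_continuous:
  assumes "continuous_on UNIV f"
  shows "(\<lambda>g. f (ext0 n g) :: real) \<in> borel_measurable (gauss_on {..<n})"
proof -
  have "ext0 n \<in> gauss_on {..<n} \<rightarrow>\<^sub>M real_product"
    unfolding ext0_def
  proof (intro measurable_abs_UNIV)
    fix i show "(\<lambda>g. if i < n then g i else 0) \<in> borel_measurable (gauss_on {..<n})"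
      by (cases "i < n") auto
  qed
  moreover have "f \<in> borel_measurable real_product"
    using borel_measurable_continuous_onI[OF assms] by (simp add: measurable_cong_sets[OF sets_PiM_equal_borel refl])
  ultimately show ?thesis by (rule measurable_compose)
qed

lemma continuous_on_of_lipschitz_enorm:
  assumes "\<And>x y. \<bar>f x - f y\<bar> \<le> enorm n (vdiff x y)"
  shows "continuous_on UNIV f"
proof -
  have "(f \<longlongrightarrow> f a) (at a)" for a
  proof (rule LIM_zero_cancel, rule Lim_null_comparison)
    show "\<forall>\<^sub>F x in at a. norm (f x - f a) \<le> enorm n (vdiff x a)" using assms by simp
    have "isCont (\<lambda>x. enorm n (vdiff x a)) a"
      by (rule continuous_on_interior[of UNIV]) (auto intro!: continuous_intros continuous_on_vdiff_left)
    thus "((\<lambda>x. enorm n (vdiff x a)) \<longlongrightarrow> 0) (at a)" by (simp add: isCont_def vdiff_def)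
  qed
  thus ?thesis by (simp add: continuous_on_def)
qed

lemma gauss_lipschitz_ext0:
  assumes "\<And>x y. \<bar>f x - f y\<bar> \<le> enorm n (vdiff x y)"
  shows "gauss_lipschitz {..<n} (\<lambda>g. f (ext0 n g))"
proof
  show "(\<lambda>g. f (ext0 n g)) \<in> borel_measurable (gauss_on {..<n})"
    by (rule measurable_gauss_vec_continuous[OF continuous_on_of_lipschitz_enorm[OF assms]])
  fix x y
  have "enorm n (vdiff (ext0 n x) (ext0 n y)) = sqrt (\<Sum>k<n. (x k - y k)\<^sup>2)"
    by (auto simp: enorm_def vdiff_def ext0_def intro!: sum.cong)
  thus "\<bar>f (ext0 n x) - f (ext0 n y)\<bar> \<le> sqrt (\<Sum>k<n. (x k - y k)\<^sup>2)" using assms[of "ext0 n x" "ext0 n y"] by simp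
qed simp

lemma expectation_enorm_square:
  "integrable (gauss_vec n) (\<lambda>g. (enorm n (ext0 n g))\<^sup>2)" "(\<integral>g. (enorm n (ext0 n g))\<^sup>2 \<partial>gauss_vec n) = real n"
proof -
  have eq: "(enorm n (ext0 n g))\<^sup>2 = (\<Sum>i<n. g i * g i)" for g
    by (simp add: enorm_square ip_def ext0_def)
  show "integrable (gauss_vec n) (\<lambda>g. (enorm n (ext0 n g))\<^sup>2)" "(\<integral>g. (enorm n (ext0 n g))\<^sup>2 \<partial>gauss_vec n) = real n"
    unfolding eq gauss_vec_def using integral_PiM_mult_components[of "{..<n}"]
    by (auto simp: Bochner_Integration.integral_sum intro!: Bochner_Integration.integrable_sum)
qed

context cone
begin

lemma gauss_lipschitz_pnorm: "gauss_lipschitz {..<n} (\<lambda>g. pnorm (ext0 n g))"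
  by (rule gauss_lipschitz_ext0) (rule pnorm_lipschitz)

lemma gauss_lipschitz_rnorm: "gauss_lipschitz {..<n} (\<lambda>g. rnorm (ext0 n g))"
  by (rule gauss_lipschitz_ext0) (rule rnorm_lipschitz)

lemma stat_dim_eq: "stat_dim n K = (\<integral>g. (pnorm (ext0 n g))\<^sup>2 \<partial>gauss_vec n)"
  by (simp add: stat_dim_def pnorm_def)

text \<open>Integrated Pythagoras. The codimension is thus the mean squared distance to the cone,
  which is the statistical dimension of the polar cone.\<close>

lemma codim_eq: "real n - stat_dim n K = (\<integral>g. (rnorm (ext0 n g))\<^sup>2 \<partial>gauss_vec n)"
proof -
  interpret p: gauss_lipschitz "{..<n}" "\<lambda>g. pnorm (ext0 n g)" by (rule gauss_lipschitz_pnorm)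
  have "(\<integral>g. (rnorm (ext0 n g))\<^sup>2 \<partial>gauss_vec n)
      = (\<integral>g. (enorm n (ext0 n g))\<^sup>2 - (pnorm (ext0 n g))\<^sup>2 \<partial>gauss_vec n)"
    by (intro Bochner_Integration.integral_cong refl) (simp add: moreau)
  also have "\<dots> = real n - stat_dim n K"
    using expectation_enorm_square[of n] p.second_moment(1) unfolding gauss_vec_def[symmetric]
    by (simp add: stat_dim_eq)
  finally show ?thesis by simp
qed

end

section \<open>Gordon's inequality for bilinear forms\<close>

lemma measure_std_normal_atMost_0: "1 / 2 \<le> measure std_normal {..0}"
proof -
  have "emeasure std_normal {0..} = (\<integral>\<^sup>+x. ennreal (std_normal_density x) * indicator {0..} x \<partial>lborel)"
    by (simp add: std_normal_def emeasure_density)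
  also have "\<dots> = (\<integral>\<^sup>+x. ennreal (std_normal_density x) * indicator {..0} x \<partial>lborel)"
    by (subst nn_integral_real_affine[where c="-1" and t=0])
       (auto intro!: nn_integral_cong simp: std_normal_density_def split: split_indicator)
  also have "\<dots> = emeasure std_normal {..0}"
    by (simp add: std_normal_def emeasure_density)
  finally have "measure std_normal {0..} = measure std_normal {..0}" by (simp add: measure_def)
  moreover have "measure std_normal UNIV \<le> measure std_normal {0..} + measure std_normal {..0}"
  proof -
    have "UNIV = {0..} \<union> {..0::real}" by auto
    thus ?thesis using measure_Un_le[of "{0..}" std_normal "{..0}"] by simp
  qed
  moreover have "measure std_normal UNIV = 1" using std_normal.prob_space by simp
  ultimately show ?thesis by linarith
qed

definition fnorm :: "nat \<Rightarrow> nat \<Rightarrow> (nat \<times> nat \<Rightarrow> real) \<Rightarrow> real" where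
  "fnorm m n G = sqrt (\<Sum>i<m. \<Sum>j<n. (G (i, j))\<^sup>2)"

lemma enorm_matvec_le: "enorm m (matvec m n G x) \<le> fnorm m n G * enorm n x"
proof -
  have "(\<Sum>i<m. (matvec m n G x i)\<^sup>2) \<le> (\<Sum>i<m. (\<Sum>j<n. (G (i, j))\<^sup>2) * (\<Sum>j<n. (x j)\<^sup>2))"
  proof (rule sum_mono)
    fix i assume "i \<in> {..<m}"
    hence "(matvec m n G x i)\<^sup>2 = (ip n (\<lambda>j. G (i, j)) x)\<^sup>2" by (simp add: matvec_def ip_def)
    also have "\<dots> \<le> (enorm n (\<lambda>j. G (i, j)) * enorm n x)\<^sup>2"
      by (rule power2_le_iff_abs_le[THEN iffD2]) (auto intro: abs_ip_le_enorm_mult)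
    also have "\<dots> = (\<Sum>j<n. (G (i, j))\<^sup>2) * (\<Sum>j<n. (x j)\<^sup>2)"
      by (simp add: power_mult_distrib enorm_def sum_nonneg)
    finally show "(matvec m n G x i)\<^sup>2 \<le> (\<Sum>j<n. (G (i, j))\<^sup>2) * (\<Sum>j<n. (x j)\<^sup>2)" .
  qed
  thus ?thesis
    unfolding enorm_def fnorm_def real_sqrt_mult[symmetric] sum_distrib_right[symmetric] by simp
qed

lemma matvec_vdiff: "matvec m n G (vdiff x y) = vdiff (matvec m n G x) (matvec m n G y)"
  by (auto simp: matvec_def vdiff_def sum_subtractf algebra_simps)

text \<open>Markov's inequality for the squared norm. The parameter \<open>\<delta>\<close> will be
  the mesh of a net, so a bound that vanishes with \<open>\<delta>\<close> is all that is
  asked.\<close>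

lemma measure_sum_squares_ge:
  assumes "finite A" "0 < \<delta>"
  shows "\<P>(x in gauss_on A. 1 < \<delta> * sqrt (\<Sum>k\<in>A. (x k)\<^sup>2))
      \<le> \<delta>\<^sup>2 * real (card A)"
proof -
  let ?N = "gauss_on A"
  interpret N: prob_space ?N by (rule prob_space_gauss_on)
  let ?B = "{x \<in> space ?N. 1 < \<delta> * sqrt (\<Sum>k\<in>A. (x k)\<^sup>2)}"
  have int: "integrable ?N (\<lambda>x. \<delta>\<^sup>2 * (\<Sum>k\<in>A. x k * x k))"
    using integral_PiM_mult_components(1)[OF assms(1)] by auto
  have [measurable]: "?B \<in> sets ?N" by measurable
  have "measure ?N ?B = (\<integral>x. indicator ?B x \<partial>?N)" by simp
  also have "\<dots> \<le> (\<integral>x. \<delta>\<^sup>2 * (\<Sum>k\<in>A. x k * x k) \<partial>?N)"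
  proof (rule integral_mono[OF _ int])
    show "integrable ?N (indicator ?B :: _ \<Rightarrow> real)" by (rule N.integrable_const_bound[of _ 1]) auto
    fix x
    have "1 \<le> (\<delta> * sqrt (\<Sum>k\<in>A. (x k)\<^sup>2))\<^sup>2" if "1 < \<delta> * sqrt (\<Sum>k\<in>A. (x k)\<^sup>2)"
      using that by (intro one_le_power) simp
    thus "indicator ?B x \<le> \<delta>\<^sup>2 * (\<Sum>k\<in>A. x k * x k)"
      unfolding power_mult_distrib by (auto simp: sum_nonneg power2_eq_square[of "x _"] split: split_indicator)
  qed
  also have "\<dots> = \<delta>\<^sup>2 * real (card A)"
    using integral_PiM_mult_components[OF assms(1)] by (simp add: Bochner_Integration.integral_sum)
  finally show ?thesis .
qed

text \<open>First component 0 marks the coordinates of \<open>g\<close>, first component 1 those of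
  \<open>h\<close>. The index type is that of matrix entries because
  \<open>gordon_comparison\<close> takes both processes over one type of indices.\<close>

abbreviation pair_index :: "nat \<Rightarrow> nat \<Rightarrow> (nat \<times> nat) set" where
  "pair_index n m \<equiv> {0} \<times> {..<n} \<union> {1} \<times> {..<m}"

text \<open>The auxiliary standard normal variable is the entry \<open>(m, 0)\<close>, which \<open>matvec m n\<close> ignores; it
  equalizes the variances in Gordon's comparison.\<close>

lemma gordon_bilinear:
  fixes \<kappa> :: real
  assumes fin: "finite U" "finite V"
    and U: "\<And>\<mu>. \<mu> \<in> U \<Longrightarrow> enorm n \<mu> = 1" and V: "\<And>v. v \<in> V \<Longrightarrow> enorm m v = 1" and \<kappa>: "\<kappa>\<^sup>2 = 1"
  shows "\<P>(G in gauss_mat m n. \<exists>\<mu>\<in>U. \<forall>v\<in>V. ip m v (matvec m n G \<mu>) \<le> 2)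
    \<le> 2 * measure (gauss_on (pair_index n m))
       {x \<in> space (gauss_on (pair_index n m)).
          \<exists>\<mu>\<in>U. \<forall>v\<in>V. ip m v (\<lambda>i. x (1, i)) - \<kappa> * ip n \<mu> (\<lambda>j. x (0, j)) < 3}"
proof -
  let ?y = "\<lambda>v \<mu> x. ip m v (\<lambda>i. x (1, i)) - \<kappa> * ip n \<mu> (\<lambda>j. x (0, j))"
  let ?I = "{..<m} \<times> {..<n}"
  let ?A = "insert (m, 0) ?I" and ?A' = "pair_index n m"
  let ?NI = "gauss_on ?I" and ?N = "gauss_on ?A" and ?N' = "gauss_on ?A'"
  interpret NI: prob_space ?NI by (rule prob_space_gauss_on)
  interpret N: prob_space ?N by (rule prob_space_gauss_on)
  interpret N': prob_space ?N' by (rule prob_space_gauss_on)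
  have [simp]: "(m, 0) \<notin> ?I" by simp
  define a :: "(nat \<Rightarrow> real) \<times> (nat \<Rightarrow> real) \<Rightarrow> nat \<times> nat \<Rightarrow> real" where "a = (\<lambda>p k. if k = (m, 0) then 1 else snd p (fst k) * fst p (snd k) :: real)"
  define b :: "(nat \<Rightarrow> real) \<times> (nat \<Rightarrow> real) \<Rightarrow> nat \<times> nat \<Rightarrow> real" where "b = (\<lambda>p k. if fst k = (0::nat) then - \<kappa> * fst p (snd k) else snd p (snd k) :: real)"
  have X: "(\<Sum>k\<in>?A. a (\<mu>, v) k * x k) = x (m, 0) + ip m v (matvec m n x \<mu>)" for \<mu> v and x :: "nat \<times> nat \<Rightarrow> real"
  proof -
    have "(\<Sum>k\<in>?I. a (\<mu>, v) k * x k) = (\<Sum>i<m. \<Sum>j<n. v i * \<mu> j * x (i, j))"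
      unfolding sum.cartesian_product by (intro sum.cong refl) (auto simp: a_def)
    also have "\<dots> = ip m v (matvec m n x \<mu>)"
      by (simp add: ip_def matvec_def sum_distrib_left mult_ac)
    finally show ?thesis by (subst sum.insert) (auto simp: a_def)
  qed
  have split: "(\<Sum>k\<in>?A'. h k) = (\<Sum>j<n. h (0, j)) + (\<Sum>i<m. h (1, i))" for h :: "nat \<times> nat \<Rightarrow> real"
  proof -
    have "(\<Sum>k\<in>?A'. h k) = (\<Sum>k\<in>{0} \<times> {..<n}. h k) + (\<Sum>k\<in>{1} \<times> {..<m}. h k)"
      by (intro sum.union_disjoint) auto
    moreover have "(\<Sum>k\<in>{c} \<times> B. h k) = (\<Sum>j\<in>B. h (c, j))" for c B
    proof -
      have "{c} \<times> B = Pair c ` B" by auto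
      thus ?thesis by (simp add: sum.reindex inj_on_def)
    qed
    ultimately show ?thesis by simp
  qed
  have Y: "(\<Sum>k\<in>?A'. b (\<mu>, v) k * x k) = ?y v \<mu> x" for \<mu> v and x :: "nat \<times> nat \<Rightarrow> real"
    unfolding split by (simp add: b_def ip_def sum_distrib_left sum_negf mult_ac)
  have covX: "(\<Sum>k\<in>?A. a (\<mu>, v) k * a (\<mu>', v') k) = 1 + ip m v v' * ip n \<mu> \<mu>'" for \<mu> v \<mu>' v'
  proof -
    have "(\<Sum>k\<in>?I. a (\<mu>, v) k * a (\<mu>', v') k) = (\<Sum>i<m. \<Sum>j<n. (v i * v' i) * (\<mu> j * \<mu>' j))"
      unfolding sum.cartesian_product by (intro sum.cong refl) (auto simp: a_def)
    also have "\<dots> = ip m v v' * ip n \<mu> \<mu>'" by (simp add: ip_def sum_product)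
    finally show ?thesis by (subst sum.insert) (auto simp: a_def)
  qed
  have covY: "(\<Sum>k\<in>?A'. b (\<mu>, v) k * b (\<mu>', v') k) = ip n \<mu> \<mu>' + ip m v v'" for \<mu> v \<mu>' v'
  proof -
    have "(\<Sum>j<n. - \<kappa> * \<mu> j * (- \<kappa> * \<mu>' j)) = \<kappa>\<^sup>2 * ip n \<mu> \<mu>'"
      by (simp add: ip_def sum_distrib_left power2_eq_square mult_ac)
    thus ?thesis unfolding split using \<kappa> by (simp add: b_def ip_def)
  qed
  have g: "\<P>(x in ?N'. \<forall>\<mu>\<in>U. \<exists>v\<in>V. 3 \<le> (\<Sum>k\<in>?A'. b (\<mu>, v) k * x k))
     \<le> \<P>(x in ?N. \<forall>\<mu>\<in>U. \<exists>v\<in>V. 2 < (\<Sum>k\<in>?A. a (\<mu>, v) k * x k))"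
  \<comment> \<open>With x, y the inner products of the two \<open>\<mu>\<close> and of the two
    \<open>v\<close>, the covariances are 1 + x y and x + y. They differ by (1 - x) (1 - y), which
    is nonnegative for unit vectors and zero when the two \<open>\<mu>\<close> coincide.\<close>
  proof (rule gordon_comparison)
    fix \<mu> \<mu>' v v' assume *: "\<mu> \<in> U" "\<mu>' \<in> U" "v \<in> V" "v' \<in> V"
    have "ip n \<mu> \<mu>' \<le> 1" "ip m v v' \<le> 1"
      using ip_le_enorm_mult[of n \<mu> \<mu>'] ip_le_enorm_mult[of m v v'] * U V by auto
    hence "0 \<le> (1 - ip n \<mu> \<mu>') * (1 - ip m v v')" by simp
    thus "(\<Sum>k\<in>?A'. b (\<mu>, v) k * b (\<mu>', v') k) \<le> (\<Sum>k\<in>?A. a (\<mu>, v) k * a (\<mu>', v') k)"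
      unfolding covX covY by (simp add: algebra_simps)
  next
    fix \<mu> v v' assume *: "\<mu> \<in> U" "v \<in> V" "v' \<in> V"
    have "ip n \<mu> \<mu> = 1" using U[OF *(1)] enorm_square[of n \<mu>] by simp
    thus "(\<Sum>k\<in>?A'. b (\<mu>, v) k * b (\<mu>, v') k) = (\<Sum>k\<in>?A. a (\<mu>, v) k * a (\<mu>, v') k)"
      unfolding covX covY by simp
  qed (use fin in auto)
  let ?EU = "{G \<in> space ?NI. \<exists>\<mu>\<in>U. \<forall>v\<in>V. ip m v (matvec m n G \<mu>) \<le> 2}"
  let ?EZ = "{x \<in> space ?N. (\<exists>\<mu>\<in>U. \<forall>v\<in>V. ip m v (matvec m n x \<mu>) \<le> 2) \<and> x (m, 0) \<le> 0}"
  have mv: "(\<lambda>G. ip m v (matvec m n G \<mu>)) \<in> borel_measurable (gauss_on S)" if "?I \<subseteq> S" for v \<mu> S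
  proof -
    have "(\<lambda>G. \<Sum>i<m. v i * (\<Sum>j<n. G (i, j) * \<mu> j)) \<in> borel_measurable (gauss_on S)"
      using that by (intro borel_measurable_sum borel_measurable_times borel_measurable_const) auto
    thus ?thesis by (simp add: ip_def matvec_def)
  qed
  have [measurable]: "(\<lambda>G. ip m v (matvec m n G \<mu>)) \<in> borel_measurable ?NI"
    "(\<lambda>G. ip m v (matvec m n G \<mu>)) \<in> borel_measurable ?N" for v \<mu> by (rule mv; blast)+
  have [measurable]: "?EU \<in> sets ?NI" using fin by measurable
  have [measurable]: "?EZ \<in> sets ?N" using fin by measurable
  have upd: "matvec m n (x((m, 0) := y)) \<mu> = matvec m n x \<mu>" for x y \<mu>
    by (auto simp: matvec_def fun_eq_iff intro!: sum.cong)
  \<comment> \<open>The auxiliary entry is independent of the others and nonpositive with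
    probability at least 1/2; when it is, adding it keeps the form below the threshold. Removing it
    costs the factor 2.\<close>
  have "emeasure ?N ?EZ = (\<integral>\<^sup>+x. indicator ?EZ x \<partial>?N)" by simp
  also have "\<dots> = (\<integral>\<^sup>+x. \<integral>\<^sup>+y. indicator ?EZ (x((m, 0) := y)) \<partial>std_normal \<partial>?NI)"
    by (rule gauss.product_nn_integral_insert) auto
  also have "\<dots> = (\<integral>\<^sup>+x. \<integral>\<^sup>+y. indicator ?EU x * indicator {..0} y \<partial>std_normal \<partial>?NI)"
    by (intro nn_integral_cong) (auto simp: upd space_PiM PiE_iff extensional_def split: split_indicator)
  also have "\<dots> = emeasure ?NI ?EU * emeasure std_normal {..0}"
    by (simp add: nn_integral_cmult nn_integral_multc)
  finally have EZ: "measure ?N ?EZ = measure ?NI ?EU * measure std_normal {..0}"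
    by (simp add: measure_def enn2real_mult)
  have "measure ?NI ?EU \<le> 2 * measure ?N ?EZ"
    unfolding EZ using mult_left_mono[OF measure_std_normal_atMost_0, of "measure ?NI ?EU"] by simp
  also have "measure ?N ?EZ \<le> \<P>(x in ?N. \<exists>\<mu>\<in>U. \<forall>v\<in>V. x (m, 0) + ip m v (matvec m n x \<mu>) \<le> 2)"
    by (rule N.finite_measure_mono) (use fin in \<open>auto, force\<close>)
  also have "\<dots> = 1 - \<P>(x in ?N. \<forall>\<mu>\<in>U. \<exists>v\<in>V. 2 < x (m, 0) + ip m v (matvec m n x \<mu>))"
  proof (subst N.prob_compl[symmetric])
    show "{x \<in> space ?N. \<forall>\<mu>\<in>U. \<exists>v\<in>V. 2 < x (m, 0) + ip m v (matvec m n x \<mu>)} \<in> N.events" using fin by measurable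
    have "{x \<in> space ?N. \<exists>\<mu>\<in>U. \<forall>v\<in>V. x (m, 0) + ip m v (matvec m n x \<mu>) \<le> 2}
      = space ?N - {x \<in> space ?N. \<forall>\<mu>\<in>U. \<exists>v\<in>V. 2 < x (m, 0) + ip m v (matvec m n x \<mu>)}"
      unfolding not_le[symmetric] by blast
    thus "\<P>(x in ?N. \<exists>\<mu>\<in>U. \<forall>v\<in>V. x (m, 0) + ip m v (matvec m n x \<mu>) \<le> 2)
      = measure ?N (space ?N - {x \<in> space ?N. \<forall>\<mu>\<in>U. \<exists>v\<in>V. 2 < x (m, 0) + ip m v (matvec m n x \<mu>)})" by simp
  qed
  also have "\<dots> \<le> 1 - \<P>(x in ?N'. \<forall>\<mu>\<in>U. \<exists>v\<in>V. 3 \<le> ?y v \<mu> x)"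
    using g unfolding X Y by simp
  also have "\<dots> = \<P>(x in ?N'. \<exists>\<mu>\<in>U. \<forall>v\<in>V. ?y v \<mu> x < 3)"
  proof -
    have [measurable]: "(\<lambda>x. ?y v \<mu> x) \<in> borel_measurable ?N'" for v \<mu>
      unfolding Y[symmetric] by measurable
    have "{x \<in> space ?N'. \<exists>\<mu>\<in>U. \<forall>v\<in>V. ?y v \<mu> x < 3}
       = space ?N' - {x \<in> space ?N'. \<forall>\<mu>\<in>U. \<exists>v\<in>V. 3 \<le> ?y v \<mu> x}"
      unfolding not_less[symmetric] by blast
    moreover have "{x \<in> space ?N'. \<forall>\<mu>\<in>U. \<exists>v\<in>V. 3 \<le> ?y v \<mu> x} \<in> N'.events"
      using fin by measurable
    ultimately show ?thesis by (simp only: N'.prob_compl)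
  qed
  finally show ?thesis by (simp add: gauss_mat_def)
qed

text \<open>The marginal of a product measure along an injection of index sets. It extracts
  \<open>g\<close> and \<open>h\<close> from their joint vector, and later shows that the transpose
  of a Gaussian matrix is a Gaussian matrix.\<close>

lemma measure_PiM_reindex:
  assumes "inj_on f A" "f ` A \<subseteq> B" "E \<in> sets (gauss_on A)"
  shows "\<P>(x in gauss_on B. (\<lambda>k\<in>A. x (f k)) \<in> E)
     = measure (gauss_on A) E"
    and "{x \<in> space (gauss_on B). (\<lambda>k\<in>A. x (f k)) \<in> E} \<in> sets (gauss_on B)"
proof -
  have [measurable]: "(\<lambda>x. \<lambda>k\<in>A. x (f k)) \<in> gauss_on B \<rightarrow>\<^sub>M gauss_on A"
    using assms(2) by (intro measurable_restrict measurable_component_singleton) auto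
  note [measurable] = assms(3)
  show "{x \<in> space (gauss_on B). (\<lambda>k\<in>A. x (f k)) \<in> E} \<in> sets (gauss_on B)"
    by measurable
  have "gauss_on A = distr (gauss_on B) (gauss_on A) (\<lambda>x. \<lambda>k\<in>A. x (f k))"
    using assms by (intro distr_PiM_reindex[symmetric] prob_space_std_normal) auto
  hence "measure (gauss_on A) E = measure (distr (gauss_on B) (gauss_on A) (\<lambda>x. \<lambda>k\<in>A. x (f k))) E"
    by simp
  also have "\<dots> = measure (gauss_on B) ((\<lambda>x. \<lambda>k\<in>A. x (f k)) -` E \<inter> space (gauss_on B))"
    by (rule measure_distr) measurable
  finally show "\<P>(x in gauss_on B. (\<lambda>k\<in>A. x (f k)) \<in> E)
     = measure (gauss_on A) E"
    by (simp add: vimage_def Int_def conj_commute)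
qed

lemma enorm_ext0 [simp]: "enorm n (ext0 n g) = enorm n g" and ip_ext0 [simp]: "ip n v (ext0 n g) = ip n v g"
  by (simp_all add: enorm_def ip_def ext0_def)

text \<open>The 4 in \<open>a - 4\<close> has four sources: the threshold 1 in the event, 1 for
  moving \<open>\<mu>\<close> into a net, 1 for the smoothing gap between 2 and 3 in
  \<open>gordon_bilinear\<close>, and 1 for moving the maximizing \<open>v\<close> into a net. The
  moves fail only if \<open>G\<close> or \<open>h\<close> is large compared with
  \<open>1 / \<delta>\<close>, which costs at most \<open>\<epsilon>\<close>. The sign
  \<open>\<kappa>\<close> is 1 in part (1) and - 1 in part (2), where \<open>- ip m v g\<close> is
  what can be bounded.\<close>

lemma gaussian_min_max:
  fixes \<kappa> a :: real and f\<^sub>S f\<^sub>T :: "(nat \<Rightarrow> real) \<Rightarrow> real"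
  assumes S: "compact S" "\<And>\<mu>. \<mu> \<in> S \<Longrightarrow> enorm n \<mu> = 1"
    and T: "compact T" "\<And>v. v \<in> T \<Longrightarrow> enorm m v = 1" and \<kappa>: "\<kappa>\<^sup>2 = 1"
    and meas: "(\<lambda>g. f\<^sub>S (ext0 n g)) \<in> borel_measurable (gauss_vec n)" "(\<lambda>h. f\<^sub>T (ext0 m h)) \<in> borel_measurable (gauss_vec m)"
    and f\<^sub>S: "\<And>\<mu> g. \<mu> \<in> S \<Longrightarrow> \<kappa> * ip n \<mu> g \<le> f\<^sub>S g"
    and f\<^sub>T: "\<And>h. h \<in> Rn m \<Longrightarrow> a < f\<^sub>T h \<Longrightarrow> \<exists>v\<in>T. a < ip m v h"
    and E: "E \<in> sets (gauss_mat m n)"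
    and E_sub: "\<And>G. G \<in> E \<Longrightarrow> \<exists>\<mu>\<in>S. \<forall>v\<in>T. ip m v (matvec m n G \<mu>) \<le> 1"
  shows "measure (gauss_mat m n) E
     \<le> 2 * (\<P>(h in gauss_vec m. f\<^sub>T (ext0 m h) \<le> a)
          + \<P>(g in gauss_vec n. a - 4 \<le> f\<^sub>S (ext0 n g)))"
proof (rule field_le_epsilon)
  fix \<epsilon> :: real assume "0 < \<epsilon>"
  let ?I = "{..<m} \<times> {..<n}" and ?A = "pair_index n m"
  let ?NI = "gauss_on ?I" and ?N = "gauss_on ?A"
    and ?Nm = "gauss_on {..<m}" and ?Nn = "gauss_on {..<n}"
  interpret NI: prob_space ?NI by (rule prob_space_gauss_on)
  interpret N: prob_space ?N by (rule prob_space_gauss_on)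
  \<comment> \<open>The event that \<open>G\<close> is large costs \<open>m * n\<close> times
    \<open>\<delta>\<^sup>2\<close>, the one for \<open>h\<close> costs \<open>m\<close> times it,
    doubled by the factor in front; the summand 1 keeps \<open>c\<close> positive.\<close>
  define c where "c = real (m * n) + 2 * real m + 1"
  define \<delta> where "\<delta> = sqrt (\<epsilon> / c)"
  have c: "0 < c" by (simp add: c_def add_nonneg_pos)
  have \<delta>: "0 < \<delta>" "\<delta>\<^sup>2 * c = \<epsilon>" using \<open>0 < \<epsilon>\<close> c by (simp_all add: \<delta>_def)
  obtain U where U: "finite U" "U \<subseteq> S" "\<And>x. x \<in> S \<Longrightarrow> \<exists>u\<in>U. enorm n (vdiff x u) < \<delta>"
    using finite_net[OF S(1) \<delta>(1), of n] by blast
  obtain V where V: "finite V" "V \<subseteq> T" "\<And>x. x \<in> T \<Longrightarrow> \<exists>u\<in>V. enorm m (vdiff x u) < \<delta>"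
    using finite_net[OF T(1) \<delta>(1), of m] by blast
  let ?EU = "{G \<in> space ?NI. \<exists>\<mu>\<in>U. \<forall>v\<in>V. ip m v (matvec m n G \<mu>) \<le> 2}"
  let ?F = "{G \<in> space ?NI. 1 < \<delta> * sqrt (\<Sum>k\<in>?I. (G k)\<^sup>2)}"
  have [measurable]: "(\<lambda>G. ip m v (matvec m n G \<mu>)) \<in> borel_measurable ?NI" for v \<mu>
  proof -
    have "(\<lambda>G. \<Sum>i<m. v i * (\<Sum>j<n. G (i, j) * \<mu> j)) \<in> borel_measurable ?NI"
      by (intro borel_measurable_sum borel_measurable_times borel_measurable_const) auto
    thus ?thesis by (simp add: ip_def matvec_def)
  qed
  have [measurable]: "?EU \<in> sets ?NI" "?F \<in> sets ?NI" using U(1) V(1) by measurable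
  have "E \<subseteq> ?EU \<union> ?F"
  proof
    fix G assume G: "G \<in> E"
    hence sp: "G \<in> space ?NI" using sets.sets_into_space[OF E] by (auto simp: gauss_mat_def)
    have fn: "sqrt (\<Sum>k\<in>?I. (G k)\<^sup>2) = fnorm m n G" by (simp add: fnorm_def sum.cartesian_product)
    obtain \<mu> where \<mu>: "\<mu> \<in> S" "\<And>v. v \<in> T \<Longrightarrow> ip m v (matvec m n G \<mu>) \<le> 1" using E_sub[OF G] by blast
    obtain u where u: "u \<in> U" "enorm n (vdiff \<mu> u) < \<delta>" using U(3)[OF \<mu>(1)] by blast
    show "G \<in> ?EU \<union> ?F"
    proof (cases "1 < \<delta> * fnorm m n G")
      case False
      have "ip m v (matvec m n G u) \<le> 2" if v: "v \<in> V" for v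
      proof -
        have "ip m v (vdiff (matvec m n G u) (matvec m n G \<mu>)) \<le> enorm m v * enorm m (matvec m n G (vdiff u \<mu>))"
          unfolding matvec_vdiff by (rule ip_le_enorm_mult)
        also have "\<dots> \<le> 1 * (fnorm m n G * enorm n (vdiff u \<mu>))"
          using T(2) V(2) v by (intro mult_mono enorm_matvec_le) auto
        also have "\<dots> \<le> fnorm m n G * \<delta>"
          using u(2) by (auto simp: enorm_vdiff_commute[of n u] fnorm_def sum_nonneg intro!: mult_left_mono)
        also have "\<dots> \<le> 1" using False by (simp add: mult.commute)
        finally show ?thesis using \<mu>(2)[of v] V(2) v by (auto simp: ip_vdiff)
      qed
      thus ?thesis using u sp by blast
    qed (use sp fn in auto)
  qed
  hence "measure (gauss_mat m n) E \<le> measure ?NI (?EU \<union> ?F)"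
    unfolding gauss_mat_def by (intro NI.finite_measure_mono) auto
  also have "\<dots> \<le> measure ?NI ?EU + measure ?NI ?F" by (rule measure_Un_le) measurable
  also have "measure ?NI ?F \<le> \<delta>\<^sup>2 * real (m * n)"
    using measure_sum_squares_ge[of ?I \<delta>] \<delta> by simp
  also have "measure ?NI ?EU \<le> 2 * \<P>(x in ?N. \<exists>\<mu>\<in>U. \<forall>v\<in>V. ip m v (\<lambda>i. x (1, i)) - \<kappa> * ip n \<mu> (\<lambda>j. x (0, j)) < 3)"
    using gordon_bilinear[OF U(1) V(1) _ _ \<kappa>, of n m] S(2) T(2) U(2) V(2) by (auto simp: gauss_mat_def)
  also have "\<P>(x in ?N. \<exists>\<mu>\<in>U. \<forall>v\<in>V. ip m v (\<lambda>i. x (1, i)) - \<kappa> * ip n \<mu> (\<lambda>j. x (0, j)) < 3)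
     \<le> \<P>(h in ?Nm. f\<^sub>T (ext0 m h) \<le> a) + \<P>(g in ?Nn. a - 4 \<le> f\<^sub>S (ext0 n g))
       + \<delta>\<^sup>2 * real m" (is "measure ?N ?Y \<le> _")
  proof -
    let ?h = "\<lambda>x. \<lambda>i\<in>{..<m}. x (Pair 1 i)" and ?g = "\<lambda>x. \<lambda>j\<in>{..<n}. x (Pair 0 j)"
    let ?B1 = "{h \<in> space ?Nm. f\<^sub>T (ext0 m h) \<le> a}" and ?B2 = "{g \<in> space ?Nn. a - 4 \<le> f\<^sub>S (ext0 n g)}"
      and ?B3 = "{h \<in> space ?Nm. 1 < \<delta> * sqrt (\<Sum>i<m. (h i)\<^sup>2)}"
    have B: "?B1 \<in> sets ?Nm" "?B2 \<in> sets ?Nn" "?B3 \<in> sets ?Nm"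
      using meas unfolding gauss_vec_def by measurable
    let ?C1 = "{x \<in> space ?N. ?h x \<in> ?B1}" and ?C2 = "{x \<in> space ?N. ?g x \<in> ?B2}" and ?C3 = "{x \<in> space ?N. ?h x \<in> ?B3}"
    have sub: "Pair 1 ` {..<m} \<subseteq> ?A" "Pair 0 ` {..<n} \<subseteq> ?A" by auto
    have inj: "inj_on (Pair c) X" for c :: nat and X :: "nat set" by (simp add: inj_on_def)
    note C = measure_PiM_reindex[OF inj sub(1) B(1)] measure_PiM_reindex[OF inj sub(2) B(2)] measure_PiM_reindex[OF inj sub(1) B(3)]
    have "?Y \<subseteq> ?C1 \<union> ?C2 \<union> ?C3"
    proof
      fix x assume "x \<in> ?Y"
      then obtain \<mu> where x: "x \<in> space ?N" and \<mu>: "\<mu> \<in> U"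
        and Y: "\<And>v. v \<in> V \<Longrightarrow> ip m v (\<lambda>i. x (1, i)) - \<kappa> * ip n \<mu> (\<lambda>j. x (0, j)) < 3" by blast
      have sp: "?h x \<in> space ?Nm" "?g x \<in> space ?Nn" by (auto simp: space_PiM)
      have iph: "ip m v (\<lambda>i. x (1, i)) = ip m v (ext0 m (?h x))" for v
        unfolding ip_ext0 by (simp add: ip_def)
      have ipg: "ip n \<mu> (\<lambda>j. x (0, j)) = ip n \<mu> (ext0 n (?g x))"
        unfolding ip_ext0 by (simp add: ip_def)
      show "x \<in> ?C1 \<union> ?C2 \<union> ?C3"
      \<comment> \<open>Outside the three events there is a contradictory chain: a < <v0, h> <= <v,
        h> + 1 < \<kappa> <\<mu>, g> + 4 <= \<open>f\<^sub>S\<close> (g) + 4 < a.\<close>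
      proof (rule ccontr)
        assume "x \<notin> ?C1 \<union> ?C2 \<union> ?C3"
        hence n1: "a < f\<^sub>T (ext0 m (?h x))" and n2: "f\<^sub>S (ext0 n (?g x)) < a - 4"
          and n3: "\<delta> * enorm m (?h x) \<le> 1"
          using x sp unfolding enorm_def by (auto simp: not_le not_less)
        have "ext0 m (?h x) \<in> Rn m" by (simp add: Rn_def ext0_def)
        from f\<^sub>T[OF this n1] obtain v0 where v0: "v0 \<in> T" "a < ip m v0 (ext0 m (?h x))" by blast
        obtain v where v: "v \<in> V" "enorm m (vdiff v0 v) < \<delta>" using V(3)[OF v0(1)] by blast
        have "ip m (vdiff v0 v) (ext0 m (?h x)) \<le> enorm m (vdiff v0 v) * enorm m (?h x)"
          using ip_le_enorm_mult[of m "vdiff v0 v" "ext0 m (?h x)"] by simp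
        also have "\<dots> \<le> \<delta> * enorm m (?h x)" using v(2) by (intro mult_right_mono) auto
        finally have "ip m v0 (ext0 m (?h x)) - ip m v (ext0 m (?h x)) \<le> 1" using n3 by (simp only: ip_vdiff)
        moreover have "\<kappa> * ip n \<mu> (ext0 n (?g x)) \<le> f\<^sub>S (ext0 n (?g x))" using f\<^sub>S \<mu> U(2) by blast
        ultimately show False using Y[OF v(1)] v0(2) n2 unfolding iph ipg by linarith
      qed
    qed
    hence "measure ?N ?Y \<le> measure ?N (?C1 \<union> ?C2 \<union> ?C3)"
      using C by (intro N.finite_measure_mono sets.Un) auto
    also have "\<dots> \<le> measure ?N (?C1 \<union> ?C2) + measure ?N ?C3" using C by (intro measure_Un_le sets.Un)
    also have "measure ?N (?C1 \<union> ?C2) \<le> measure ?N ?C1 + measure ?N ?C2" using C by (intro measure_Un_le)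
    also have "measure ?N ?C3 \<le> \<delta>\<^sup>2 * real m"
      unfolding C using measure_sum_squares_ge[of "{..<m}" \<delta>] \<delta> by simp
    finally show ?thesis unfolding C by simp
  qed
  finally have "measure (gauss_mat m n) E \<le> 2 * (\<P>(h in ?Nm. f\<^sub>T (ext0 m h) \<le> a)
      + \<P>(g in ?Nn. a - 4 \<le> f\<^sub>S (ext0 n g)) + \<delta>\<^sup>2 * real m) + \<delta>\<^sup>2 * real (m * n)"
    by simp
  moreover have "2 * (\<delta>\<^sup>2 * real m) + \<delta>\<^sup>2 * real (m * n) \<le> \<epsilon>"
    unfolding \<delta>(2)[symmetric] c_def by (simp add: algebra_simps)
  ultimately show "measure (gauss_mat m n) E
     \<le> 2 * (\<P>(h in gauss_vec m. f\<^sub>T (ext0 m h) \<le> a)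
          + \<P>(g in gauss_vec n. a - 4 \<le> f\<^sub>S (ext0 n g))) + \<epsilon>"
    unfolding gauss_vec_def by simp
qed

section \<open>Images of cones\<close>

context cone
begin

lemma compact_ball: "compact {x \<in> K. enorm n x \<le> R}"
proof (rule compact_closed_subset_Rn_ball)
  show "closed {x \<in> K. enorm n x \<le> R}"
    using closed_Int[OF closed closed_Collect_le[OF continuous_on_enorm[of UNIV "\<lambda>x. x" n] continuous_on_const[of UNIV R]]]
    by (simp add: Int_def continuous_on_coord)
qed (use Rn in auto)

lemma compact_sphere: "compact {x \<in> K. enorm n x = 1}"
proof (rule compact_closed_subset_Rn_ball)
  show "closed {x \<in> K. enorm n x = 1}"
    using closed_Int[OF closed closed_Collect_eq[OF continuous_on_enorm[of UNIV "\<lambda>x. x" n] continuous_on_const[of UNIV 1]]]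
    by (simp add: Int_def continuous_on_coord)
qed (use Rn in auto)

end

lemma compact_dual_sphere: "compact {v \<in> Rn n. enorm n v = 1 \<and> (\<forall>x\<in>X. ip n v x \<le> 0)}"
proof (rule compact_closed_subset_Rn_ball)
  have "closed (Rn n \<inter> {v. enorm n v = 1} \<inter> (\<Inter>x\<in>X. {v. ip n v x \<le> 0}))"
    by (intro closed_Int closed_Rn closed_INT ballI closed_Collect_le closed_Collect_eq continuous_intros)
  moreover have "Rn n \<inter> {v. enorm n v = 1} \<inter> (\<Inter>x\<in>X. {v. ip n v x \<le> 0}) = {v \<in> Rn n. enorm n v = 1 \<and> (\<forall>x\<in>X. ip n v x \<le> 0)}"
    by auto
  ultimately show "closed {v \<in> Rn n. enorm n v = 1 \<and> (\<forall>x\<in>X. ip n v x \<le> 0)}" by simp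
qed auto

lemma matvec_Rn: "matvec m n G x \<in> Rn m"
  by (simp add: matvec_def Rn_def)

lemma matvec_add: "matvec m n G (\<lambda>i. x i + y i) = (\<lambda>i. matvec m n G x i + matvec m n G y i)"
  and matvec_scale: "matvec m n G (\<lambda>i. c * x i) = (\<lambda>i. c * matvec m n G x i)"
  by (auto simp: matvec_def sum.distrib sum_distrib_left algebra_simps)

text \<open>Both sets contain 0, so being different from {0} means having a nonzero element. The
  strict inequality for the norm makes the event a countable union of closed conditions
  below.\<close>

lemma image_meets_cone_iff:
  assumes "closed_convex_cone n K" "closed_convex_cone m L"
  shows "L \<inter> matvec m n G ` K \<noteq> {(\<lambda>_. 0)} \<longleftrightarrow> (\<exists>\<mu>\<in>K. matvec m n G \<mu> \<in> L \<and> 0 < enorm m (matvec m n G \<mu>))"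
proof -
  interpret K: cone n K by unfold_locales fact
  interpret L: cone m L by unfold_locales fact
  have "matvec m n G (\<lambda>_. 0) = (\<lambda>_. 0)" by (auto simp: matvec_def)
  hence z: "(\<lambda>_. 0) \<in> L \<inter> matvec m n G ` K" using K.zero L.zero by (metis IntI imageI)
  have "0 < enorm m (matvec m n G \<mu>) \<longleftrightarrow> matvec m n G \<mu> \<noteq> (\<lambda>_. 0)" for \<mu>
    using enorm_eq_0_iff[OF matvec_Rn[of m n G \<mu>]] enorm_nonneg[of m "matvec m n G \<mu>"] by linarith
  thus ?thesis using z by auto
qed

text \<open>Witnesses for a convergent sequence of matrices have a convergent subsequence by
  compactness, and the lower bound \<open>\<epsilon>\<close> survives in the limit.\<close>

lemma closed_image_meets:
  fixes \<epsilon> :: real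
  assumes "compact K" "closed L"
  shows "closed {G. \<exists>\<mu>\<in>K. matvec m n G \<mu> \<in> L \<and> \<epsilon> \<le> enorm m (matvec m n G \<mu>)}"
  unfolding closed_sequential_limits
proof (intro allI impI)
  let ?P = "\<lambda>G \<mu>. matvec m n G \<mu> \<in> L \<and> \<epsilon> \<le> enorm m (matvec m n G \<mu>)"
  fix x l assume *: "(\<forall>k. x k \<in> {G. \<exists>\<mu>\<in>K. ?P G \<mu>}) \<and> x \<longlonglongrightarrow> l"
  then obtain \<mu> where \<mu>: "\<And>k. \<mu> k \<in> K" "\<And>k. ?P (x k) (\<mu> k)" by (simp, metis)
  obtain \<mu>0 r where r: "\<mu>0 \<in> K" "strict_mono r" "(\<mu> \<circ> r) \<longlonglongrightarrow> \<mu>0"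
    using compact_imp_seq_compact[OF assms(1)] \<mu>(1) unfolding seq_compact_def by metis
  have cont: "continuous_on UNIV (\<lambda>p. matvec m n (fst p) (snd p))"
  proof (rule continuous_on_coordinatewise_then_product)
    have "continuous_on UNIV (\<lambda>p::(nat \<times> nat \<Rightarrow> real) \<times> (nat \<Rightarrow> real). fst p k)" for k
      by (rule continuous_on_compose2[OF continuous_on_coord[of UNIV]]) (auto intro: continuous_intros)
    moreover have "continuous_on UNIV (\<lambda>p::(nat \<times> nat \<Rightarrow> real) \<times> (nat \<Rightarrow> real). snd p k)" for k
      by (rule continuous_on_compose2[OF continuous_on_coord[of UNIV]]) (auto intro: continuous_intros)
    ultimately show "continuous_on UNIV (\<lambda>p. matvec m n (fst p) (snd p) i)" for i
      unfolding matvec_def by (cases "i < m") (auto intro!: continuous_intros)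
  qed
  have "closed {z. z \<in> L \<and> \<epsilon> \<le> enorm m z}"
    using closed_Int[OF assms(2) closed_Collect_le[OF continuous_on_const[of UNIV \<epsilon>] continuous_on_enorm[of UNIV "\<lambda>x. x" m]]]
    by (simp add: Int_def continuous_on_coord)
  from closed_vimage[OF this cont] have cl: "closed {p. ?P (fst p) (snd p)}"
    by (simp add: vimage_def)
  have "(\<lambda>k. (x (r k), \<mu> (r k))) \<longlonglongrightarrow> (l, \<mu>0)"
    using * r LIMSEQ_subseq_LIMSEQ[of x l r] by (intro tendsto_Pair) (auto simp: o_def)
  from closed_sequentially[OF cl _ this] have "?P l \<mu>0" using \<mu>(2) by auto
  thus "l \<in> {G. \<exists>\<mu>\<in>K. ?P G \<mu>}" using r(1) by blast
qed

text \<open>The event is the union over k of the closed events with a witness of norm at most k and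
  an image of norm at least 1/(k+1). The map \<open>?e\<close> replaces the entries outside the
  index set, \<open>undefined\<close> in the product space, by 0; \<open>matvec\<close> does not
  read them.\<close>

lemma sets_image_meets_cone:
  assumes "closed_convex_cone n K" "closed_convex_cone m L"
  shows "{G \<in> space (gauss_mat m n). L \<inter> matvec m n G ` K \<noteq> {(\<lambda>_. 0)}} \<in> sets (gauss_mat m n)"
proof -
  interpret K: cone n K by unfold_locales fact
  interpret L: cone m L by unfold_locales fact
  let ?I = "{..<m} \<times> {..<n}"
  let ?C = "\<lambda>k. {G. \<exists>\<mu>\<in>{x \<in> K. enorm n x \<le> real k}. matvec m n G \<mu> \<in> L \<and> 1 / real (Suc k) \<le> enorm m (matvec m n G \<mu>)}"
  let ?e = "\<lambda>G p. if p \<in> ?I then G p else (0::real)"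
  have "?C k \<in> sets borel" for k
    by (intro borel_closed closed_image_meets K.compact_ball L.closed)
  hence [measurable]: "?C k \<in> sets real_product" for k by (simp add: sets_PiM_equal_borel)
  have [measurable]: "?e \<in> gauss_on ?I \<rightarrow>\<^sub>M real_product"
  proof (intro measurable_abs_UNIV)
    fix p show "(\<lambda>G. ?e G p) \<in> borel_measurable (gauss_on ?I)" by (cases "p \<in> ?I") auto
  qed
  have mv: "matvec m n (?e G) \<mu> = matvec m n G \<mu>" for G \<mu>
    by (auto simp: matvec_def fun_eq_iff intro!: sum.cong)
  have "(\<exists>\<mu>\<in>K. matvec m n G \<mu> \<in> L \<and> 0 < enorm m (matvec m n G \<mu>)) \<longleftrightarrow> (\<exists>k. ?e G \<in> ?C k)" for G
  proof
    assume "\<exists>\<mu>\<in>K. matvec m n G \<mu> \<in> L \<and> 0 < enorm m (matvec m n G \<mu>)"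
    then obtain \<mu> where \<mu>: "\<mu> \<in> K" "matvec m n G \<mu> \<in> L" "0 < enorm m (matvec m n G \<mu>)" by blast
    obtain k1 where k1: "enorm n \<mu> \<le> real k1" using real_arch_simple by blast
    obtain k2 where k2: "1 / real (Suc k2) < enorm m (matvec m n G \<mu>)"
      using reals_Archimedean[OF \<mu>(3)] by (auto simp: inverse_eq_divide)
    have "1 / real (Suc (max k1 k2)) \<le> 1 / real (Suc k2)" by (intro divide_left_mono) auto
    moreover have "real k1 \<le> real (max k1 k2)" by simp
    ultimately have "?e G \<in> ?C (max k1 k2)" unfolding mem_Collect_eq mv using \<mu> k1 k2 by (intro bexI[of _ \<mu>]) auto
    thus "\<exists>k. ?e G \<in> ?C k" ..
  next
    assume "\<exists>k. ?e G \<in> ?C k"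
    then obtain k \<mu> where "\<mu> \<in> K" "matvec m n G \<mu> \<in> L" "1 / real (Suc k) \<le> enorm m (matvec m n G \<mu>)"
      unfolding mem_Collect_eq mv by blast
    moreover have "0 < 1 / real (Suc k)" by simp
    ultimately show "\<exists>\<mu>\<in>K. matvec m n G \<mu> \<in> L \<and> 0 < enorm m (matvec m n G \<mu>)" by (meson less_le_trans)
  qed
  hence "{G \<in> space (gauss_mat m n). L \<inter> matvec m n G ` K \<noteq> {(\<lambda>_. 0)}}
      = {G \<in> space (gauss_on ?I). \<exists>k. ?e G \<in> ?C k}"
    unfolding image_meets_cone_iff[OF assms] by (simp add: gauss_mat_def)
  also have "\<dots> \<in> sets (gauss_on ?I)" by measurable
  finally show ?thesis by (simp add: gauss_mat_def)
qed

section \<open>The intersection is trivial when \<open>K\<close> is small\<close>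

lemma four_exp_le: "1 \<le> t \<Longrightarrow> 4 * exp (- ((4 * sqrt t)\<^sup>2 / 4)) \<le> exp (- t)" for t :: real
proof -
  assume t: "1 \<le> t"
  have "4 \<le> 1 + 3 * t" using t by simp
  also have "\<dots> \<le> exp (3 * t)" by (rule exp_ge_add_one_self)
  finally have "4 * exp (- (4 * t)) \<le> exp (3 * t) * exp (- (4 * t))" by (rule mult_right_mono) simp
  also have "\<dots> = exp (- t)" by (simp add: exp_add[symmetric])
  finally show ?thesis using t by (simp add: power_mult_distrib)
qed

text \<open>\<open>S\<close> is the unit sphere of \<open>K\<close> and \<open>T\<close> that of the
  polar cone of \<open>L\<close>: an image point in \<open>L\<close>, rescaled to come from the unit
  sphere, has nonpositive inner product with all of \<open>T\<close>.\<close>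

lemma image_meets_cone_unlikely:
  assumes K: "closed_convex_cone n K" and L: "closed_convex_cone m L" and t: "1 \<le> t"
    and gap: "sqrt (stat_dim n K) - sqrt (real m - stat_dim m L) \<le> - 19 * sqrt t"
  shows "measure (gauss_mat m n) {G \<in> space (gauss_mat m n). L \<inter> matvec m n G ` K \<noteq> {(\<lambda>_. 0)}} \<le> exp (- t)"
proof -
  interpret K: cone n K by unfold_locales fact
  interpret L: cone m L by unfold_locales fact
  interpret p: gauss_lipschitz "{..<n}" "\<lambda>g. K.pnorm (ext0 n g)" by (rule K.gauss_lipschitz_pnorm)
  interpret q: gauss_lipschitz "{..<m}" "\<lambda>g. L.rnorm (ext0 m g)" by (rule L.gauss_lipschitz_rnorm)
  \<comment> \<open>Each tail is then \<open>exp (- 4 * t)\<close>; there are two of them, doubled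
    by the min-max bound, as in \<open>four_exp_le\<close>.\<close>
  define r where "r = 4 * sqrt t"
  have st: "1 \<le> sqrt t" using t by simp
  have r: "0 \<le> r" using st by (simp add: r_def)
  let ?p = "p.expectation (\<lambda>g. K.pnorm (ext0 n g))" and ?q = "q.expectation (\<lambda>g. L.rnorm (ext0 m g))"
  have "?p \<le> sqrt (stat_dim n K)"
    using p.expectation_le_sqrt(1) by (simp add: K.stat_dim_eq gauss_vec_def)
  moreover have "sqrt (real m - stat_dim m L) \<le> ?q + 2"
    using q.expectation_le_sqrt(2) by (simp add: L.codim_eq gauss_vec_def)
  \<comment> \<open>The deviations \<open>2 * r = 8 * sqrt t\<close>, the shift 4 and the passage
    from root mean square to mean, 2, fit into the gap.\<close>
  ultimately have a: "?p + r \<le> ?q - r - 4" using gap st unfolding r_def by linarith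
  let ?D = "{G \<in> space (gauss_mat m n). L \<inter> matvec m n G ` K \<noteq> {(\<lambda>_. 0)}}"
  have "measure (gauss_mat m n) ?D
     \<le> 2 * (\<P>(h in gauss_vec m. L.rnorm (ext0 m h) \<le> ?q - r)
          + \<P>(g in gauss_vec n. (?q - r) - 4 \<le> K.pnorm (ext0 n g)))"
  proof (rule gaussian_min_max[where \<kappa> = 1, OF K.compact_sphere _ compact_dual_sphere[of m L]])
    show "(\<lambda>g. K.pnorm (ext0 n g)) \<in> borel_measurable (gauss_vec n)" using p.meas by (simp add: gauss_vec_def)
    show "(\<lambda>g. L.rnorm (ext0 m g)) \<in> borel_measurable (gauss_vec m)" using q.meas by (simp add: gauss_vec_def)
    show "1 * ip n \<mu> g \<le> K.pnorm g" if "\<mu> \<in> {x \<in> K. enorm n x = 1}" for \<mu> g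
      using K.ip_le_pnorm[of \<mu> g] that by simp
    show "\<exists>v\<in>{v \<in> Rn m. enorm m v = 1 \<and> (\<forall>x\<in>L. ip m v x \<le> 0)}. ?q - r < ip m v h"
      if "h \<in> Rn m" "?q - r < L.rnorm h" for h
    proof -
      \<comment> \<open>The threshold \<open>?q - r\<close> is at least 4 by \<open>a\<close>, so
        the residual is nonzero and can be normalized.\<close>
      have "0 \<le> ?p" by simp
      hence "0 < L.rnorm h" using that a r by linarith
      from L.rnorm_attained[OF this that(1)] show ?thesis using that by auto
    qed
    show "?D \<in> sets (gauss_mat m n)" by (rule sets_image_meets_cone[OF K L])
    fix G assume "G \<in> ?D"
    then obtain \<mu> where \<mu>: "\<mu> \<in> K" "matvec m n G \<mu> \<in> L" "0 < enorm m (matvec m n G \<mu>)"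
      unfolding image_meets_cone_iff[OF K L] by blast
    have "enorm n \<mu> \<noteq> 0" using \<mu>(3) enorm_matvec_le[of m n G \<mu>] by auto
    hence pos: "0 < enorm n \<mu>" using enorm_nonneg[of n \<mu>] by linarith
    let ?\<mu> = "\<lambda>i. (1 / enorm n \<mu>) * \<mu> i"
    have "?\<mu> \<in> K" using pos by (intro K.scale \<mu>) simp
    moreover have "enorm n ?\<mu> = 1" unfolding enorm_scale using pos by simp
    moreover have "ip m v (matvec m n G ?\<mu>) \<le> 1" if "\<forall>x\<in>L. ip m v x \<le> 0" for v
    proof -
      have "matvec m n G ?\<mu> \<in> L" unfolding matvec_scale using pos by (intro L.scale \<mu>) simp
      thus ?thesis using that by force
    qed
    ultimately show "\<exists>\<mu>\<in>{x \<in> K. enorm n x = 1}. \<forall>v\<in>{v \<in> Rn m. enorm m v = 1 \<and> (\<forall>x\<in>L. ip m v x \<le> 0)}. ip m v (matvec m n G \<mu>) \<le> 1"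
      by (intro bexI[of _ ?\<mu>]) auto
  qed auto
  also have "\<P>(h in gauss_vec m. L.rnorm (ext0 m h) \<le> ?q - r) \<le> exp (- r\<^sup>2 / 4)"
    using q.lower_tail[OF r] by (simp add: gauss_vec_def)
  also have "\<P>(g in gauss_vec n. (?q - r) - 4 \<le> K.pnorm (ext0 n g))
      \<le> \<P>(g in gauss_vec n. ?p + r \<le> K.pnorm (ext0 n g))"
    unfolding gauss_vec_def by (intro p.finite_measure_mono) (use a in auto)
  also have "\<dots> \<le> exp (- r\<^sup>2 / 4)" using p.upper_tail[OF r] by (simp add: gauss_vec_def)
  also have "2 * (exp (- r\<^sup>2 / 4) + exp (- r\<^sup>2 / 4)) \<le> exp (- t)"
    using four_exp_le[OF t] by (simp add: r_def)
  finally show ?thesis by simp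
qed

text \<open>If \<open>L\<close> is a subspace, then its intersection with the half-space of a vector \<open>w \<in> L\<close> is a
  cone that is no longer a subspace and whose statistical dimension is smaller by \<open>1 / 2\<close> only. Working with it rules out that the
  point of \<open>L\<close> produced below is zero, at the cost of the term \<open>\<bar>ip m w g\<bar>\<close>.\<close>

lemma pointed_subcone:
  assumes L: "closed_convex_cone m L" and ne: "L \<noteq> {(\<lambda>_. 0)}"
  obtains L' w where "closed_convex_cone m L'" "L' \<subseteq> L" "w \<in> L'" "enorm m w = 1" "(\<lambda>i. - w i) \<notin> L'"
    "\<And>v g. enorm m v = 1 \<Longrightarrow> (\<forall>x\<in>L'. 0 \<le> ip m v x) \<Longrightarrow> - ip m v g \<le> cone.rnorm m L g + \<bar>ip m w g\<bar>"
proof -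
  interpret L: cone m L by unfold_locales fact
  have unit: "\<exists>w\<in>L. enorm m w = 1 \<and> ((\<lambda>i. - x i) \<notin> L \<longrightarrow> (\<lambda>i. - w i) \<notin> L)" if x: "x \<in> L" "x \<noteq> (\<lambda>_. 0)" for x
  proof -
    have pos: "0 < enorm m x" using enorm_eq_0_iff[OF L.Rn[OF x(1)]] x(2) enorm_nonneg[of m x] by linarith
    let ?w = "\<lambda>i. (1 / enorm m x) * x i"
    have "(\<lambda>i. - x i) \<in> L" if "(\<lambda>i. - ?w i) \<in> L"
      using L.scale[OF that, of "enorm m x"] pos by (simp add: field_simps)
    moreover have "?w \<in> L" using pos by (intro L.scale x) simp
    moreover have "enorm m ?w = 1" unfolding enorm_scale using pos by simp
    ultimately show ?thesis by (intro bexI[of _ ?w]) auto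
  qed
  show ?thesis
  proof (cases "\<exists>x\<in>L. (\<lambda>i. - x i) \<notin> L")
    case True
    then obtain x where x: "x \<in> L" "(\<lambda>i. - x i) \<notin> L" by blast
    hence "x \<noteq> (\<lambda>_. 0)" using L.zero by auto
    with unit x obtain w where w: "w \<in> L" "enorm m w = 1" "(\<lambda>i. - w i) \<notin> L" by blast
    show ?thesis
    proof (rule that[OF L subset_refl w])
      fix v g assume v: "enorm m v = 1" "\<forall>x\<in>L. 0 \<le> ip m v x"
      have "ip m (\<lambda>i. - v i) g \<le> enorm m (\<lambda>i. - v i) * L.rnorm g"
        using v by (intro L.ip_le_rnorm) (simp add: ip_linear)
      moreover have "enorm m (\<lambda>i. - v i) = 1" using v by (simp add: enorm_def)
      ultimately show "- ip m v g \<le> L.rnorm g + \<bar>ip m w g\<bar>" by (simp add: ip_linear)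
    qed
  next
    case False
    hence neg: "(\<lambda>i. - x i) \<in> L" if "x \<in> L" for x using that by blast
    obtain x where "x \<in> L" "x \<noteq> (\<lambda>_. 0)" using ne L.zero by blast
    with unit obtain w where w: "w \<in> L" "enorm m w = 1" by blast
    have ww: "ip m w w = 1" using w(2) enorm_square[of m w] by simp
    let ?L' = "{x \<in> L. 0 \<le> ip m x w}"
    show ?thesis
    proof (rule that[of ?L' w])
      show "closed_convex_cone m ?L'"
        unfolding closed_convex_cone_def
      proof (intro conjI ballI allI impI)
        show "?L' \<subseteq> Rn m" using L.Rn by auto
        show "(\<lambda>i. 0) \<in> ?L'" using L.zero by (simp add: ip_def)
        show "(\<lambda>i. c * x i) \<in> ?L'" if "x \<in> ?L'" "0 \<le> c" for x c
          using that L.scale by (simp add: ip_linear)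
        show "(\<lambda>i. u * x i + (1 - u) * y i) \<in> ?L'" if "x \<in> ?L'" "y \<in> ?L'" "0 \<le> u \<and> u \<le> 1" for x y u
          using that L.scale L.add by (simp add: ip_linear)
        fix y assume y: "y \<in> Rn m" "\<forall>e>0. \<exists>x\<in>?L'. enorm m (vdiff x y) < e"
        have "\<forall>e>0. \<exists>x\<in>L. enorm m (vdiff x y) < e" using y(2) by blast
        hence "y \<in> L" using L y(1) by (simp add: closed_convex_cone_def)
        moreover have "0 \<le> ip m y w"
        proof (rule field_le_epsilon)
          fix e :: real assume "0 < e"
          then obtain x where x: "x \<in> ?L'" "enorm m (vdiff x y) < e" using y by blast
          have "ip m (vdiff x y) w \<le> enorm m (vdiff x y) * enorm m w" by (rule ip_le_enorm_mult)
          thus "0 \<le> ip m y w + e" using x w by (simp add: ip_vdiff)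
        qed
        ultimately show "y \<in> ?L'" by simp
      qed
      show "w \<in> ?L'" "enorm m w = 1" "(\<lambda>i. - w i) \<notin> ?L'" using w ww by (simp_all add: ip_linear)
      fix v g assume v: "enorm m v = 1" "\<forall>x\<in>?L'. 0 \<le> ip m v x"
      \<comment> \<open>Minus the component of \<open>v\<close> orthogonal to \<open>w\<close>. For
        x in \<open>L\<close> the vector x - <x, w> w is in \<open>L\<close> and orthogonal to
        \<open>w\<close>, hence in the half-space, where \<open>v\<close> is nonnegative; so this
        component is polar to all of \<open>L\<close> and the distance to \<open>L\<close> controls
        it.\<close>
      define v' where "v' = (\<lambda>i. - (v i - ip m v w * w i))"
      have v'x: "ip m v' x = - (ip m v x - ip m v w * ip m w x)" for x by (simp add: v'_def ip_linear)
      have "ip m v' x \<le> 0" if "x \<in> L" for x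
      proof -
        \<comment> \<open>\<open>L.scale\<close> takes nonnegative factors only, so the sign goes
          into the vector, both \<open>w\<close> and \<open>- w\<close> being in
          \<open>L\<close>.\<close>
        have "(\<lambda>i. - sgn (ip m x w) * w i) \<in> L" using w neg L.zero by (auto simp: sgn_if)
        from L.add[OF that L.scale[OF this abs_ge_zero]]
        have "(\<lambda>i. x i + \<bar>ip m x w\<bar> * (- sgn (ip m x w) * w i)) \<in> L" .
        also have "(\<lambda>i. x i + \<bar>ip m x w\<bar> * (- sgn (ip m x w) * w i)) = (\<lambda>i. x i - ip m x w * w i)"
          by (auto simp: sgn_if abs_if)
        finally have "(\<lambda>i. x i - ip m x w * w i) \<in> ?L'" by (simp add: ip_linear ww)
        hence "0 \<le> ip m v (\<lambda>i. x i - ip m x w * w i)" using v by blast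
        hence "0 \<le> ip m v x - ip m x w * ip m v w" by (simp only: ip_linear)
        thus ?thesis unfolding v'x ip_commute[of m w x] by (simp add: mult.commute)
      qed
      hence "ip m v' g \<le> enorm m v' * L.rnorm g" by (rule L.ip_le_rnorm)
      also have "enorm m v' \<le> 1"
      proof -
        have "ip m v v = 1" using v(1) enorm_square[of m v] by simp
        hence "(enorm m v')\<^sup>2 = 1 - (ip m v w)\<^sup>2"
          unfolding enorm_square v'_def ip_linear ww ip_commute[of m w v]
          by (simp add: power2_eq_square algebra_simps)
        hence "(enorm m v')\<^sup>2 \<le> 1\<^sup>2" by simp
        thus ?thesis by (rule power2_le_imp_le) simp
      qed
      hence "enorm m v' * L.rnorm g \<le> 1 * L.rnorm g" by (intro mult_right_mono) auto
      finally have 1: "ip m v' g \<le> L.rnorm g" by simp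
      have "\<bar>ip m v w\<bar> \<le> 1" using abs_ip_le_enorm_mult[of m v w] v w by simp
      hence "\<bar>ip m v w\<bar> * \<bar>ip m w g\<bar> \<le> 1 * \<bar>ip m w g\<bar>" by (intro mult_right_mono) auto
      hence "- (ip m v w * ip m w g) \<le> \<bar>ip m w g\<bar>" by (simp add: abs_mult[symmetric])
      thus "- ip m v g \<le> L.rnorm g + \<bar>ip m w g\<bar>" using 1 unfolding v'x by linarith
    qed auto
  qed
qed

text \<open>The nonzero point of the intersection is \<open>w + l\<close>, where \<open>l\<close> in \<open>L\<close> and \<open>\<mu>\<close> in the unit ball of \<open>K\<close> solve
  \<open>matvec m n G \<mu> - w = l\<close>. They are found by minimizing the distance of \<open>matvec m n G \<mu> - w\<close>
  to \<open>L\<close>: at a minimizer with positive distance the normalized residual would violate the hypothesis.\<close>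

lemma cone_meets_of_dual_bound:
  assumes K: "closed_convex_cone n K" and L: "closed_convex_cone m L"
    and w: "w \<in> L" "enorm m w = 1" "(\<lambda>i. - w i) \<notin> L"
    and dual: "\<And>v. v \<in> Rn m \<Longrightarrow> enorm m v = 1 \<Longrightarrow> \<forall>x\<in>L. 0 \<le> ip m v x \<Longrightarrow>
       \<exists>\<mu>\<in>K. enorm n \<mu> = 1 \<and> 1 < ip m v (matvec m n G \<mu>)"
  shows "\<exists>\<mu>\<in>K. matvec m n G \<mu> \<in> L \<and> 0 < enorm m (matvec m n G \<mu>)"
proof -
  interpret K: cone n K by unfold_locales fact
  interpret L: cone m L by unfold_locales fact
  let ?B = "{x \<in> K. enorm n x \<le> 1}" and ?y = "\<lambda>\<mu>. vdiff (matvec m n G \<mu>) w"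
  have "continuous_on ?B (\<lambda>\<mu>. L.rnorm (?y \<mu>))"
  proof (rule continuous_on_compose2[OF continuous_on_of_lipschitz_enorm[OF L.rnorm_lipschitz]])
    show "continuous_on ?B ?y"
    proof (rule continuous_on_coordinatewise_then_product)
      show "continuous_on ?B (\<lambda>\<mu>. ?y \<mu> i)" for i
        unfolding vdiff_def matvec_def by (cases "i < m") (auto intro!: continuous_intros)
    qed
  qed auto
  moreover have "?B \<noteq> {}" using K.zero by auto
  ultimately obtain \<mu> where \<mu>: "\<mu> \<in> K" "enorm n \<mu> \<le> 1"
    and min: "\<And>x. x \<in> ?B \<Longrightarrow> L.rnorm (?y \<mu>) \<le> L.rnorm (?y x)"
    using continuous_attains_inf[OF K.compact_ball[of 1], of "\<lambda>\<mu>. L.rnorm (?y \<mu>)"] by blast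
  let ?l = "proj m L (?y \<mu>)"
  have yR: "?y \<mu> \<in> Rn m" using matvec_Rn[of m n G \<mu>] L.Rn[OF w(1)] by (simp add: Rn_def vdiff_def)
  let ?d = "vdiff (?y \<mu>) ?l"
  have dR: "?d \<in> Rn m" using yR L.Rn[OF L.proj(1), of "?y \<mu>"] by (simp add: Rn_def vdiff_def)
  show ?thesis
  proof (cases "L.rnorm (?y \<mu>) = 0")
    case True
    hence "?d = (\<lambda>_. 0)" using enorm_eq_0_iff[OF dR] by (simp add: L.rnorm_def)
    hence "matvec m n G \<mu> i - w i - ?l i = 0" for i unfolding vdiff_def by (rule fun_cong)
    then obtain l where l: "l \<in> L" "\<And>i. matvec m n G \<mu> i - w i - l i = 0"
      using L.proj(1)[of "?y \<mu>"] by blast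
    have G: "matvec m n G \<mu> = (\<lambda>i. w i + l i)"
    proof
      show "matvec m n G \<mu> i = w i + l i" for i using l(2)[of i] by simp
    qed
    have "matvec m n G \<mu> \<in> L" unfolding G by (rule L.add[OF w(1) l(1)])
    moreover have "matvec m n G \<mu> \<noteq> (\<lambda>_. 0)"
    proof
      assume "matvec m n G \<mu> = (\<lambda>_. 0)"
      hence "l i = - w i" for i using l(2)[of i] by simp
      hence "l = (\<lambda>i. - w i)" by (rule ext)
      thus False using w(3) l(1) by simp
    qed
    ultimately show ?thesis using \<mu>(1) enorm_eq_0_iff[OF matvec_Rn[of m n G \<mu>]] enorm_nonneg[of m "matvec m n G \<mu>"]
      by (intro bexI[of _ \<mu>]) linarith+
  next
    case False
    define R where "R = L.rnorm (?y \<mu>)"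
    have R: "0 < R" using False L.rnorm_nonneg[of "?y \<mu>"] unfolding R_def by linarith
    let ?v = "\<lambda>i. (- (1 / R)) * ?d i"
    have vd: "ip m ?v z = - (1 / R) * ip m ?d z" for z by (rule ip_linear)
    have "?v \<in> Rn m" using dR by (simp add: Rn_def)
    moreover have "enorm m ?v = 1" unfolding enorm_scale using R by (simp add: R_def L.rnorm_def)
    moreover have "\<forall>x\<in>L. 0 \<le> ip m ?v x"
      unfolding vd using R L.ip_residual_le[of _ "?y \<mu>"] by (simp add: mult_nonpos_nonpos divide_nonpos_pos)
    ultimately obtain \<mu>1 where \<mu>1: "\<mu>1 \<in> K" "enorm n \<mu>1 = 1" "1 < ip m ?v (matvec m n G \<mu>1)"
      using dual by blast
    have "0 \<le> ip m ?d (vdiff (matvec m n G \<mu>1) (matvec m n G \<mu>))"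
    proof (rule ip_nonneg_of_enorm_minimal)
      fix s :: real assume s: "0 < s" "s \<le> 1"
      let ?x = "\<lambda>i. (1 - s) * \<mu> i + s * \<mu>1 i"
      have "?x \<in> K" using s by (intro K.add K.scale \<mu> \<mu>1) auto
      moreover have "enorm n ?x \<le> 1"
      proof -
        have "enorm n ?x \<le> \<bar>1 - s\<bar> * enorm n \<mu> + \<bar>s\<bar> * enorm n \<mu>1"
          using enorm_add_le[of n "\<lambda>i. (1 - s) * \<mu> i" "\<lambda>i. s * \<mu>1 i"] by (simp add: enorm_scale)
        also have "\<dots> \<le> (1 - s) * 1 + s * 1" using s \<mu>(2) \<mu>1(2) by (intro add_mono mult_mono) auto
        finally show ?thesis by simp
      qed
      ultimately have "L.rnorm (?y \<mu>) \<le> L.rnorm (?y ?x)" by (intro min) simp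
      \<comment> \<open>Keeping the point \<open>?l\<close> instead of projecting anew can only
        overestimate the distance to \<open>L\<close>, and makes the compared vector affine in
        \<open>s\<close>.\<close>
      also have "\<dots> \<le> enorm m (vdiff (?y ?x) ?l)" unfolding L.rnorm_def by (intro L.proj)
      also have "vdiff (?y ?x) ?l = (\<lambda>i. ?d i + s * vdiff (matvec m n G \<mu>1) (matvec m n G \<mu>) i)"
        unfolding matvec_add matvec_scale by (auto simp: vdiff_def algebra_simps)
      finally show "enorm m ?d \<le> enorm m (\<lambda>i. ?d i + s * vdiff (matvec m n G \<mu>1) (matvec m n G \<mu>) i)"
        by (simp add: L.rnorm_def)
    qed
    hence "ip m ?v (vdiff (matvec m n G \<mu>1) (matvec m n G \<mu>)) \<le> 0"
      unfolding vd using R by (simp add: divide_nonneg_pos)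
    hence "1 < ip m ?v (matvec m n G \<mu>)" using \<mu>1(3) by (simp only: ip_vdiff)
    \<comment> \<open>Here the bound 1 in \<open>dual\<close> meets the unit length of
      \<open>w\<close>: <v, G \<mu>> = <v, G \<mu> - w> + <v, w> is at most 0 + 1, contradicting
      first-order optimality.\<close>
    moreover have "ip m ?v (?y \<mu>) \<le> 0"
    proof -
      have "ip m ?d (?y \<mu>) = ip m ?d ?d"
        using L.ip_residual_proj[of "?y \<mu>"] by (simp only: ip_vdiff(2))
      thus ?thesis unfolding vd enorm_square[symmetric] using R by simp
    qed
    moreover have "ip m ?v w \<le> 1" using ip_le_enorm_mult[of m ?v w] \<open>enorm m ?v = 1\<close> w(2) by simp
    ultimately show ?thesis by (simp only: ip_vdiff)
  qed
qed

section \<open>The intersection is nontrivial when \<open>K\<close> is large\<close>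

lemma abs_ip_lipschitz:
  assumes "enorm m w = 1"
  shows "\<bar>\<bar>ip m w x\<bar> - \<bar>ip m w y\<bar>\<bar> \<le> enorm m (vdiff x y)"
proof -
  have "\<bar>\<bar>ip m w x\<bar> - \<bar>ip m w y\<bar>\<bar> \<le> \<bar>ip m w (vdiff x y)\<bar>" by (simp add: ip_vdiff)
  also have "\<dots> \<le> enorm m (vdiff x y)" using abs_ip_le_enorm_mult[of m w] assms by simp
  finally show ?thesis .
qed

lemma expectation_abs_ip_le:
  assumes "enorm m w = 1"
  shows "(\<integral>g. \<bar>ip m w (ext0 m g)\<bar> \<partial>gauss_vec m) \<le> 1"
proof -
  interpret w: gauss_lipschitz "{..<m}" "\<lambda>g. \<bar>ip m w (ext0 m g)\<bar>"
    by (rule gauss_lipschitz_ext0) (rule abs_ip_lipschitz[OF assms])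
  have sq: "\<bar>ip m w (ext0 m g)\<bar>\<^sup>2 = (\<Sum>k<m. \<Sum>l<m. (w k * w l) * (g k * g l))" for g
    unfolding power2_abs ip_ext0 by (simp add: ip_def power2_eq_square sum_product mult_ac)
  have "w.expectation (\<lambda>g. \<bar>ip m w (ext0 m g)\<bar>\<^sup>2) = (\<Sum>k<m. \<Sum>l<m. (w k * w l) * w.expectation (\<lambda>g. g k * g l))"
    unfolding sq using integral_PiM_mult_components(1)[of "{..<m}"]
    by (subst Bochner_Integration.integral_sum, (intro Bochner_Integration.integrable_sum integrable_mult_right; simp),
        intro sum.cong refl, subst Bochner_Integration.integral_sum) auto
  also have "\<dots> = (\<Sum>k<m. \<Sum>l<m. if l = k then w k * w k else 0)"
    using integral_PiM_mult_components(2)[of "{..<m}"] by (intro sum.cong) auto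
  also have "\<dots> = (enorm m w)\<^sup>2" unfolding enorm_square by (simp add: ip_def)
  finally show ?thesis using w.expectation_le_sqrt(1) assms by (simp add: gauss_vec_def)
qed

text \<open>The spheres exchange roles: the outer set consists of unit vectors nonnegative on the
  pointed subcone, the inner one is the unit sphere of \<open>K\<close>, and the matrix is
  transposed. By \<open>cone_meets_of_dual_bound\<close> a trivial intersection yields an outer
  vector with all inner values at most 1.\<close>

lemma image_misses_cone_unlikely:
  assumes K: "closed_convex_cone n K" and L: "closed_convex_cone m L" and L_ne: "L \<noteq> {(\<lambda>_. 0)}" and t: "1 \<le> t"
    and gap: "19 * sqrt t \<le> sqrt (stat_dim n K) - sqrt (real m - stat_dim m L)"
  shows "measure (gauss_mat m n) {G \<in> space (gauss_mat m n). L \<inter> matvec m n G ` K = {(\<lambda>_. 0)}} \<le> exp (- t)"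
proof -
  interpret K: cone n K by unfold_locales fact
  interpret L: cone m L by unfold_locales fact
  obtain L' w where L': "closed_convex_cone m L'" "L' \<subseteq> L" and w: "w \<in> L'" "enorm m w = 1" "(\<lambda>i. - w i) \<notin> L'"
    and dual: "\<And>v g. enorm m v = 1 \<Longrightarrow> (\<forall>x\<in>L'. 0 \<le> ip m v x) \<Longrightarrow> - ip m v g \<le> L.rnorm g + \<bar>ip m w g\<bar>"
    using pointed_subcone[OF L L_ne] by metis
  define q where "q = (\<lambda>g. L.rnorm g + \<bar>ip m w g\<bar>)"
  interpret p: gauss_lipschitz "{..<n}" "\<lambda>g. K.pnorm (ext0 n g)" by (rule K.gauss_lipschitz_pnorm)
  interpret ql: gauss_lipschitz "{..<m}" "\<lambda>g. L.rnorm (ext0 m g)" by (rule L.gauss_lipschitz_rnorm)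
  interpret qw: gauss_lipschitz "{..<m}" "\<lambda>g. \<bar>ip m w (ext0 m g)\<bar>"
    by (rule gauss_lipschitz_ext0) (rule abs_ip_lipschitz[OF w(2)])
  \<comment> \<open>\<open>q\<close> is a sum of two 1-Lipschitz functions; its half fits the
    locale, and a deviation \<open>r\<close> of the half is one of \<open>2 * r\<close> for
    \<open>q\<close>.\<close>
  interpret q: gauss_lipschitz "{..<m}" "\<lambda>g. q (ext0 m g) / 2"
  proof (rule gauss_lipschitz_ext0)
    fix x y
    have "\<bar>q x - q y\<bar> \<le> 2 * enorm m (vdiff x y)"
      using L.rnorm_lipschitz[of x y] abs_ip_lipschitz[OF w(2), of x y] unfolding q_def by linarith
    thus "\<bar>q x / 2 - q y / 2\<bar> \<le> enorm m (vdiff x y)"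
      by (simp flip: diff_divide_distrib)
  qed
  define r where "r = 4 * sqrt t"
  have st: "1 \<le> sqrt t" using t by simp
  have r: "0 \<le> r" using st by (simp add: r_def)
  let ?p = "p.expectation (\<lambda>g. K.pnorm (ext0 n g))" and ?q = "ql.expectation (\<lambda>g. q (ext0 m g) / 2)"
  have "sqrt (stat_dim n K) \<le> ?p + 2"
    using p.expectation_le_sqrt(2) by (simp add: K.stat_dim_eq gauss_vec_def)
  moreover have "2 * ?q \<le> sqrt (real m - stat_dim m L) + 1"
  proof -
    have "2 * ?q = ql.expectation (\<lambda>g. L.rnorm (ext0 m g)) + ql.expectation (\<lambda>g. \<bar>ip m w (ext0 m g)\<bar>)"
      unfolding q_def using ql.integrable qw.integrable by simp
    moreover have "ql.expectation (\<lambda>g. L.rnorm (ext0 m g)) \<le> sqrt (real m - stat_dim m L)"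
      using ql.expectation_le_sqrt(1) by (simp add: L.codim_eq gauss_vec_def)
    ultimately show ?thesis using expectation_abs_ip_le[OF w(2)] by (simp add: gauss_vec_def)
  qed
  \<comment> \<open>With \<open>s = sqrt t\<close>, the deviations \<open>12 * s\<close> and the
    constants 4 + 2 + 1, at most \<open>7 * s\<close>, exhaust the gap
    \<open>19 * s\<close>.\<close>
  moreover have "2 * (y + 4 * s) \<le> x - 4 * s - 4"
    if "c \<le> x + 2" "2 * y \<le> d + 1" "19 * s \<le> c - d" "1 \<le> s" for c d x y s :: real
  proof -
    have "2 * y + 19 * s - 3 \<le> x" using that(1-3) by simp
    thus ?thesis using that(4) by simp
  qed
  ultimately have a: "2 * (?q + r) \<le> ?p - r - 4" using gap st unfolding r_def by blast
  have q0: "0 \<le> ?q" by (simp add: q_def)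
  have "0 \<le> x - r" if "2 * (y + r) \<le> x - r - 4" "0 \<le> y" for x y :: real
    using that r by (simp add: algebra_simps)
  from this[OF a q0] have pr: "0 \<le> ?p - r" .
  let ?D = "{G \<in> space (gauss_mat m n). L \<inter> matvec m n G ` K = {(\<lambda>_. 0)}}"
  have "?D = space (gauss_mat m n) - {G \<in> space (gauss_mat m n). L \<inter> matvec m n G ` K \<noteq> {(\<lambda>_. 0)}}" by blast
  also have "\<dots> \<in> sets (gauss_mat m n)" by (intro sets.compl_sets sets_image_meets_cone[OF K L])
  finally have D: "?D \<in> sets (gauss_mat m n)" .
  \<comment> \<open>\<open>compact_dual_sphere\<close> speaks of nonpositive inner products, so the
    dual of \<open>L'\<close> is written as the polar of \<open>- L'\<close>.\<close>
  let ?S = "{v \<in> Rn m. enorm m v = 1 \<and> (\<forall>x\<in>(\<lambda>x i. - x i) ` L'. ip m v x \<le> 0)}"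
  let ?sw = "\<lambda>H. \<lambda>k\<in>{..<m} \<times> {..<n}. H (prod.swap k) :: real"
  let ?E = "{H \<in> space (gauss_mat n m). ?sw H \<in> ?D}"
  have swap: "inj_on prod.swap ({..<m} \<times> {..<n})" "prod.swap ` ({..<m} \<times> {..<n}) \<subseteq> {..<n} \<times> {..<m}"
    by (auto simp: inj_on_def)
  \<comment> \<open>If \<open>H\<close> is a Gaussian n by m matrix, its transpose
    \<open>?sw H\<close> is a Gaussian m by n matrix, so the event may be measured in terms of
    \<open>H\<close>.\<close>
  note E = measure_PiM_reindex[OF swap D[unfolded gauss_mat_def], folded gauss_mat_def]
  have adj: "ip n \<mu> (matvec n m H v) = ip m v (matvec m n (?sw H) \<mu>)" for \<mu> v H
  proof -
    have "ip n \<mu> (matvec n m H v) = (\<Sum>j<n. \<Sum>i<m. \<mu> j * (H (j, i) * v i))"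
      by (simp add: ip_def matvec_def sum_distrib_left)
    also have "\<dots> = (\<Sum>i<m. \<Sum>j<n. \<mu> j * (H (j, i) * v i))" by (rule sum.swap)
    also have "\<dots> = ip m v (matvec m n (?sw H) \<mu>)"
      by (simp add: ip_def matvec_def sum_distrib_left mult_ac)
    finally show ?thesis .
  qed
  have "measure (gauss_mat m n) ?D = measure (gauss_mat n m) ?E" using E(1) by simp
  also have "\<dots> \<le> 2 * (\<P>(g in gauss_vec n. K.pnorm (ext0 n g) \<le> ?p - r)
          + \<P>(h in gauss_vec m. (?p - r) - 4 \<le> q (ext0 m h)))"
  proof (rule gaussian_min_max[where \<kappa> = "- 1", OF compact_dual_sphere[of m "(\<lambda>x i. - x i) ` L'"] _ K.compact_sphere])
    show "(\<lambda>g. K.pnorm (ext0 n g)) \<in> borel_measurable (gauss_vec n)" using p.meas by (simp add: gauss_vec_def)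
    show "(\<lambda>g. q (ext0 m g)) \<in> borel_measurable (gauss_vec m)"
      unfolding q_def gauss_vec_def using ql.meas qw.meas by (intro borel_measurable_add)
    show "- 1 * ip m v g \<le> q g" if "v \<in> ?S" for v g
      using dual[of v g] that by (simp add: q_def ip_linear)
    show "\<exists>\<mu>\<in>{x \<in> K. enorm n x = 1}. ?p - r < ip n \<mu> g" if "g \<in> Rn n" "?p - r < K.pnorm g" for g
    proof -
      have "0 < K.pnorm g" using pr that(2) by (rule le_less_trans)
      from K.pnorm_attained[OF this] show ?thesis using that by auto
    qed
    show "?E \<in> sets (gauss_mat n m)" by (rule E(2))
    fix H assume H: "H \<in> ?E"
    show "\<exists>v\<in>?S. \<forall>\<mu>\<in>{x \<in> K. enorm n x = 1}. ip n \<mu> (matvec n m H v) \<le> 1"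
    proof (rule ccontr)
      assume neg: "\<not> ?thesis"
      have "\<exists>\<mu>\<in>K. matvec m n (?sw H) \<mu> \<in> L' \<and> 0 < enorm m (matvec m n (?sw H) \<mu>)"
      proof (rule cone_meets_of_dual_bound[OF K L'(1) w])
        fix v assume v: "v \<in> Rn m" "enorm m v = 1" "\<forall>x\<in>L'. 0 \<le> ip m v x"
        hence "v \<in> ?S" by (simp add: ip_linear)
        hence "\<not> (\<forall>\<mu>\<in>{x \<in> K. enorm n x = 1}. ip n \<mu> (matvec n m H v) \<le> 1)" using neg by blast
        thus "\<exists>\<mu>\<in>K. enorm n \<mu> = 1 \<and> 1 < ip m v (matvec m n (?sw H) \<mu>)" unfolding adj by (auto simp: not_le)
      qed
      hence "L \<inter> matvec m n (?sw H) ` K \<noteq> {(\<lambda>_. 0)}" using image_meets_cone_iff[OF K L] L'(2) by blast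
      thus False using H by simp
    qed
  qed auto
  also have "\<P>(g in gauss_vec n. K.pnorm (ext0 n g) \<le> ?p - r) \<le> exp (- r\<^sup>2 / 4)"
    using p.lower_tail[OF r] by (simp add: gauss_vec_def)
  also have "\<P>(h in gauss_vec m. (?p - r) - 4 \<le> q (ext0 m h))
      \<le> \<P>(h in gauss_vec m. ?q + r \<le> q (ext0 m h) / 2)"
    unfolding gauss_vec_def
  proof (rule ql.finite_measure_mono)
    show "{h \<in> space ql.M. ?q + r \<le> q (ext0 m h) / 2} \<in> ql.events" using q.meas by measurable
    have "?q + r \<le> x / 2" if "(?p - r) - 4 \<le> x" for x
      using order_trans[OF a that] by simp
    thus "{h \<in> space ql.M. (?p - r) - 4 \<le> q (ext0 m h)} \<subseteq> {h \<in> space ql.M. ?q + r \<le> q (ext0 m h) / 2}" by blast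
  qed
  also have "\<dots> \<le> exp (- r\<^sup>2 / 4)" using q.upper_tail[OF r] by (simp add: gauss_vec_def)
  also have "2 * (exp (- r\<^sup>2 / 4) + exp (- r\<^sup>2 / 4)) \<le> exp (- t)"
    using four_exp_le[OF t] by (simp add: r_def)
  finally show ?thesis by simp
qed

theorem theorem1p1:
  shows "\<exists>C::real. C > 0 \<and>
    (\<forall>(n::nat) (m::nat) K L (t::real).
       closed_convex_cone n K \<longrightarrow> K \<noteq> {(\<lambda>i. 0)} \<longrightarrow>
       closed_convex_cone m L \<longrightarrow> L \<noteq> {(\<lambda>i. 0)} \<longrightarrow> t \<ge> 1 \<longrightarrow>
       (sqrt (stat_dim n K) - sqrt (real m - stat_dim m L) \<le> - C * sqrt t \<longrightarrow>
          measure (gauss_mat m n)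
            {G \<in> space (gauss_mat m n). L \<inter> matvec m n G ` K = {(\<lambda>i. 0)}} \<ge> 1 - exp (- t))
     \<and> (sqrt (stat_dim n K) - sqrt (real m - stat_dim m L) \<ge> C * sqrt t \<longrightarrow>
          measure (gauss_mat m n)
            {G \<in> space (gauss_mat m n). L \<inter> matvec m n G ` K \<noteq> {(\<lambda>i. 0)}} \<ge> 1 - exp (- t)))"
proof (intro exI[of _ 19] conjI allI impI)
  fix n m :: nat and K L and t :: real
  assume K: "closed_convex_cone n K" and L: "closed_convex_cone m L" "L \<noteq> {(\<lambda>i. 0)}" and t: "1 \<le> t"
  let ?D = "{G \<in> space (gauss_mat m n). L \<inter> matvec m n G ` K \<noteq> {(\<lambda>i. 0)}}"
    and ?D' = "{G \<in> space (gauss_mat m n). L \<inter> matvec m n G ` K = {(\<lambda>i. 0)}}"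
  interpret prob_space "gauss_mat m n"
    unfolding gauss_mat_def by (rule prob_space_gauss_on)
  have "?D' = space (gauss_mat m n) - ?D" by blast
  hence compl: "prob ?D' = 1 - prob ?D"
    using prob_compl[OF sets_image_meets_cone[OF K L(1)]] by simp
  {
    assume "sqrt (stat_dim n K) - sqrt (real m - stat_dim m L) \<le> - 19 * sqrt t"
    thus "1 - exp (- t) \<le> prob ?D'"
      using image_meets_cone_unlikely[OF K L(1) t] unfolding compl by simp
  next
    assume "19 * sqrt t \<le> sqrt (stat_dim n K) - sqrt (real m - stat_dim m L)"
    from image_misses_cone_unlikely[OF K L t this]
    show "1 - exp (- t) \<le> prob ?D" unfolding compl by simp
  }
qed simp

end
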